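(* For list contextual recommendation, consider the algorithm which in each round $t$ computes the discretization $D=\{p_0,\dots,p_k\}$ of the curvature path of the current knowledge set $K_t$ with $k=200d^4$, picks for each $p_i\in D$ an arbitrary $x_i\in\arg\max_{x\in\mathcal{X}_t}\langle p_i,x\rangle$, and plays the list $L_t=\{x_i: p_i\in D\}$. For every $T$, every hidden point $w^*\in\mathsf{B}$ and every adversarial sequence of action sets, this algorithm incurs total regret at most $O(d^2\log d)$.
   Context: $\mathsf{B}=\{w\in\mathbb{R}^d:\|w\|_2\le1\}$, $+$ denotes Minkowski sum, $\mathsf{cg}(L)=\big(\int_L x\,dx\big)/\big(\int_L 1\,dx\big)$. List contextual recommendation: there is a hidden $w^*\in\mathsf{B}$. In each round $t=1,\dots,T$ the learner is shown a set $\mathcal{X}_t\subseteq\mathsf{B}$, outputs a list $L_t\subseteq\mathcal{X}_t$, and observes some $x_t^*\in\arg\max_{x\in\mathcal{X}_t}\langle x,w^*\rangle$ (ties broken adversarially). The loss in round $t$ is $\langle w^*,x_t^*\rangle-\max_{x\in L_t}\langle w^*,x\rangle$ and the total regret is the sum of losses. The knowledge set is $K_1=\mathsf{B}$ and $K_{t+1}=K_t\cap\bigcap_{x\in L_t}\{w:\langle x_t^*-x,w\rangle\ge0\}$. The curvature path of a convex set $K$ is $\rho_K(r)=\mathsf{cg}(K+r\mathsf{B})$, $r\in[0,\infty]$. The discretization with parameter $k$ is a set $D=\{p_0,\dots,p_k\}\subset K$ obtained by taking an invertible linear map $A$ and point $q$ with $q+\mathsf{B}\subseteq A(K)\subseteq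 q+d\mathsf{B}$, dividing the path $\{A\rho_K(r):r\in[0,\infty]\}$ into $k$ pieces of equal length, and letting $Ap_0,\dots,Ap_k$ be the endpoints; it satisfies: for every $r$ there is $p_i\in D$ with $|\langle\rho_K(r)-p_i,u\rangle|\le\frac{4d^3}{k}\mathsf{width}(K;u)$ for all unit $u$, where $\mathsf{width}(K;u)=\max_{x\in K}\langle u,x\rangle-\min_{x\in K}\langle u,x\rangle$. *)

theory Defs
  imports "HOL-Analysis.Analysis"
begin

text \<open>Vectors of R^d are represented as functions nat => real that vanish at
indices >= d (the dimension d is a natural number so that the O(.) constant
can be uniform in d).\<close>

type_synonym vec = "nat \<Rightarrow> real"

definition Rd :: "nat \<Rightarrow> vec set" where
  "Rd d = {x. \<forall>i\<ge>d. x i = 0}"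

definition inner_d :: "nat \<Rightarrow> vec \<Rightarrow> vec \<Rightarrow> real" where
  "inner_d d x y = (\<Sum>i<d. x i * y i)"

definition norm_d :: "nat \<Rightarrow> vec \<Rightarrow> real" where
  "norm_d d x = sqrt (inner_d d x x)"

definition vadd :: "vec \<Rightarrow> vec \<Rightarrow> vec" where
  "vadd x y = (\<lambda>i. x i + y i)"

definition vsub :: "vec \<Rightarrow> vec \<Rightarrow> vec" where
  "vsub x y = (\<lambda>i. x i - y i)"

definition cball_d :: "nat \<Rightarrow> real \<Rightarrow> vec set" where
  "cball_d d r = {y \<in> Rd d. norm_d d y \<le> r}"

definition mink :: "nat \<Rightarrow> vec set \<Rightarrow> real \<Rightarrow> vec set" where
  "mink d K r = {vadd x y | x y. x \<in> K \<and> y \<in> cball_d d r}"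

definition pad :: "nat \<Rightarrow> vec \<Rightarrow> vec" where
  "pad d x = (\<lambda>i. if i < d then x i else 0)"

abbreviation leb_d :: "nat \<Rightarrow> vec measure" where
  "leb_d d \<equiv> Pi\<^sub>M {..<d} (\<lambda>_. lborel)"

definition vol_d :: "nat \<Rightarrow> vec set \<Rightarrow> real" where
  "vol_d d L = measure (leb_d d) {x \<in> space (leb_d d). pad d x \<in> L}"

definition cg :: "nat \<Rightarrow> vec set \<Rightarrow> vec" where
  "cg d L = (\<lambda>i. if i < d then
      (LINT x|leb_d d. indicator L (pad d x) * x i) / vol_d d L else 0)"

definition rho :: "nat \<Rightarrow> vec set \<Rightarrow> real \<Rightarrow> vec" where
  "rho d K r = cg d (mink d K r)"

definition rho_inf :: "nat \<Rightarrow> vec set \<Rightarrow> vec" where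
  "rho_inf d K = (\<lambda>i. Lim at_top (\<lambda>r. rho d K r i))"

text \<open>The curvature path over r in [0,infinity], reparametrised by s in [0,1],
r = s/(1-s) (arc length is invariant under this reparametrisation).\<close>
definition curv_path :: "nat \<Rightarrow> vec set \<Rightarrow> real \<Rightarrow> vec" where
  "curv_path d K s = (if s < 1 then rho d K (s / (1 - s)) else rho_inf d K)"

definition arclen :: "nat \<Rightarrow> (real \<Rightarrow> vec) \<Rightarrow> real \<Rightarrow> real \<Rightarrow> ereal" where
  "arclen d \<gamma> a b = (SUP nt \<in> {(n, t). t 0 = a \<and> t n = b \<and> (\<forall>i<n. t i \<le> t (Suc i))}.
      ereal (\<Sum>i<fst nt. norm_d d (vsub (\<gamma> (snd nt (Suc i))) (\<gamma> (snd nt i)))))"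

definition lin_app :: "nat \<Rightarrow> (nat \<Rightarrow> nat \<Rightarrow> real) \<Rightarrow> vec \<Rightarrow> vec" where
  "lin_app d M x = (\<lambda>i. if i < d then (\<Sum>j<d. M i j * x j) else 0)"

definition invertible_d :: "nat \<Rightarrow> (nat \<Rightarrow> nat \<Rightarrow> real) \<Rightarrow> bool" where
  "invertible_d d M \<longleftrightarrow> (\<exists>N. \<forall>x\<in>Rd d. lin_app d N (lin_app d M x) = x \<and> lin_app d M (lin_app d N x) = x)"

definition is_discretization :: "nat \<Rightarrow> nat \<Rightarrow> vec set \<Rightarrow> (nat \<Rightarrow> vec) \<Rightarrow> bool" where
  "is_discretization d k K p \<longleftrightarrow>
    (\<exists>M q. invertible_d d M \<and> q \<in> Rd d \<and>
       {vadd q y | y. y \<in> cball_d d 1} \<subseteq> lin_app d M ` K \<and>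
       lin_app d M ` K \<subseteq> {vadd q y | y. y \<in> cball_d d (real d)} \<and>
       (\<exists>s. s 0 = 0 \<and> s k = 1 \<and> (\<forall>i<k. s i \<le> s (Suc i)) \<and>
          (\<forall>i<k. arclen d (lin_app d M \<circ> curv_path d K) (s i) (s (Suc i))
                 = arclen d (lin_app d M \<circ> curv_path d K) 0 1 / ereal (real k)) \<and>
          (\<forall>i\<le>k. p i = curv_path d K (s i))))"

text \<open>A run of the algorithm for T rounds in dimension d with hidden point w.
X t: action set, xs t: observed best action x_t^*, K t: knowledge set,
p t: the discretization used in round t, xi t i: the chosen maximiser for p t i,
L t: the played list.\<close>
definition alg_run ::
  "nat \<Rightarrow> nat \<Rightarrow> vec \<Rightarrow> (nat \<Rightarrow> vec set) \<Rightarrow> (nat \<Rightarrow> vec) \<Rightarrow> (nat \<Rightarrow> vec set)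
   \<Rightarrow> (nat \<Rightarrow> nat \<Rightarrow> vec) \<Rightarrow> (nat \<Rightarrow> nat \<Rightarrow> vec) \<Rightarrow> (nat \<Rightarrow> vec set) \<Rightarrow> bool" where
  "alg_run d T w X xs K p xi L \<longleftrightarrow>
     (let k = 200 * d ^ 4 in
      K 1 = cball_d d 1 \<and>
      (\<forall>t\<in>{1..T}.
         X t \<subseteq> cball_d d 1 \<and>
         is_discretization d k (K t) (p t) \<and>
         (\<forall>i\<le>k. xi t i \<in> X t \<and> (\<forall>x\<in>X t. inner_d d (p t i) x \<le> inner_d d (p t i) (xi t i))) \<and>
         L t = xi t ` {0..k} \<and>
         xs t \<in> X t \<and> (\<forall>x\<in>X t. inner_d d x w \<le> inner_d d (xs t) w) \<and>
         K (Suc t) = K t \<inter> (\<Inter>x\<in>L t. {v \<in> Rd d. inner_d d (vsub (xs t) x) v \<ge> 0})))"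

definition regret :: "nat \<Rightarrow> nat \<Rightarrow> vec \<Rightarrow> (nat \<Rightarrow> vec) \<Rightarrow> (nat \<Rightarrow> vec set) \<Rightarrow> real" where
  "regret d T w xs L = (\<Sum>t=1..T. inner_d d w (xs t) - Max ((\<lambda>x. inner_d d w x) ` L t))"

end

theory Submission
  imports Defs
begin

text \<open>
  For a radius \<open>r\<close> consider the potential \<open>vol (K\<^sub>t + r B)\<close>. The curvature path contains the centroid of
  \<open>K\<^sub>t + r B\<close>, so some point \<open>p\<^sub>i\<close> of the discretization is close to it, relative to the width of \<open>K\<^sub>t\<close>
  in every direction. In a round of loss at least \<open>h\<close> the new knowledge set is cut by a half-space with
  \<open>p\<^sub>i\<close> on its boundary or outside it, and the width of \<open>K\<^sub>t\<close> in the direction of the cut is of order \<open>h\<close> or more.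
  With \<open>r = h / (100 d)\<close> the cut passes so close to the centroid that the potential drops by a factor
  \<open>1 - 1/(32 d)\<close>. As the potential always lies between \<open>r\<^sup>d vol B\<close> and \<open>(1 + r)\<^sup>d vol B\<close>, there are at
  most \<open>32 d\<^sup>2 ln (1 + 100 d / h)\<close> such rounds; summing over \<open>h = 2\<^sup>-\<^sup>j\<close> gives the bound.

  The discretization is fine enough because the curvature path has length \<open>O(d\<^sup>3)\<close> in the normalized
  coordinates: volume and moments of \<open>K + r B\<close> are polynomials in \<open>r\<close> of degree at most \<open>d + 1\<close>, so every
  coordinate of the path is a rational function that takes each value at most \<open>d + 1\<close> times, unless it
  is constant. The polynomiality is elementary for \<open>K + r Z\<close> with a zonotope \<open>Z\<close>, and the ball is a
  limit of zonotopes.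
\<close>

subsection \<open>Vectors and convex bodies\<close>

text \<open>The ball \<open>r B\<close> is there because nothing bounds the volume of
  \<open>K t\<close> from below: cuts can flatten it at will. The suitable radius depends on the
  loss level \<open>h\<close>, which the algorithm does not know; following the path over all radii
  lets one list serve every level, and the analysis then uses a separate potential for each
  \<open>h\<close>. The price is that a half-space containing the new knowledge set contains the
  enlarged set only up to a slack of \<open>2 r\<close>, so this slack and the discretization error
  must both be small against the width divided by \<open>d\<close>.

  A cut near the centroid is shown to remove only a fraction of order \<open>1/d\<close>. This is
  affordable: it accounts for one factor \<open>d\<close> of the bound, and the exponent of the
  potential for the other. Summing over the scales costs no further logarithm, since the number of
  rounds grows only linearly in \<open>j\<close> while the weight is \<open>2^-j\<close>.

  The path stays short because its points never leave \<open>K\<close>, although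
  \<open>K + r B\<close> grows without bound; a normalized coordinate is thus confined to an
  interval of length \<open>2 d\<close>, whatever \<open>r\<close> is.\<close>

definition vscale :: "real \<Rightarrow> vec \<Rightarrow> vec" where
  "vscale c x = (\<lambda>i. c * x i)"

lemmas vec_defs = vadd_def vsub_def vscale_def

lemma inner_d_commute: "inner_d d x y = inner_d d y x"
  unfolding inner_d_def by (simp add: mult.commute)

lemma inner_d_add_right: "inner_d d x (vadd y z) = inner_d d x y + inner_d d x z"
  unfolding inner_d_def vadd_def by (simp add: algebra_simps sum.distrib)

lemma inner_d_sub_right: "inner_d d x (vsub y z) = inner_d d x y - inner_d d x z"
  unfolding inner_d_def vsub_def by (simp add: algebra_simps sum_subtractf)

lemma inner_d_scale_right: "inner_d d x (vscale c y) = c * inner_d d x y"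
  unfolding inner_d_def vscale_def by (simp add: algebra_simps sum_distrib_left)

lemma inner_d_add_left: "inner_d d (vadd y z) x = inner_d d y x + inner_d d z x"
  by (simp add: inner_d_commute[of d _ x] inner_d_add_right)

lemma inner_d_sub_left: "inner_d d (vsub y z) x = inner_d d y x - inner_d d z x"
  by (simp add: inner_d_commute[of d _ x] inner_d_sub_right)

lemma inner_d_scale_left: "inner_d d (vscale c y) x = c * inner_d d y x"
  by (simp add: inner_d_commute[of d _ x] inner_d_scale_right)

lemmas inner_d_simps = inner_d_add_right inner_d_sub_right inner_d_scale_right
  inner_d_add_left inner_d_sub_left inner_d_scale_left

lemma norm_d_L2_set: "norm_d d x = L2_set x {..<d}"
  unfolding norm_d_def inner_d_def L2_set_def by (simp add: power2_eq_square)

lemma norm_d_nonneg [simp]: "0 \<le> norm_d d x"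
  by (simp add: norm_d_L2_set)

lemma norm_d_power2: "(norm_d d x)\<^sup>2 = inner_d d x x"
  unfolding norm_d_def inner_d_def by (simp add: sum_nonneg)

lemma norm_d_triangle: "norm_d d (vadd x y) \<le> norm_d d x + norm_d d y"
  unfolding norm_d_L2_set vadd_def by (rule L2_set_triangle_ineq)

lemma norm_d_scale: "norm_d d (vscale c x) = \<bar>c\<bar> * norm_d d x"
proof -
  have "inner_d d (vscale c x) (vscale c x) = c\<^sup>2 * inner_d d x x"
    by (simp add: inner_d_simps power2_eq_square)
  then show ?thesis
    by (simp add: norm_d_def real_sqrt_mult)
qed

lemma norm_d_triangle_sub: "norm_d d (vsub x y) \<le> norm_d d x + norm_d d y"
proof -
  have "vsub x y = vadd x (vscale (-1) y)"
    by (auto simp: vec_defs)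
  then show ?thesis
    using norm_d_triangle[of d x "vscale (-1) y"] by (simp add: norm_d_scale)
qed

lemma inner_d_Cauchy_Schwarz: "\<bar>inner_d d x y\<bar> \<le> norm_d d x * norm_d d y"
proof -
  have "\<bar>inner_d d x y\<bar> \<le> (\<Sum>i<d. \<bar>x i\<bar> * \<bar>y i\<bar>)"
    unfolding inner_d_def by (rule order_trans[OF sum_abs]) (simp add: abs_mult)
  also have "\<dots> \<le> norm_d d x * norm_d d y"
    unfolding norm_d_L2_set by (rule L2_set_mult_ineq)
  finally show ?thesis .
qed

lemma norm_d_le_sum_abs: "norm_d d x \<le> (\<Sum>i<d. \<bar>x i\<bar>)"
  unfolding norm_d_L2_set by (rule L2_set_le_sum_abs)

lemma abs_component_le_norm_d:
  assumes "i < d" shows "\<bar>x i\<bar> \<le> norm_d d x"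
proof -
  have "(x i)\<^sup>2 \<le> (\<Sum>i<d. (x i)\<^sup>2)"
    by (rule member_le_sum) (use assms in auto)
  then have "sqrt ((x i)\<^sup>2) \<le> sqrt (\<Sum>i<d. (x i)\<^sup>2)"
    by (rule real_sqrt_le_mono)
  then show ?thesis
    by (simp add: norm_d_L2_set L2_set_def)
qed

lemma norm_d_eq_0_Rd:
  assumes "x \<in> Rd d" "norm_d d x = 0" shows "x = (\<lambda>i. 0)"
proof
  fix i
  show "x i = 0"
    using assms abs_component_le_norm_d[of i d x] by (cases "i < d") (auto simp: Rd_def)
qed

lemma Rd_ops [simp]:
  "x \<in> Rd d \<Longrightarrow> y \<in> Rd d \<Longrightarrow> vadd x y \<in> Rd d"
  "x \<in> Rd d \<Longrightarrow> y \<in> Rd d \<Longrightarrow> vsub x y \<in> Rd d"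
  "x \<in> Rd d \<Longrightarrow> vscale c x \<in> Rd d"
  "(\<lambda>i. 0) \<in> Rd d"
  "pad d z \<in> Rd d"
  by (auto simp: Rd_def vec_defs pad_def)

lemma cball_d_Rd: "x \<in> cball_d d r \<Longrightarrow> x \<in> Rd d"
  by (simp add: cball_d_def)

lemma continuous_inner_d [continuous_intros]: "continuous_on S (inner_d d u)"
  unfolding inner_d_def
  by (intro continuous_on_sum continuous_on_mult continuous_on_const
      continuous_on_subset[OF continuous_on_product_coordinates]) auto

lemma continuous_norm_d [continuous_intros]: "continuous_on S (norm_d d)"
  unfolding norm_d_def inner_d_def
  by (intro continuous_on_real_sqrt continuous_on_sum continuous_on_mult
      continuous_on_subset[OF continuous_on_product_coordinates]) auto

lemma closed_Rd: "closed (Rd d)"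
proof -
  have "Rd d = (\<Inter>i\<in>{d..}. {x. x i = 0})"
    by (auto simp: Rd_def)
  moreover have "closed {x::vec. x i = 0}" for i
    by (rule closed_Collect_eq) (auto intro: continuous_on_product_coordinates)
  ultimately show ?thesis
    by (simp add: closed_INT)
qed

text \<open>Tychonoff. Vectors live in an infinite product, and compactness of the balls is reduced
  to this.\<close>

lemma compact_box: "compact {x::vec. \<forall>i. x i \<in> {a i..b i}}"
proof -
  have "compactin (product_topology (\<lambda>i::nat. euclidean) UNIV) (PiE UNIV (\<lambda>i. {a i..b i}))"
    by (subst compactin_PiE) auto
  then have "compact (PiE UNIV (\<lambda>i. {a i..b i}))"
    by (simp add: euclidean_product_topology)
  moreover have "PiE UNIV (\<lambda>i. {a i..b i}) = {x::vec. \<forall>i. x i \<in> {a i..b i}}"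
    by auto
  ultimately show ?thesis
    by simp
qed

lemma closed_cball_d: "closed (cball_d d r)"
proof -
  have "cball_d d r = Rd d \<inter> {x. norm_d d x \<le> r}"
    by (auto simp: cball_d_def)
  moreover have "closed {x. norm_d d x \<le> r}"
    by (intro closed_Collect_le continuous_norm_d continuous_on_const)
  ultimately show ?thesis
    using closed_Rd by (simp add: closed_Int)
qed

lemma compact_cball_d: "compact (cball_d d r)"
proof (rule compact_Int_closed[OF compact_box[of "\<lambda>i. -r" "\<lambda>i. r"] closed_cball_d, of d r,
      THEN back_subst[of compact]], rule Int_absorb1, cases "r < 0")
  case True
  have "cball_d d r = {}"
    using True by (auto simp: cball_d_def) (meson norm_d_nonneg not_le order.strict_trans1)
  then show "cball_d d r \<subseteq> {x. \<forall>i. x i \<in> {- r..r}}"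
    by simp
next
  case False
  show "cball_d d r \<subseteq> {x. \<forall>i. x i \<in> {- r..r}}"
  proof safe
    fix x i assume x: "x \<in> cball_d d r"
    show "x i \<in> {-r..r}"
    proof (cases "i < d")
      case True
      then show ?thesis
        using abs_component_le_norm_d[of i d x] x by (auto simp: cball_d_def)
    next
      case f: False
      then show ?thesis
        using x False by (auto simp: cball_d_def Rd_def)
    qed
  qed
qed

text \<open>\<open>mink\<close> adds only balls; the arguments below also add segments and
  zonotopes.\<close>

definition msum :: "vec set \<Rightarrow> vec set \<Rightarrow> vec set" where
  "msum K S = {vadd x y | x y. x \<in> K \<and> y \<in> S}"

lemma mink_msum: "mink d K r = msum K (cball_d d r)"
  by (simp add: mink_def msum_def)

lemma compact_msum:
  assumes "compact K" "compact S" shows "compact (msum K S)"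
proof -
  have "msum K S = (\<lambda>z. vadd (fst z) (snd z)) ` (K \<times> S)"
    by (force simp: msum_def)
  moreover have "continuous_on (K \<times> S) (\<lambda>z. vadd (fst z) (snd z))"
    unfolding vadd_def
    by (intro continuous_on_coordinatewise_then_product continuous_on_add
        continuous_on_compose2[OF continuous_on_product_coordinates continuous_on_fst]
        continuous_on_compose2[OF continuous_on_product_coordinates continuous_on_snd])
       (auto intro: continuous_intros)
  ultimately show ?thesis
    using assms by (auto intro!: compact_continuous_image compact_Times)
qed

definition vconvex :: "vec set \<Rightarrow> bool" where
  "vconvex K \<longleftrightarrow> (\<forall>x\<in>K. \<forall>y\<in>K. \<forall>t\<in>{0..1}. vadd (vscale (1 - t) x) (vscale t y) \<in> K)"

text \<open>No interior is demanded, so that points and segments are bodies too. Where interior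
  points matter, a ball inside \<open>K\<close> is assumed separately.\<close>

definition body :: "nat \<Rightarrow> vec set \<Rightarrow> bool" where
  "body d K \<longleftrightarrow> compact K \<and> vconvex K \<and> K \<subseteq> Rd d"

lemma vconvex_msum:
  assumes "vconvex K" "vconvex S" shows "vconvex (msum K S)"
  unfolding vconvex_def
proof (intro ballI)
  fix x y t :: _ assume "x \<in> msum K S" "y \<in> msum K S" and t: "t \<in> {0..1::real}"
  then obtain a b a' b' where *: "a \<in> K" "b \<in> S" "a' \<in> K" "b' \<in> S" "x = vadd a b" "y = vadd a' b'"
    by (auto simp: msum_def)
  have "vadd (vscale (1 - t) x) (vscale t y) =
     vadd (vadd (vscale (1 - t) a) (vscale t a')) (vadd (vscale (1 - t) b) (vscale t b'))"
    by (auto simp: vec_defs * algebra_simps)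
  then show "vadd (vscale (1 - t) x) (vscale t y) \<in> msum K S"
    using assms * t unfolding msum_def vconvex_def by blast
qed

lemma vconvex_cball_d: "vconvex (cball_d d r)"
  unfolding vconvex_def
proof (intro ballI)
  fix x y t :: _ assume *: "x \<in> cball_d d r" "y \<in> cball_d d r" and t: "t \<in> {0..1::real}"
  have "norm_d d (vadd (vscale (1 - t) x) (vscale t y)) \<le> (1 - t) * norm_d d x + t * norm_d d y"
    using norm_d_triangle[of d "vscale (1 - t) x" "vscale t y"] t by (simp add: norm_d_scale)
  also have "\<dots> \<le> (1 - t) * r + t * r"
    using * t by (intro add_mono mult_left_mono) (auto simp: cball_d_def)
  finally show "vadd (vscale (1 - t) x) (vscale t y) \<in> cball_d d r"
    using * by (simp add: cball_d_def algebra_simps)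
qed

lemma body_cball_d: "body d (cball_d d r)"
  by (auto simp: body_def compact_cball_d vconvex_cball_d cball_d_Rd)

lemma body_msum: "body d K \<Longrightarrow> body d S \<Longrightarrow> body d (msum K S)"
  unfolding body_def by (auto simp: compact_msum vconvex_msum) (auto simp: msum_def subset_iff)

lemma body_mink: "body d K \<Longrightarrow> body d (mink d K r)"
  unfolding mink_msum by (intro body_msum body_cball_d)

lemma body_bounded:
  assumes "body d K" obtains R where "R > 0" "K \<subseteq> cball_d d R"
proof (cases "K = {}")
  case False
  have "compact (norm_d d ` K)"
    using assms by (intro compact_continuous_image continuous_norm_d) (simp add: body_def)
  then obtain R where "\<forall>y\<in>norm_d d ` K. norm y \<le> R"
    using compact_imp_bounded bounded_iff by metis
  then have "K \<subseteq> cball_d d (max R 1)"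
    using assms by (force simp: body_def cball_d_def)
  then show ?thesis
    using that[of "max R 1"] by auto
qed (use that[of 1] in auto)

subsection \<open>Lebesgue measure on vectors\<close>

text \<open>The image under \<open>pad\<close> is a Borel measure on the type in which the sets
  themselves live. It is concentrated on \<open>Rd d\<close>, so coordinates beyond \<open>d\<close>
  are controlled only almost everywhere.\<close>

definition lebv :: "nat \<Rightarrow> vec measure" where
  "lebv d = distr (leb_d d) borel (pad d)"

abbreviation vol :: "nat \<Rightarrow> vec set \<Rightarrow> real" where
  "vol d \<equiv> measure (lebv d)"

lemma sets_lebv [simp, measurable_cong]: "sets (lebv d) = sets borel"
  by (simp add: lebv_def)

lemma space_lebv [simp]: "space (lebv d) = UNIV"
  by (simp add: lebv_def)

lemma measurable_vecI:
  assumes "\<And>i. (\<lambda>x. f x i) \<in> borel_measurable M"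
  shows "(f :: _ \<Rightarrow> vec) \<in> borel_measurable M"
proof -
  have "f \<in> measurable M (Pi\<^sub>M UNIV (\<lambda>i. borel))"
    by (rule measurable_PiM_single') (use assms in auto)
  then show ?thesis
    using measurable_cong_sets[OF refl sets_PiM_equal_borel] by blast
qed

lemma measurable_component [measurable]: "(\<lambda>x::vec. x i) \<in> borel_measurable borel"
  by (rule borel_measurable_continuous_onI) (rule continuous_on_product_coordinates)

lemma measurable_component':
  "f \<in> borel_measurable M \<Longrightarrow> (\<lambda>x. (f x :: vec) i) \<in> borel_measurable M"
  using measurable_compose[OF _ measurable_component] by blast

lemma measurable_vadd [measurable (raw)]:
  "f \<in> borel_measurable M \<Longrightarrow> g \<in> borel_measurable M \<Longrightarrow> (\<lambda>x. vadd (f x) (g x)) \<in> borel_measurable M"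
  unfolding vadd_def
  by (rule measurable_vecI, (rule borel_measurable_add borel_measurable_diff borel_measurable_times)?)
    (auto intro: measurable_component')

lemma measurable_vsub [measurable (raw)]:
  "f \<in> borel_measurable M \<Longrightarrow> g \<in> borel_measurable M \<Longrightarrow> (\<lambda>x. vsub (f x) (g x)) \<in> borel_measurable M"
  unfolding vsub_def
  by (rule measurable_vecI, (rule borel_measurable_add borel_measurable_diff borel_measurable_times)?)
    (auto intro: measurable_component')

lemma measurable_vscale [measurable (raw)]:
  "f \<in> borel_measurable M \<Longrightarrow> g \<in> borel_measurable M \<Longrightarrow> (\<lambda>x. vscale (f x) (g x)) \<in> borel_measurable M"
  unfolding vscale_def
  by (rule measurable_vecI, (rule borel_measurable_add borel_measurable_diff borel_measurable_times)?)
    (auto intro: measurable_component')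

lemma measurable_inner_d [measurable (raw)]:
  "f \<in> borel_measurable M \<Longrightarrow> g \<in> borel_measurable M \<Longrightarrow> (\<lambda>x. inner_d d (f x) (g x)) \<in> borel_measurable M"
  unfolding inner_d_def
  by (rule borel_measurable_sum, rule borel_measurable_times) (auto intro: measurable_component')

lemma measurable_norm_d [measurable (raw)]:
  "f \<in> borel_measurable M \<Longrightarrow> (\<lambda>x. norm_d d (f x)) \<in> borel_measurable M"
  unfolding norm_d_def by measurable

lemma measurable_pad [measurable]: "pad d \<in> borel_measurable (leb_d d)"
proof (rule measurable_vecI)
  fix i
  show "(\<lambda>x. pad d x i) \<in> borel_measurable (leb_d d)"
    using measurable_component_singleton[of i "{..<d}" "\<lambda>_. lborel :: real measure"]
    by (cases "i < d") (auto simp: pad_def)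
qed

lemma sets_borel_body: "body d K \<Longrightarrow> K \<in> sets borel"
  by (auto simp: body_def intro: borel_compact)

lemma sets_borel_cball_d [measurable]: "cball_d d r \<in> sets borel"
  by (rule sets_borel_body[OF body_cball_d])

lemma sets_borel_Rd [measurable]: "Rd d \<in> sets borel"
  by (simp add: borel_closed closed_Rd)

interpretation leb: product_sigma_finite "\<lambda>_::nat. lborel :: real measure"
  by standard

lemma leb_d_translate: "distr (leb_d d) (leb_d d) (\<lambda>x. \<lambda>i\<in>{..<d}. x i + a i) = leb_d d"
proof (rule leb.PiM_eqI)
  fix A :: "nat \<Rightarrow> real set" assume A: "\<And>i. i \<in> {..<d} \<Longrightarrow> A i \<in> sets lborel"
  have meas: "(\<lambda>x. \<lambda>i\<in>{..<d}. x i + a i) \<in> measurable (leb_d d) (leb_d d)"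
    by measurable
  have 1: "(\<lambda>x. \<lambda>i\<in>{..<d}. x i + a i) -` (PiE {..<d} A) \<inter> space (leb_d d)
        = PiE {..<d} (\<lambda>i. (\<lambda>y. a i + y) -` A i)"
    by (auto simp: space_PiM PiE_iff add.commute extensional_def)
  have 2: "(\<lambda>y. a i + y) -` A i \<in> sets lborel" if "i < d" for i
    using A[of i] that by (auto intro!: measurable_sets_borel[of "\<lambda>y. a i + y"])
  have 3: "emeasure lborel ((\<lambda>y. a i + y) -` A i) = emeasure lborel (A i)" if "i < d" for i
    using A[of i] that arg_cong[OF lborel_distr_plus[of "a i"], of "\<lambda>M. emeasure M (A i)"]
    by (simp add: emeasure_distr)
  have "emeasure (distr (leb_d d) (leb_d d) (\<lambda>x. \<lambda>i\<in>{..<d}. x i + a i)) (Pi\<^sub>E {..<d} A)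
     = emeasure (leb_d d) (PiE {..<d} (\<lambda>i. (\<lambda>y. a i + y) -` A i))"
    using A by (subst emeasure_distr[OF meas]) (auto simp: 1 intro: sets_PiM_I_finite)
  also have "\<dots> = (\<Prod>i<d. emeasure lborel (A i))"
    using 2 3 by (subst leb.emeasure_PiM) auto
  finally show "emeasure (distr (leb_d d) (leb_d d) (\<lambda>x. \<lambda>i\<in>{..<d}. x i + a i)) (Pi\<^sub>E {..<d} A)
     = (\<Prod>i<d. emeasure lborel (A i))" .
qed auto

lemma lebv_translate:
  assumes "a \<in> Rd d"
  shows "distr (lebv d) borel (vadd a) = lebv d"
proof -
  have m: "vadd a \<in> borel_measurable borel"
    by measurable
  have m2: "(\<lambda>x. \<lambda>i\<in>{..<d}. x i + a i) \<in> measurable (leb_d d) (leb_d d)"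
    by measurable
  have "distr (lebv d) borel (vadd a) = distr (leb_d d) borel (vadd a \<circ> pad d)"
    unfolding lebv_def by (rule distr_distr[OF m measurable_pad])
  also have "vadd a \<circ> pad d = pad d \<circ> (\<lambda>x. \<lambda>i\<in>{..<d}. x i + a i)"
    using assms by (auto simp: fun_eq_iff vadd_def pad_def Rd_def)
  also have "distr (leb_d d) borel \<dots> = distr (distr (leb_d d) (leb_d d) (\<lambda>x. \<lambda>i\<in>{..<d}. x i + a i)) borel (pad d)"
    by (rule distr_distr[OF measurable_pad m2, symmetric])
  also have "\<dots> = lebv d"
    by (simp add: leb_d_translate lebv_def)
  finally show ?thesis .
qed

lemma AE_lebv_Rd: "AE x in lebv d. x \<in> Rd d"
  unfolding lebv_def by (subst AE_distr_iff) auto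

lemma sets_borel_box: "{x::vec. \<forall>i<d. \<bar>x i\<bar> \<le> c} \<in> sets borel"
proof -
  have "{x::vec. \<forall>i<d. \<bar>x i\<bar> \<le> c} = {x. \<forall>i\<in>{..<d}. \<bar>x i\<bar> \<le> c}"
    by auto
  also have "\<dots> \<in> sets borel"
    by measurable
  finally show ?thesis .
qed

lemma emeasure_lebv_box:
  assumes "c \<ge> 0"
  shows "emeasure (lebv d) {x. \<forall>i<d. \<bar>x i\<bar> \<le> c} = ennreal ((2 * c) ^ d)"
proof -
  note m = sets_borel_box[of d c]
  have abs_le: "\<bar>y\<bar> \<le> c \<longleftrightarrow> - c \<le> y \<and> y \<le> c" for y :: real
    by linarith
  have "pad d -` {x. \<forall>i<d. \<bar>x i\<bar> \<le> c} \<inter> space (leb_d d) = PiE {..<d} (\<lambda>_. {-c..c})"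
    using abs_le by (auto simp: space_PiM pad_def PiE_iff)
  then have "emeasure (lebv d) {x. \<forall>i<d. \<bar>x i\<bar> \<le> c} = (\<Prod>i<d. emeasure lborel {-c..c})"
    using m unfolding lebv_def
    by (subst emeasure_distr[OF measurable_pad]) (auto simp: leb.emeasure_PiM)
  also have "\<dots> = ennreal ((2 * c) ^ d)"
    using assms by (simp add: ennreal_power)
  finally show ?thesis .
qed

lemma sigma_finite_lebv: "sigma_finite_measure (lebv d)"
proof
  define A where "A n = {x::vec. \<forall>i<d. \<bar>x i\<bar> \<le> real n}" for n
  have "A n \<in> sets borel" for n
    unfolding A_def by (rule sets_borel_box)
  moreover have "\<exists>n. x \<in> A n" for x
  proof -
    obtain n where "(\<Sum>i<d. \<bar>x i\<bar>) \<le> real n"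
      using real_arch_simple by blast
    moreover have "\<bar>x i\<bar> \<le> (\<Sum>i<d. \<bar>x i\<bar>)" if "i < d" for i
      by (rule member_le_sum) (use that in auto)
    ultimately show ?thesis
      unfolding A_def by (intro exI[of _ n] CollectI allI impI) (erule order_trans[rotated], simp)
  qed
  moreover have "emeasure (lebv d) (A n) \<noteq> \<infinity>" for n
    unfolding A_def by (subst emeasure_lebv_box) auto
  ultimately show "\<exists>A. countable A \<and> A \<subseteq> sets (lebv d) \<and> \<Union>A = space (lebv d) \<and> (\<forall>a\<in>A. emeasure (lebv d) a \<noteq> \<infinity>)"
    by (intro exI[of _ "range A"]) auto
qed

lemma emeasure_cball_d_finite: "emeasure (lebv d) (cball_d d r) < \<infinity>"
proof -
  have "emeasure (lebv d) (cball_d d r) \<le> emeasure (lebv d) {x. \<forall>i<d. \<bar>x i\<bar> \<le> \<bar>r\<bar>}"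
  proof (rule emeasure_mono)
    show "cball_d d r \<subseteq> {x. \<forall>i<d. \<bar>x i\<bar> \<le> \<bar>r\<bar>}"
    proof safe
      fix x i assume "x \<in> cball_d d r" "i < d"
      then show "\<bar>x i\<bar> \<le> \<bar>r\<bar>"
        using abs_component_le_norm_d[of i d x] by (simp add: cball_d_def) linarith
    qed
  qed (simp add: sets_borel_box)
  also have "\<dots> < \<infinity>"
    by (subst emeasure_lebv_box) auto
  finally show ?thesis .
qed

lemma emeasure_cball_d_pos:
  assumes "r > 0" shows "emeasure (lebv d) (cball_d d r) > 0"
proof -
  \<comment> \<open>Half the side of a cube inside the ball; the summand 1 covers
    \<open>d = 0\<close>.\<close>
  define c where "c = r / (real d + 1)"
  have c: "c > 0" "real d * c \<le> r"
    using assms by (auto simp: c_def field_simps)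
  have "{x. \<forall>i<d. \<bar>x i\<bar> \<le> c} \<inter> Rd d \<subseteq> cball_d d r"
  proof
    fix x assume x: "x \<in> {x. \<forall>i<d. \<bar>x i\<bar> \<le> c} \<inter> Rd d"
    have "norm_d d x \<le> (\<Sum>i<d. \<bar>x i\<bar>)"
      by (rule norm_d_le_sum_abs)
    also have "\<dots> \<le> (\<Sum>i<d. c)"
      using x by (intro sum_mono) auto
    finally show "x \<in> cball_d d r"
      using x c by (simp add: cball_d_def)
  qed
  then have "AE x in lebv d. x \<in> {x. \<forall>i<d. \<bar>x i\<bar> \<le> c} \<longrightarrow> x \<in> cball_d d r"
    using AE_lebv_Rd[of d] by (rule_tac AE_mp) auto
  then have "emeasure (lebv d) {x. \<forall>i<d. \<bar>x i\<bar> \<le> c} \<le> emeasure (lebv d) (cball_d d r)"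
    by (rule emeasure_mono_AE) simp
  then show ?thesis
    using c by (subst (asm) emeasure_lebv_box) (auto intro: less_le_trans[rotated])
qed

lemma nn_integral_lebv_translate:
  assumes "a \<in> Rd d" "f \<in> borel_measurable borel"
  shows "(\<integral>\<^sup>+x. f (vadd a x) \<partial>lebv d) = (\<integral>\<^sup>+x. f x \<partial>lebv d)"
  using nn_integral_distr[of "vadd a" "lebv d" borel f] assms lebv_translate[OF assms(1)] by simp

text \<open>Swapping the order of integration in the double integral of
\<open>1\<^sub>E (x + y) 1\<^sub>F (y)\<close> shows that \<open>\<nu>\<close> is a multiple of Lebesgue measure.\<close>

lemma translation_invariant_unique:
  assumes sets_nu [simp, measurable_cong]: "sets \<nu> = sets borel" and sf: "sigma_finite_measure \<nu>"
    and inv: "\<And>a. a \<in> Rd d \<Longrightarrow> distr \<nu> borel (vadd a) = \<nu>" and Rd: "AE x in \<nu>. x \<in> Rd d"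
    and [measurable]: "E \<in> sets borel" "F \<in> sets borel"
  shows "emeasure (lebv d) E * emeasure \<nu> F = emeasure \<nu> E * emeasure (lebv d) {x. vscale (-1) x \<in> F}"
proof -
  have [simp]: "space \<nu> = UNIV"
    using sets_eq_imp_space_eq[OF sets_nu] by simp
  interpret pair_sigma_finite "lebv d" \<nu>
    using sf sigma_finite_lebv by (simp add: pair_sigma_finite_def)
  have [measurable]: "{x. vscale (-1) x \<in> F} \<in> sets borel"
  proof -
    have "vscale (-1) -` F \<inter> space borel \<in> sets borel"
      by (rule measurable_sets[of _ borel borel]) measurable
    then show ?thesis
      by (simp add: vimage_def)
  qed
  have "emeasure (lebv d) E * emeasure \<nu> F = (\<integral>\<^sup>+y. emeasure (lebv d) E * indicator F y \<partial>\<nu>)"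
    by (simp add: nn_integral_cmult)
  also have "\<dots> = (\<integral>\<^sup>+y. (\<integral>\<^sup>+x. indicator E (vadd y x) * indicator F y \<partial>lebv d) \<partial>\<nu>)"
  proof (rule nn_integral_cong_AE, rule AE_mp[OF Rd], rule AE_I2, intro impI)
    fix y assume "y \<in> Rd d"
    then show "emeasure (lebv d) E * indicator F y
        = (\<integral>\<^sup>+x. indicator E (vadd y x) * indicator F y \<partial>lebv d)"
      using nn_integral_lebv_translate[of y d "indicator E"] by (simp add: nn_integral_multc)
  qed
  also have "\<dots> = (\<integral>\<^sup>+x. (\<integral>\<^sup>+y. indicator E (vadd y x) * indicator F y \<partial>\<nu>) \<partial>lebv d)"
    by (rule Fubini') measurable
  also have "\<dots> = (\<integral>\<^sup>+x. (\<integral>\<^sup>+y. indicator E y * indicator F (vsub y x) \<partial>\<nu>) \<partial>lebv d)"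
  proof (rule nn_integral_cong_AE, rule AE_mp[OF AE_lebv_Rd], rule AE_I2, intro impI)
    fix x assume x: "x \<in> Rd d"
    have *: "vadd (vsub y x) x = y" "vadd (vscale (-1) x) y = vsub y x" for y
      by (auto simp: vec_defs)
    have "(\<integral>\<^sup>+y. indicator E (vadd y x) * indicator F y \<partial>\<nu>)
       = (\<integral>\<^sup>+y. indicator E (vadd y x) * indicator F y \<partial>distr \<nu> borel (vadd (vscale (-1) x)))"
      using x by (subst inv) auto
    also have "\<dots> = (\<integral>\<^sup>+y. indicator E (vadd (vadd (vscale (-1) x) y) x) * indicator F (vadd (vscale (-1) x) y) \<partial>\<nu>)"
      by (rule nn_integral_distr) measurable
    also have "\<dots> = (\<integral>\<^sup>+y. indicator E y * indicator F (vsub y x) \<partial>\<nu>)"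
      by (simp only: *)
    finally show "(\<integral>\<^sup>+y. indicator E (vadd y x) * indicator F y \<partial>\<nu>) =
      (\<integral>\<^sup>+y. indicator E y * indicator F (vsub y x) \<partial>\<nu>)" .
  qed
  also have "\<dots> = (\<integral>\<^sup>+y. (\<integral>\<^sup>+x. indicator E y * indicator F (vsub y x) \<partial>lebv d) \<partial>\<nu>)"
    by (rule Fubini'[symmetric]) measurable
  also have "\<dots> = (\<integral>\<^sup>+y. indicator E y * emeasure (lebv d) {x. vscale (-1) x \<in> F} \<partial>\<nu>)"
  proof (rule nn_integral_cong_AE, rule AE_mp[OF Rd], rule AE_I2, intro impI)
    fix y assume y: "y \<in> Rd d"
    have *: "vsub y (vadd y x) = vscale (-1) x" for x
      by (auto simp: vec_defs)
    have "(\<integral>\<^sup>+x. indicator F (vsub y x) \<partial>lebv d) = (\<integral>\<^sup>+x. indicator F (vscale (-1) x) \<partial>lebv d)"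
      using nn_integral_lebv_translate[of y d "\<lambda>x. indicator F (vsub y x)"] y by (simp add: *)
    also have "\<dots> = (\<integral>\<^sup>+x. indicator {x. vscale (-1) x \<in> F} x \<partial>lebv d)"
      by (simp add: indicator_def)
    also have "\<dots> = emeasure (lebv d) {x. vscale (-1) x \<in> F}"
      by (rule nn_integral_indicator) simp
    finally show "(\<integral>\<^sup>+x. indicator E y * indicator F (vsub y x) \<partial>lebv d) =
         indicator E y * emeasure (lebv d) {x. vscale (-1) x \<in> F}"
      by (simp add: nn_integral_cmult)
  qed
  also have "\<dots> = emeasure \<nu> E * emeasure (lebv d) {x. vscale (-1) x \<in> F}"
    by (simp add: nn_integral_multc)
  finally show ?thesis .
qed

text \<open>This applies \<open>translation_invariant_unique\<close> to the image measure of
  \<open>T\<close>, which is translation invariant because \<open>T\<close> is additive and onto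
  \<open>Rd d\<close>. Comparing with a symmetric test set \<open>F\<close> replaces the
  determinant. The bound \<open>expand\<close> keeps preimages of balls inside balls, which makes
  the image measure sigma-finite.\<close>

lemma emeasure_lebv_linear:
  assumes [measurable]: "T \<in> borel_measurable borel"
    and add: "\<And>x y. T (vadd x y) = vadd (T x) (T y)"
    and TRd: "\<And>x. x \<in> Rd d \<Longrightarrow> T x \<in> Rd d"
    and surj: "\<And>a. a \<in> Rd d \<Longrightarrow> \<exists>a'\<in>Rd d. T a' = a"
    and expand: "\<And>x. x \<in> Rd d \<Longrightarrow> norm_d d x \<le> C * norm_d d (T x)" "C \<ge> 0"
    and [measurable]: "E \<in> sets borel" "F \<in> sets borel"
    and sym: "\<And>x. x \<in> F \<Longrightarrow> vscale (-1) x \<in> F"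
  shows "emeasure (lebv d) E * emeasure (lebv d) (T -` F) = emeasure (lebv d) (T -` E) * emeasure (lebv d) F"
proof -
  let ?\<nu> = "distr (lebv d) borel T"
  have AE: "AE x in ?\<nu>. x \<in> Rd d"
    using AE_lebv_Rd[of d] by (subst AE_distr_iff) (auto simp: TRd elim: AE_mp)
  have meas: "T -` A \<in> sets borel" if "A \<in> sets borel" for A
    by (rule measurable_sets_borel[OF assms(1) that])
  have sf: "sigma_finite_measure ?\<nu>"
  proof
    have fin: "emeasure ?\<nu> (cball_d d (real n)) \<noteq> \<infinity>" for n
    proof -
      have "emeasure ?\<nu> (cball_d d (real n)) = emeasure (lebv d) (T -` cball_d d (real n))"
        by (subst emeasure_distr) auto
      also have "\<dots> \<le> emeasure (lebv d) (cball_d d (C * real n))"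
      proof (rule emeasure_mono_AE, rule AE_mp[OF AE_lebv_Rd], rule AE_I2, intro impI)
        fix x assume "x \<in> Rd d" "x \<in> T -` cball_d d (real n)"
        then show "x \<in> cball_d d (C * real n)"
          using order_trans[OF expand(1) mult_left_mono[OF _ expand(2)]] by (auto simp: cball_d_def)
      qed simp
      also have "\<dots> < \<infinity>"
        by (rule emeasure_cball_d_finite)
      finally show ?thesis
        by simp
    qed
    \<comment> \<open>Balls cover only \<open>Rd d\<close>; the complement joins the cover as a null
      set.\<close>
    have fin2: "emeasure ?\<nu> (- Rd d) \<noteq> \<infinity>"
    proof -
      have "emeasure ?\<nu> (- Rd d) = 0"
        using AE by (subst (asm) AE_iff_measurable[of "- Rd d"]) (auto simp: Collect_neg_eq)
      then show ?thesis
        by simp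
    qed
    have "x \<in> - Rd d \<union> (\<Union>n. cball_d d (real n))" for x
      using real_arch_simple[of "norm_d d x"] by (auto simp: cball_d_def)
    then show "\<exists>A. countable A \<and> A \<subseteq> sets ?\<nu> \<and> \<Union>A = space ?\<nu> \<and> (\<forall>a\<in>A. emeasure ?\<nu> a \<noteq> \<infinity>)"
      using fin fin2 by (intro exI[of _ "insert (- Rd d) (range (\<lambda>n. cball_d d (real n)))"]) auto
  qed
  have inv: "distr ?\<nu> borel (vadd a) = ?\<nu>" if a: "a \<in> Rd d" for a
  proof -
    obtain a' where a': "a' \<in> Rd d" "T a' = a"
      using surj[OF a] by auto
    have m [measurable]: "vadd a \<in> borel_measurable borel" "vadd a' \<in> borel_measurable borel"
      by measurable
    have "distr ?\<nu> borel (vadd a) = distr (lebv d) borel (vadd a \<circ> T)"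
      by (rule distr_distr) measurable
    also have "vadd a \<circ> T = T \<circ> vadd a'"
      by (auto simp: add a')
    also have "distr (lebv d) borel (T \<circ> vadd a') = distr (distr (lebv d) borel (vadd a')) borel T"
      by (rule distr_distr[symmetric]) measurable
    also have "\<dots> = ?\<nu>"
      using a' by (simp add: lebv_translate)
    finally show ?thesis .
  qed
  have "vscale (-1) (vscale (-1) x) = x" for x
    by (auto simp: vec_defs)
  then have "{x. vscale (-1) x \<in> F} = F"
    using sym by (metis (mono_tags, lifting) Collect_cong mem_Collect_eq Collect_mem_eq)
  then show ?thesis
    using translation_invariant_unique[OF _ sf inv AE, of E F] meas by (simp add: emeasure_distr)
qed

text \<open>Householder reflection in the hyperplane orthogonal to \<open>u\<close>. If
  \<open>inner_d d u u = 0\<close>, division by zero turns it into the identity.\<close>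

definition reflect :: "nat \<Rightarrow> vec \<Rightarrow> vec \<Rightarrow> vec" where
  "reflect d u x = vsub x (vscale (2 * inner_d d u x / inner_d d u u) u)"

lemma measurable_reflect [measurable]: "reflect d u \<in> borel_measurable borel"
  unfolding reflect_def by measurable

lemma reflect_add: "reflect d u (vadd x y) = vadd (reflect d u x) (reflect d u y)"
  unfolding reflect_def inner_d_simps by (auto simp: vec_defs add_divide_distrib algebra_simps)

lemma inner_reflect: "inner_d d (reflect d u x) y = inner_d d x (reflect d u y)"
  by (simp add: reflect_def inner_d_simps inner_d_commute[of d x u])

lemma reflect_reflect: "reflect d u (reflect d u x) = x"
proof (cases "inner_d d u u = 0")
  case True
  then show ?thesis
    by (auto simp: reflect_def vec_defs)
next
  case False
  then have "inner_d d u (reflect d u x) = - inner_d d u x"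
    by (simp add: reflect_def inner_d_simps)
  then show ?thesis
    unfolding reflect_def[of d u "reflect d u x"] by (simp add: reflect_def vec_defs)
qed

lemma norm_reflect: "norm_d d (reflect d u x) = norm_d d x"
  unfolding norm_d_def by (simp add: inner_reflect reflect_reflect)

lemma reflect_Rd: "u \<in> Rd d \<Longrightarrow> x \<in> Rd d \<Longrightarrow> reflect d u x \<in> Rd d"
  by (simp add: reflect_def)

text \<open>The unit ball is a symmetric test set that every reflection preserves. Its measure is
  positive and finite, so it can be cancelled.\<close>

lemma distr_lebv_reflect:
  assumes "u \<in> Rd d"
  shows "distr (lebv d) borel (reflect d u) = lebv d"
proof (rule measure_eqI)
  fix E assume "E \<in> sets (distr (lebv d) borel (reflect d u))"
  then have E [measurable]: "E \<in> sets borel"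
    by simp
  have m: "reflect d u -` A \<in> sets borel" if "A \<in> sets borel" for A
    by (rule measurable_sets_borel[OF measurable_reflect that])
  have ball: "emeasure (lebv d) (reflect d u -` cball_d d 1) = emeasure (lebv d) (cball_d d 1)"
  proof (rule emeasure_eq_AE[OF AE_mp[OF AE_lebv_Rd]])
    show "AE x in lebv d. x \<in> Rd d \<longrightarrow> (x \<in> reflect d u -` cball_d d 1) = (x \<in> cball_d d 1)"
      using assms by (intro AE_I2) (auto simp: cball_d_def norm_reflect reflect_Rd)
  qed (auto simp: m)
  have "emeasure (lebv d) E * emeasure (lebv d) (reflect d u -` cball_d d 1)
      = emeasure (lebv d) (reflect d u -` E) * emeasure (lebv d) (cball_d d 1)"
  proof (rule emeasure_lebv_linear)
    show "norm_d d x \<le> 1 * norm_d d (reflect d u x)" for x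
      by (simp add: norm_reflect)
    show "\<exists>a'\<in>Rd d. reflect d u a' = a" if "a \<in> Rd d" for a
      using that assms by (intro bexI[of _ "reflect d u a"]) (auto simp: reflect_reflect reflect_Rd)
  qed (use assms in \<open>auto simp: reflect_add reflect_Rd cball_d_def norm_d_scale\<close>)
  then have "emeasure (lebv d) E = emeasure (lebv d) (reflect d u -` E)"
    using emeasure_cball_d_pos[of 1 d] emeasure_cball_d_finite[of d 1]
    by (auto simp: ball ennreal_mult_cancel_left mult.commute[of _ "emeasure (lebv d) (cball_d d 1)"])
  then show "emeasure (distr (lebv d) borel (reflect d u)) E = emeasure (lebv d) E"
    by (simp add: emeasure_distr)
qed simp

text \<open>Here the test set is a cube, because the measure of a dilated cube is known
  explicitly.\<close>

lemma emeasure_lebv_scale: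
  assumes c: "c > 0" and E [measurable]: "E \<in> sets borel"
  shows "emeasure (lebv d) (vscale c -` E) = ennreal (inverse c ^ d) * emeasure (lebv d) E"
proof -
  define F where "F = {x::vec. \<forall>i<d. \<bar>x i\<bar> \<le> 1}"
  have F [measurable]: "F \<in> sets borel"
    unfolding F_def by (rule sets_borel_box)
  have pre: "vscale c -` F = {x. \<forall>i<d. \<bar>x i\<bar> \<le> inverse c}"
    using c by (auto simp: F_def vscale_def abs_mult field_simps)
  have "emeasure (lebv d) E * emeasure (lebv d) (vscale c -` F)
      = emeasure (lebv d) (vscale c -` E) * emeasure (lebv d) F"
  proof (rule emeasure_lebv_linear)
    show "norm_d d x \<le> inverse c * norm_d d (vscale c x)" for x
      using c by (simp add: norm_d_scale field_simps)
    show "\<exists>a'\<in>Rd d. vscale c a' = a" if "a \<in> Rd d" for a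
      using that c by (intro bexI[of _ "vscale (inverse c) a"]) (auto simp: vec_defs Rd_def)
  qed (use c in \<open>auto simp: F_def vec_defs Rd_def algebra_simps\<close>)
  also have "emeasure (lebv d) F = ennreal (2 ^ d)"
    unfolding F_def by (subst emeasure_lebv_box) auto
  also have "emeasure (lebv d) (vscale c -` F) = ennreal (inverse c ^ d) * ennreal (2 ^ d)"
    unfolding pre using c
    by (subst emeasure_lebv_box) (auto simp: power_mult_distrib ennreal_mult'' mult.commute)
  finally have "ennreal (2 ^ d) * (ennreal (inverse c ^ d) * emeasure (lebv d) E)
     = ennreal (2 ^ d) * emeasure (lebv d) (vscale c -` E)"
    by (simp add: ac_simps)
  then show ?thesis
    by (subst (asm) ennreal_mult_cancel_left) auto
qed

lemma integral_lebv_translate: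
  fixes f :: "vec \<Rightarrow> real"
  assumes "a \<in> Rd d" "f \<in> borel_measurable borel"
  shows "(LINT x|lebv d. f (vadd a x)) = (LINT x|lebv d. f x)"
  using integral_distr[of "vadd a" "lebv d" borel f] assms lebv_translate[OF assms(1)] by simp

lemma integral_lebv_reflect:
  fixes f :: "vec \<Rightarrow> real"
  assumes "u \<in> Rd d" "f \<in> borel_measurable borel"
  shows "(LINT x|lebv d. f (reflect d u x)) = (LINT x|lebv d. f x)"
  using integral_distr[of "reflect d u" "lebv d" borel f] assms distr_lebv_reflect[OF assms(1)] by simp

lemma distr_lebv_scale:
  assumes c: "c > 0"
  shows "distr (lebv d) borel (vscale c) = density (lebv d) (\<lambda>_. ennreal (inverse c ^ d))"
proof (rule measure_eqI)
  have m: "vscale c \<in> borel_measurable borel"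
    by measurable
  fix E assume "E \<in> sets (distr (lebv d) borel (vscale c))"
  then have E: "E \<in> sets borel"
    by simp
  then show "emeasure (distr (lebv d) borel (vscale c)) E
     = emeasure (density (lebv d) (\<lambda>_. ennreal (inverse c ^ d))) E"
    using m c by (simp add: emeasure_distr emeasure_lebv_scale emeasure_density nn_integral_cmult)
qed simp

lemma integral_lebv_scale:
  fixes f :: "vec \<Rightarrow> real"
  assumes c: "c > 0" and f: "f \<in> borel_measurable borel"
  shows "(LINT x|lebv d. f (vscale c x)) = inverse c ^ d * (LINT x|lebv d. f x)"
proof -
  have m: "vscale c \<in> borel_measurable borel"
    by measurable
  have "(LINT x|lebv d. f (vscale c x)) = (LINT x|distr (lebv d) borel (vscale c). f x)"
    using m f by (subst integral_distr) auto
  then show ?thesis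
    using f c by (simp add: distr_lebv_scale integral_real_density)
qed

lemma integrable_lebv_scale:
  fixes f :: "vec \<Rightarrow> real"
  assumes c: "c > 0" and f: "integrable (lebv d) f"
  shows "integrable (lebv d) (\<lambda>x. f (vscale c x))"
proof -
  have m: "vscale c \<in> borel_measurable (lebv d)"
    by measurable
  have "integrable (distr (lebv d) borel (vscale c)) f"
    unfolding distr_lebv_scale[OF c] using f c by (subst integrable_real_density) auto
  then show ?thesis
    by (rule integrable_distr[OF m])
qed

lemma integrable_lebv_translate:
  fixes f :: "vec \<Rightarrow> real"
  assumes a: "a \<in> Rd d" and f: "integrable (lebv d) f"
  shows "integrable (lebv d) (\<lambda>x. f (vadd a x))"
proof -
  have m: "vadd a \<in> borel_measurable (lebv d)"
    by measurable
  show ?thesis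
    using integrable_distr[OF m, of f] f by (simp add: lebv_translate[OF a])
qed

lemma emeasure_bounded_finite:
  assumes "L \<subseteq> cball_d d R"
  shows "emeasure (lebv d) L < \<infinity>"
  by (rule le_less_trans[OF emeasure_mono[OF assms] emeasure_cball_d_finite]) simp

lemma set_integrable_bounded:
  fixes f :: "vec \<Rightarrow> real"
  assumes L: "L \<in> sets borel" "L \<subseteq> cball_d d R" and f: "f \<in> borel_measurable borel"
    and B: "\<And>x. x \<in> L \<Longrightarrow> \<bar>f x\<bar> \<le> B"
  shows "set_integrable (lebv d) L f"
  unfolding set_integrable_def
proof (rule integrableI_bounded_set[of L _ _ B])
  show "emeasure (lebv d) L < \<infinity>"
    by (rule emeasure_bounded_finite[OF L(2)])
qed (use L f B in \<open>auto simp: indicator_def\<close>)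

lemma set_integral_bound:
  fixes f :: "vec \<Rightarrow> real"
  assumes L: "L \<in> sets borel" "L \<subseteq> cball_d d R" and f: "f \<in> borel_measurable borel"
    and B: "\<And>x. x \<in> L \<Longrightarrow> \<bar>f x\<bar> \<le> B"
  shows "\<bar>LINT x:L|lebv d. f x\<bar> \<le> B * vol d L"
proof -
  have i: "set_integrable (lebv d) L f"
    by (rule set_integrable_bounded[OF assms])
  have c: "set_integrable (lebv d) L (\<lambda>x. B)"
    using L B by (intro set_integrable_bounded[of L d R _ "\<bar>B\<bar>"]) auto
  have fin: "emeasure (lebv d) L \<noteq> \<infinity>"
    using emeasure_bounded_finite[OF L(2)] by simp
  have "\<bar>LINT x:L|lebv d. f x\<bar> \<le> (LINT x:L|lebv d. \<bar>f x\<bar>)"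
    using set_integral_norm_bound[OF i] by simp
  also have "\<dots> \<le> (LINT x:L|lebv d. B)"
    by (rule set_integral_mono[OF set_integrable_abs[OF i] c B])
  also have "\<dots> = B * vol d L"
    using fin L by (subst set_integral_const) (auto simp: less_top)
  finally show ?thesis .
qed

lemma body_translate:
  assumes "body d K" "a \<in> Rd d" shows "body d (vadd a ` K)"
proof -
  have "vadd a ` K = msum {a} K"
    by (auto simp: msum_def)
  moreover have "body d {a}"
  proof -
    have "vadd (vscale (1 - t) a) (vscale t a) = a" for t
      by (auto simp: vec_defs algebra_simps)
    then show ?thesis
      using assms by (auto simp: body_def vconvex_def)
  qed
  ultimately show ?thesis
    using assms body_msum by simp
qed

lemma continuous_vscale: "continuous_on S (vscale c)"
  unfolding vscale_def
  by (intro continuous_on_coordinatewise_then_product continuous_on_mult continuous_on_const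
      continuous_on_subset[OF continuous_on_product_coordinates]) auto

lemma body_scale:
  assumes "body d K" shows "body d (vscale c ` K)"
proof -
  have "compact (vscale c ` K)"
    using assms by (intro compact_continuous_image continuous_vscale) (simp add: body_def)
  moreover have "vconvex (vscale c ` K)"
    unfolding vconvex_def
  proof safe
    fix x y t assume *: "x \<in> K" "y \<in> K" "t \<in> {0..1::real}"
    have "vadd (vscale (1 - t) (vscale c x)) (vscale t (vscale c y)) = vscale c (vadd (vscale (1 - t) x) (vscale t y))"
      by (auto simp: vec_defs algebra_simps)
    then show "vadd (vscale (1 - t) (vscale c x)) (vscale t (vscale c y)) \<in> vscale c ` K"
      using assms * by (auto simp: body_def vconvex_def)
  qed
  ultimately show ?thesis
    using assms by (auto simp: body_def)
qed

lemma body_emeasure_finite: "body d K \<Longrightarrow> emeasure (lebv d) K < \<infinity>"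
  using body_bounded emeasure_bounded_finite by metis

lemma body_fmeasurable: "body d K \<Longrightarrow> K \<in> fmeasurable (lebv d)"
  by (auto intro!: fmeasurableI sets_borel_body dest: body_emeasure_finite)

lemma measure_translate:
  assumes "a \<in> Rd d" "K \<in> sets borel" "vadd a ` K \<in> sets borel"
  shows "vol d (vadd a ` K) = vol d K"
proof -
  have v: "vadd a -` (vadd a ` K) = K"
    by (auto simp: vadd_def fun_eq_iff) (metis ext)
  have "vol d (vadd a ` K) = measure (distr (lebv d) borel (vadd a)) (vadd a ` K)"
    by (simp add: lebv_translate assms)
  also have "\<dots> = vol d K"
    using assms v by (subst measure_distr) auto
  finally show ?thesis .
qed

lemma measure_scale:
  assumes "c > 0" "body d K"
  shows "vol d (vscale c ` K) = c ^ d * vol d K"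
proof -
  have v: "vscale c -` (vscale c ` K) = K"
    using assms(1) by (auto simp: vscale_def fun_eq_iff) (metis ext)
  have s: "vscale c ` K \<in> sets borel"
    using assms by (intro sets_borel_body body_scale)
  have "emeasure (lebv d) K = ennreal (inverse c ^ d) * emeasure (lebv d) (vscale c ` K)"
    using emeasure_lebv_scale[OF assms(1) s, of d] by (simp add: v)
  then have "vol d K = inverse c ^ d * vol d (vscale c ` K)"
    using assms(1) by (simp add: measure_def enn2real_mult)
  then show ?thesis
    using assms(1) by (simp add: power_inverse field_simps)
qed

subsection \<open>Polynomiality for zonotopes\<close>

text \<open>One functional for all that is needed: \<open>\<alpha> = 1\<close>, \<open>u = 0\<close>
  gives the volume, \<open>\<alpha> = 0\<close> the numerator of the centroid in direction
  \<open>u\<close>, and \<open>\<alpha> = - c\<close> the signed moment about the hyperplane at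
  height \<open>c\<close>.\<close>

definition aff_int :: "nat \<Rightarrow> real \<Rightarrow> vec \<Rightarrow> vec set \<Rightarrow> real" where
  "aff_int d \<alpha> u L = (LINT x:L|lebv d. \<alpha> + inner_d d u x)"

lemma abs_affine_le:
  assumes "x \<in> cball_d d R"
  shows "\<bar>\<alpha> + inner_d d u x\<bar> \<le> \<bar>\<alpha>\<bar> + norm_d d u * R"
proof -
  have "\<bar>inner_d d u x\<bar> \<le> norm_d d u * norm_d d x"
    by (rule inner_d_Cauchy_Schwarz)
  also have "\<dots> \<le> norm_d d u * R"
    using assms by (intro mult_left_mono) (auto simp: cball_d_def)
  finally show ?thesis
    by linarith
qed

lemma affine_set_integrable:
  assumes "L \<in> sets borel" "L \<subseteq> cball_d d R"
  shows "set_integrable (lebv d) L (\<lambda>x. \<alpha> + inner_d d u x)"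
  by (rule set_integrable_bounded[OF assms _ abs_affine_le]) (use assms in auto)

lemma affine_set_integrable_body:
  assumes "body d L"
  shows "set_integrable (lebv d) L (\<lambda>x. \<alpha> + inner_d d u x)"
proof -
  obtain R where "L \<subseteq> cball_d d R"
    using body_bounded[OF assms] by metis
  then show ?thesis
    using affine_set_integrable sets_borel_body[OF assms] by blast
qed

lemma aff_int_bound:
  assumes "L \<in> sets borel" "L \<subseteq> cball_d d R"
  shows "\<bar>aff_int d \<alpha> u L\<bar> \<le> (\<bar>\<alpha>\<bar> + norm_d d u * R) * vol d L"
  unfolding aff_int_def
  by (rule set_integral_bound[OF assms _ abs_affine_le]) (use assms in auto)

lemma aff_int_1_0:
  assumes "body d L" shows "aff_int d 1 (\<lambda>_. 0) L = vol d L"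
proof -
  have "inner_d d (\<lambda>_. 0) x = 0" for x
    by (simp add: inner_d_def)
  then show ?thesis
    using sets_borel_body[OF assms] body_emeasure_finite[OF assms]
    by (simp add: aff_int_def set_integral_const)
qed

lemma aff_int_translate:
  assumes L: "body d L" and b: "b \<in> Rd d"
  shows "aff_int d \<alpha> u (vadd b ` L) = aff_int d \<alpha> u L + inner_d d u b * vol d L"
proof -
  have m: "vadd b ` L \<in> sets borel" "L \<in> sets borel"
    using body_translate[OF L b] L by (auto intro: sets_borel_body)
  have i: "indicator (vadd b ` L) (vadd b x) = (indicator L x :: real)" for x
    by (auto simp: indicator_def vadd_def fun_eq_iff) (metis ext)
  have "aff_int d \<alpha> u (vadd b ` L) =
      (LINT x|lebv d. indicator (vadd b ` L) (vadd b x) * (\<alpha> + inner_d d u (vadd b x)))"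
    unfolding aff_int_def set_lebesgue_integral_def
    using m b by (subst integral_lebv_translate) auto
  also have "\<dots> = (LINT x:L|lebv d. (\<alpha> + inner_d d u x) + inner_d d u b)"
    unfolding i set_lebesgue_integral_def by (simp add: inner_d_simps algebra_simps)
  also have "\<dots> = aff_int d \<alpha> u L + (LINT x:L|lebv d. inner_d d u b)"
    unfolding aff_int_def
    by (intro set_integral_add affine_set_integrable_body L)
       (use affine_set_integrable_body[OF L, of "inner_d d u b" "\<lambda>_. 0"] in \<open>simp add: inner_d_def\<close>)
  also have "(LINT x:L|lebv d. inner_d d u b) = inner_d d u b * vol d L"
    using m body_emeasure_finite[OF L] by (subst set_integral_const) auto
  finally show ?thesis .
qed

lemma set_integral_Un_Int:
  fixes f :: "vec \<Rightarrow> real"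
  assumes "set_integrable M A f" "set_integrable M B f" "A \<in> sets M" "B \<in> sets M"
  shows "(LINT x:A\<union>B|M. f x) = (LINT x:A|M. f x) + (LINT x:B|M. f x) - (LINT x:A\<inter>B|M. f x)"
proof -
  have "set_integrable M (A \<inter> B) f"
    using assms by (meson set_integrable_subset Int_lower1 sets.Int)
  then have "(LINT x:A|M. f x) + (LINT x:B|M. f x) - (LINT x:A\<inter>B|M. f x) =
    (LINT x|M. indicator A x * f x + indicator B x * f x - indicator (A \<inter> B) x * f x)"
    using assms by (simp add: set_lebesgue_integral_def set_integrable_def)
  also have "\<dots> = (LINT x:A\<union>B|M. f x)"
    unfolding set_lebesgue_integral_def
    by (intro Bochner_Integration.integral_cong) (auto simp: indicator_def)
  finally show ?thesis ..
qed

section \<open>Minkowski sums with a segment\<close>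

definition segment :: "vec \<Rightarrow> real \<Rightarrow> vec set" where
  "segment a s = (\<lambda>t. vscale t a) ` {0..s}"

lemma body_segment:
  assumes "a \<in> Rd d" shows "body d (segment a s)"
proof -
  have "compact (segment a s)"
    unfolding segment_def vscale_def
    by (intro compact_continuous_image continuous_on_coordinatewise_then_product continuous_intros) auto
  moreover have "vconvex (segment a s)"
    unfolding vconvex_def
  proof (intro ballI)
    fix x y t assume *: "x \<in> segment a s" "y \<in> segment a s" "t \<in> {0..1::real}"
    then obtain p q where pq: "p \<in> {0..s}" "q \<in> {0..s}" "x = vscale p a" "y = vscale q a"
      by (auto simp: segment_def)
    have "(1 - t) * p + t * q \<le> (1 - t) * s + t * s"
      using * pq by (intro add_mono mult_left_mono) auto
    moreover have "0 \<le> (1 - t) * p" "0 \<le> t * q"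
      using * pq by auto
    moreover have "(1 - t) * s + t * s = s"
      by (simp add: algebra_simps)
    ultimately have "(1 - t) * p + t * q \<in> {0..s}"
      unfolding atLeastAtMost_iff by linarith
    moreover have "vadd (vscale (1 - t) x) (vscale t y) = vscale ((1 - t) * p + t * q) a"
      by (auto simp: pq vec_defs algebra_simps)
    ultimately show "vadd (vscale (1 - t) x) (vscale t y) \<in> segment a s"
      by (auto simp: segment_def)
  qed
  ultimately show ?thesis
    using assms by (auto simp: body_def segment_def)
qed

lemma msum_commute: "msum A B = msum B A"
proof -
  have "vadd x y = vadd y x" for x y
    by (simp add: vadd_def add.commute)
  then show ?thesis
    unfolding msum_def by blast
qed

lemma msumI: "x \<in> A \<Longrightarrow> y \<in> B \<Longrightarrow> vadd x y \<in> msum A B"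
  by (auto simp: msum_def)

lemma msumE: "z \<in> msum A B \<Longrightarrow> (\<And>x y. x \<in> A \<Longrightarrow> y \<in> B \<Longrightarrow> z = vadd x y \<Longrightarrow> P) \<Longrightarrow> P"
  by (auto simp: msum_def)

lemma msum_assoc: "msum (msum A B) C = msum A (msum B C)"
proof -
  have *: "vadd (vadd x y) z = vadd x (vadd y z)" for x y z
    by (auto simp: vadd_def)
  show ?thesis
    by (intro set_eqI iffI; elim msumE; hypsubst) (simp add: * msumI, simp add: msumI flip: *)
qed

lemma msum_mono: "A \<subseteq> A' \<Longrightarrow> B \<subseteq> B' \<Longrightarrow> msum A B \<subseteq> msum A' B'"
  by (auto simp: msum_def)

lemma msum_cball_d:
  assumes "A \<subseteq> cball_d d r" "B \<subseteq> cball_d d s" shows "msum A B \<subseteq> cball_d d (r + s)"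
proof
  fix z assume "z \<in> msum A B"
  then obtain x y where "x \<in> cball_d d r" "y \<in> cball_d d s" "z = vadd x y"
    using assms by (auto simp: msum_def)
  then show "z \<in> cball_d d (r + s)"
    using norm_d_triangle[of d x y] by (auto simp: cball_d_def)
qed

lemma msum_segment_0 [simp]: "msum K (segment a 0) = K"
  by (auto simp: msum_def segment_def vec_defs)

lemma msum_segment_Un:
  assumes "s \<ge> 0" "t \<ge> 0"
  shows "msum K (segment a (s + t)) = msum K (segment a s) \<union> vadd (vscale s a) ` msum K (segment a t)"
proof (intro equalityI subsetI)
  fix x assume "x \<in> msum K (segment a (s + t))"
  then obtain k \<sigma> where k: "k \<in> K" "0 \<le> \<sigma>" "\<sigma> \<le> s + t" "x = vadd k (vscale \<sigma> a)"
    by (auto simp: msum_def segment_def)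
  show "x \<in> msum K (segment a s) \<union> vadd (vscale s a) ` msum K (segment a t)"
  proof (cases "\<sigma> \<le> s")
    case True
    then have "vscale \<sigma> a \<in> segment a s"
      using k by (auto simp: segment_def)
    then show ?thesis
      using k by (auto simp: msum_def)
  next
    case False
    then have "vadd k (vscale (\<sigma> - s) a) \<in> msum K (segment a t)"
      using k by (intro msumI) (auto simp: segment_def)
    moreover have "x = vadd (vscale s a) (vadd k (vscale (\<sigma> - s) a))"
      by (auto simp: k vec_defs algebra_simps)
    ultimately show ?thesis
      by blast
  qed
next
  fix x assume "x \<in> msum K (segment a s) \<union> vadd (vscale s a) ` msum K (segment a t)"
  then show "x \<in> msum K (segment a (s + t))"
  proof
    assume "x \<in> msum K (segment a s)"
    moreover have "segment a s \<subseteq> segment a (s + t)"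
      using assms by (auto simp: segment_def)
    ultimately show ?thesis
      using msum_mono by blast
  next
    assume "x \<in> vadd (vscale s a) ` msum K (segment a t)"
    then obtain k \<tau> where k: "k \<in> K" "0 \<le> \<tau>" "\<tau> \<le> t" "x = vadd (vscale s a) (vadd k (vscale \<tau> a))"
      by (auto simp: msum_def segment_def)
    have "x = vadd k (vscale (s + \<tau>) a)"
      by (auto simp: k vec_defs algebra_simps)
    then show ?thesis
      using k assms by (auto intro!: msumI simp: segment_def)
  qed
qed

text \<open>A common point, moved back by \<open>s a\<close>, lies on a line in direction
  \<open>a\<close> between two points of \<open>K\<close>: one is reached by going forward by
  \<open>s - \<sigma>\<close>, the other by going back by \<open>\<tau>\<close>. Convexity puts it
  into \<open>K\<close>.\<close>

lemma msum_segment_Int: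
  assumes "s \<ge> 0" "t \<ge> 0" and K: "vconvex K"
  shows "msum K (segment a s) \<inter> vadd (vscale s a) ` msum K (segment a t) = vadd (vscale s a) ` K"
proof (intro equalityI subsetI)
  fix x assume "x \<in> vadd (vscale s a) ` K"
  then obtain k where k: "k \<in> K" "x = vadd (vscale s a) k"
    by auto
  have "x = vadd k (vscale s a)" "k = vadd k (vscale 0 a)"
    by (auto simp: k vec_defs)
  then have "x \<in> msum K (segment a s)" "k \<in> msum K (segment a t)"
    using k(1) assms unfolding msum_def segment_def
    by (metis (mono_tags, lifting) atLeastAtMost_iff imageI mem_Collect_eq order_refl)+
  then show "x \<in> msum K (segment a s) \<inter> vadd (vscale s a) ` msum K (segment a t)"
    using k by auto
next
  fix x assume "x \<in> msum K (segment a s) \<inter> vadd (vscale s a) ` msum K (segment a t)"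
  then obtain k \<sigma> k' \<tau> where k: "k \<in> K" "0 \<le> \<sigma>" "\<sigma> \<le> s" "x = vadd k (vscale \<sigma> a)"
    and k': "k' \<in> K" "0 \<le> \<tau>" "\<tau> \<le> t" "x = vadd (vscale s a) (vadd k' (vscale \<tau> a))"
    by (auto simp: msum_def segment_def)
  define y where "y = vadd x (vscale (-s) a)"
  have xy: "x = vadd (vscale s a) y"
    by (auto simp: y_def vec_defs)
  have y: "y i = k i - (s - \<sigma>) * a i" for i
    by (auto simp: y_def k vec_defs algebra_simps)
  have y': "y i = k' i + \<tau> * a i" for i
    using fun_cong[OF k'(4), of i] by (auto simp: y_def vec_defs algebra_simps)
  have "y \<in> K"
  proof (cases "\<tau> + (s - \<sigma>) = 0")
    case True
    then have "y = k"
      using k k' by (auto simp: y)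
    then show ?thesis
      using k by simp
  next
    case False
    define l where "l = \<tau> + (s - \<sigma>)"
    have l: "l > 0"
      using False k k' by (auto simp: l_def)
    define t where "t = (s - \<sigma>) / l"
    have "y i = (1 - t) * k i + t * k' i" for i
    proof -
      have "l * y i = \<tau> * y i + (s - \<sigma>) * y i"
        by (simp add: l_def algebra_simps)
      also have "\<dots> = \<tau> * k i + (s - \<sigma>) * k' i"
        by (subst (1) y, subst y') (simp add: algebra_simps)
      also have "\<dots> = l * ((1 - t) * k i + t * k' i)"
        using l by (simp add: t_def field_simps) (simp add: l_def algebra_simps)
      finally show ?thesis
        using l by simp
    qed
    then have "y = vadd (vscale (1 - t) k) (vscale t k')"
      by (auto simp: vec_defs)
    moreover have "t \<in> {0..1}"
      using l k k' by (auto simp: t_def l_def)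
    ultimately show ?thesis
      using K k k' by (auto simp: vconvex_def)
  qed
  then show "x \<in> vadd (vscale s a) ` K"
    using xy by auto
qed

text \<open>Inclusion-exclusion: for convex \<open>K\<close> the sets \<open>K + [0, s a]\<close> and
\<open>s a + K + [0, t a]\<close> meet exactly in \<open>s a + K\<close>. So the volume of \<open>K + [0, s a]\<close> satisfies
Cauchy's equation up to a constant, and its moments do so up to a quadratic term.\<close>

lemma aff_int_segment_add:
  assumes K: "body d K" and a: "a \<in> Rd d" and st: "s \<ge> 0" "t \<ge> 0"
  shows "aff_int d \<alpha> u (msum K (segment a (s + t))) =
     aff_int d \<alpha> u (msum K (segment a s)) + aff_int d \<alpha> u (msum K (segment a t)) - aff_int d \<alpha> u K
     + s * inner_d d u a * (vol d (msum K (segment a t)) - vol d K)"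
proof -
  have b: "body d (msum K (segment a s))" for s
    using K a by (intro body_msum body_segment)
  have sa: "vscale s a \<in> Rd d"
    using a by simp
  have "aff_int d \<alpha> u (msum K (segment a (s + t))) = aff_int d \<alpha> u (msum K (segment a s))
     + aff_int d \<alpha> u (vadd (vscale s a) ` msum K (segment a t)) - aff_int d \<alpha> u (vadd (vscale s a) ` K)"
    unfolding msum_segment_Un[OF st] aff_int_def
    using b[of s] body_translate[OF b[of t] sa] msum_segment_Int[OF st] K
    by (subst set_integral_Un_Int)
       (simp_all add: affine_set_integrable_body sets_borel_body body_def[of d K])
  then show ?thesis
    by (simp add: aff_int_translate K b sa inner_d_simps algebra_simps)
qed

text \<open>After subtracting the linear function with the same value at 1, the remainder
  \<open>H\<close> vanishes at all natural numbers. It is then periodic with period 1, hence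
  bounded, and \<open>H (n * s) = n * H s\<close> forces it to be 0.\<close>

lemma additive_bounded_linear:
  fixes G :: "real \<Rightarrow> real"
  assumes add: "\<And>s t. s \<ge> 0 \<Longrightarrow> t \<ge> 0 \<Longrightarrow> G (s + t) = G s + G t"
    and bnd: "\<And>s. 0 \<le> s \<Longrightarrow> s \<le> 1 \<Longrightarrow> \<bar>G s\<bar> \<le> B" and s: "s \<ge> 0"
  shows "G s = s * G 1"
proof -
  define H where "H s = G s - s * G 1" for s
  have Hadd: "H (s + t) = H s + H t" if "s \<ge> 0" "t \<ge> 0" for s t
    using add[OF that] by (simp add: H_def algebra_simps)
  have Hmult: "H (real n * s) = real n * H s" if "s \<ge> 0" for n s
  proof (induction n)
    case 0
    show ?case
      using Hadd[of 0 0] by simp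
  next
    case (Suc n)
    then show ?case
      using Hadd[of s "real n * s"] that by (simp add: algebra_simps)
  qed
  have Hn: "H (real n) = 0" for n
    using Hmult[of 1 n] by (simp add: H_def)
  have Hb: "\<bar>H s\<bar> \<le> B + \<bar>G 1\<bar>" if "s \<ge> 0" for s
  proof -
    define n where "n = nat \<lfloor>s\<rfloor>"
    have n: "real n \<le> s" "s - real n \<le> 1"
      unfolding n_def using that by linarith+
    have "H s = H (s - real n)"
      using Hadd[of "s - real n" "real n"] n by (simp add: Hn)
    also have "\<bar>\<dots>\<bar> \<le> \<bar>G (s - real n)\<bar> + \<bar>s - real n\<bar> * \<bar>G 1\<bar>"
      unfolding H_def by (metis abs_mult abs_triangle_ineq4)
    also have "\<dots> \<le> B + 1 * \<bar>G 1\<bar>"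
      using n by (intro add_mono bnd mult_right_mono) auto
    finally show ?thesis
      by simp
  qed
  have "H s = 0"
  proof (rule ccontr)
    assume "H s \<noteq> 0"
    then obtain n where "B + \<bar>G 1\<bar> < real n * \<bar>H s\<bar>"
      using reals_Archimedean3[of "\<bar>H s\<bar>"] by auto
    moreover have "real n * \<bar>H s\<bar> \<le> B + \<bar>G 1\<bar>"
      using Hb[of "real n * s"] Hmult[OF s, of n] s by (simp add: abs_mult)
    ultimately show False
      by simp
  qed
  then show ?thesis
    by (simp add: H_def)
qed

lemma aff_int_segment_bound:
  assumes K: "body d K" and a: "a \<in> Rd d"
  obtains B where "\<And>s. 0 \<le> s \<Longrightarrow> s \<le> 1 \<Longrightarrow> \<bar>aff_int d \<alpha> u (msum K (segment a s))\<bar> \<le> B"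
proof -
  have b: "body d (msum K (segment a s))" for s
    using K a by (intro body_msum body_segment)
  obtain R where R: "R > 0" "msum K (segment a 1) \<subseteq> cball_d d R"
    using body_bounded[OF b] by metis
  show ?thesis
  proof
    fix s :: real assume s: "0 \<le> s" "s \<le> 1"
    then have "segment a s \<subseteq> segment a 1"
      by (auto simp: segment_def)
    then have sub: "msum K (segment a s) \<subseteq> msum K (segment a 1)"
      by (simp add: msum_mono)
    then have "\<bar>aff_int d \<alpha> u (msum K (segment a s))\<bar>
      \<le> (\<bar>\<alpha>\<bar> + norm_d d u * R) * vol d (msum K (segment a s))"
      using R b by (intro aff_int_bound) (auto intro: sets_borel_body)
    also have "\<dots> \<le> (\<bar>\<alpha>\<bar> + norm_d d u * R) * vol d (msum K (segment a 1))"
      using sub R b by (intro mult_left_mono measure_mono_fmeasurable) (auto intro: sets_borel_body body_fmeasurable)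
    finally show "\<bar>aff_int d \<alpha> u (msum K (segment a s))\<bar>
      \<le> (\<bar>\<alpha>\<bar> + norm_d d u * R) * vol d (msum K (segment a 1))" .
  qed
qed

lemma measure_segment_linear:
  assumes K: "body d K" and a: "a \<in> Rd d"
  obtains \<beta> where "\<And>s. s \<ge> 0 \<Longrightarrow> vol d (msum K (segment a s)) = vol d K + \<beta> * s"
proof -
  let ?V = "\<lambda>s. vol d (msum K (segment a s))"
  have b: "body d (msum K (segment a s))" for s
    using K a by (intro body_msum body_segment)
  have i0: "inner_d d (\<lambda>_. 0) x = 0" for x
    by (simp add: inner_d_def)
  obtain B where B: "\<And>s. 0 \<le> s \<Longrightarrow> s \<le> 1 \<Longrightarrow> \<bar>?V s\<bar> \<le> B"
    using aff_int_segment_bound[OF assms, of 1 "\<lambda>_. 0"] by (auto simp: aff_int_1_0[OF b])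
  define G where "G s = ?V s - ?V 0" for s
  have "G s = s * G 1" if "s \<ge> 0" for s
  proof (rule additive_bounded_linear[OF _ _ that])
    show "G (s + t) = G s + G t" if "s \<ge> 0" "t \<ge> 0" for s t
      using aff_int_segment_add[OF assms that, of 1 "\<lambda>_. 0"] by (simp add: aff_int_1_0 b K i0 G_def)
    show "\<bar>G s\<bar> \<le> B + \<bar>?V 0\<bar>" if "0 \<le> s" "s \<le> 1" for s
      using B[OF that] unfolding G_def by linarith
  qed
  then show ?thesis
    by (intro that[of "G 1"]) (auto simp: G_def algebra_simps)
qed

lemma aff_int_segment_quadratic:
  assumes K: "body d K" and a: "a \<in> Rd d"
  obtains c1 c2 where
    "\<And>s. s \<ge> 0 \<Longrightarrow> aff_int d \<alpha> u (msum K (segment a s)) = aff_int d \<alpha> u K + c1 * s + c2 * s\<^sup>2"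
proof -
  let ?F = "\<lambda>s. aff_int d \<alpha> u (msum K (segment a s))"
  obtain \<beta> where \<beta>: "\<And>s. s \<ge> 0 \<Longrightarrow> vol d (msum K (segment a s)) = vol d K + \<beta> * s"
    using measure_segment_linear[OF assms] by metis
  \<comment> \<open>The defect of additivity is \<open>s * t * \<beta> * inner_d d u a\<close>, and
    with this \<open>c\<close> it equals \<open>c * ((s + t)^2 - s^2 - t^2)\<close>.\<close>
  define c where "c = \<beta> * inner_d d u a / 2"
  obtain B where B: "\<And>s. 0 \<le> s \<Longrightarrow> s \<le> 1 \<Longrightarrow> \<bar>?F s\<bar> \<le> B"
    using aff_int_segment_bound[OF assms] by metis
  define G where "G s = ?F s - ?F 0 - c * s\<^sup>2" for s
  have "G s = s * G 1" if "s \<ge> 0" for s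
  proof (rule additive_bounded_linear[OF _ _ that])
    show "G (s + t) = G s + G t" if "s \<ge> 0" "t \<ge> 0" for s t
      using aff_int_segment_add[OF assms that, of \<alpha> u] that
      by (simp add: \<beta> G_def c_def power2_eq_square algebra_simps)
    show "\<bar>G s\<bar> \<le> B + \<bar>?F 0\<bar> + \<bar>c\<bar>" if "0 \<le> s" "s \<le> 1" for s
    proof -
      have "\<bar>c * s\<^sup>2\<bar> \<le> \<bar>c\<bar> * 1"
        using that unfolding abs_mult by (intro mult_left_mono) (auto simp: power_le_one)
      then show ?thesis
        using B[OF that] unfolding G_def by linarith
    qed
  qed
  then show ?thesis
    by (intro that[of "G 1" c]) (auto simp: G_def algebra_simps)
qed

fun zset :: "vec list \<Rightarrow> vec set" where
  "zset [] = {\<lambda>_. 0}"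
| "zset (a # as) = msum (segment a 1) (zset as)"

lemma body_zset: "set as \<subseteq> Rd d \<Longrightarrow> body d (zset as)"
proof (induction as)
  case Nil
  have "vadd (vscale (1 - t) (\<lambda>_. 0)) (vscale t (\<lambda>_. 0)) = (\<lambda>_. 0)" for t
    by (auto simp: vec_defs)
  then show ?case
    by (auto simp: body_def vconvex_def)
qed (auto intro: body_msum body_segment)

lemma vscale_msum: "vscale r ` msum A B = msum (vscale r ` A) (vscale r ` B)"
proof -
  have "vscale r (vadd x y) = vadd (vscale r x) (vscale r y)" for x y
    by (auto simp: vec_defs algebra_simps)
  then show ?thesis
    by (auto elim!: msumE intro!: msumI simp: image_iff) (metis msumI)
qed

lemma vscale_segment: "r \<ge> 0 \<Longrightarrow> vscale r ` segment a 1 = segment a r"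
proof (intro equalityI subsetI)
  fix x assume r: "r \<ge> 0" and "x \<in> vscale r ` segment a 1"
  then obtain t where "0 \<le> t" "t \<le> 1" "x = vscale r (vscale t a)"
    by (auto simp: segment_def)
  moreover from this have "x = vscale (r * t) a" "r * t \<le> r" "0 \<le> r * t"
    using r by (auto simp: vec_defs mult_left_le)
  ultimately show "x \<in> segment a r"
    unfolding segment_def by (metis atLeastAtMost_iff imageI)
next
  fix x assume r: "r \<ge> 0" and "x \<in> segment a r"
  then obtain t where t: "0 \<le> t" "t \<le> r" "x = vscale t a"
    by (auto simp: segment_def)
  then have "x = vscale r (vscale (t / r) a)" "t / r \<le> 1" "0 \<le> t / r"
    by (auto simp: vec_defs divide_le_eq)
  then show "x \<in> vscale r ` segment a 1"
    by (auto simp: segment_def)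
qed

text \<open>In \<open>K + r Z\<close> the parameter \<open>r\<close> scales all segments at once.
  The induction decouples them: in \<open>g r s\<close> the first segment has its own length
  \<open>s\<close> and the others are scaled by \<open>r\<close>. The dependence on \<open>s\<close>
  is quadratic, the one on \<open>r\<close> polynomial by the induction hypothesis for the body
  \<open>K + [0, s a]\<close>, and at the end \<open>s = r\<close>.\<close>

lemma aff_int_zset_poly:
  assumes "body d K" "set as \<subseteq> Rd d"
  shows "\<exists>p. \<forall>r\<ge>0. aff_int d \<alpha> u (msum K (vscale r ` zset as)) = poly p r"
  using assms
proof (induction as arbitrary: K)
  case Nil
  have "msum K (vscale r ` zset []) = K" for r
    by (auto simp: msum_def vec_defs)
  then show ?case
    by (intro exI[of _ "[:aff_int d \<alpha> u K:]"]) simp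
next
  case (Cons a as)
  have a: "a \<in> Rd d" and as: "set as \<subseteq> Rd d"
    using Cons.prems by auto
  define g where "g r s = aff_int d \<alpha> u (msum (msum K (segment a s)) (vscale r ` zset as))" for r s
  have "\<exists>p. \<forall>r\<ge>0. g r s = poly p r" for s
    unfolding g_def using Cons.prems by (intro Cons.IH body_msum body_segment) auto
  then obtain p where p: "\<And>r s. r \<ge> 0 \<Longrightarrow> g r s = poly (p s) r"
    by metis
  \<comment> \<open>The quadratic in \<open>s\<close> has coefficients depending on \<open>r\<close>
    in an unknown way. Interpolation at 0, 1, 2 expresses it through three values that are
    polynomials in \<open>r\<close>.\<close>
  have interp: "g r s = g r 0 * ((s - 1) * (s - 2) / 2) - g r 1 * (s * (s - 2)) + g r 2 * (s * (s - 1) / 2)"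
    if s: "s \<ge> 0" for r s
  proof -
    have b: "body d (msum K (vscale r ` zset as))"
      using Cons.prems as by (intro body_msum body_scale body_zset)
    have "g r s = aff_int d \<alpha> u (msum (msum K (vscale r ` zset as)) (segment a s))" for s
      unfolding g_def msum_assoc by (subst (2) msum_commute) simp
    then obtain c1 c2 where c: "\<And>s. s \<ge> 0 \<Longrightarrow> g r s = aff_int d \<alpha> u (msum K (vscale r ` zset as)) + c1 * s + c2 * s\<^sup>2"
      using aff_int_segment_quadratic[OF b a, of \<alpha> u] by metis
    show ?thesis
      unfolding c[OF s] c[of 0, simplified] c[of 1, simplified] c[of 2, simplified]
      by (simp add: field_simps power2_eq_square)
  qed
  have "aff_int d \<alpha> u (msum K (vscale r ` zset (a # as))) =
     poly (p 0 * ([:-1, 1:] * [:-2, 1:] * [:1/2:]) - p 1 * ([:0, 1:] * [:-2, 1:])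
         + p 2 * ([:0, 1:] * [:-1, 1:] * [:1/2:])) r" if r: "r \<ge> 0" for r
  proof -
    have "aff_int d \<alpha> u (msum K (vscale r ` zset (a # as))) = g r r"
      using r by (simp add: g_def vscale_msum vscale_segment msum_assoc)
    also have "\<dots> = poly (p 0 * ([:-1, 1:] * [:-2, 1:] * [:1/2:]) - p 1 * ([:0, 1:] * [:-2, 1:])
         + p 2 * ([:0, 1:] * [:-1, 1:] * [:1/2:])) r"
      by (subst interp[OF r]) (simp add: p[OF r] field_simps)
    finally show ?thesis .
  qed
  then show ?case
    by blast
qed

text \<open>The polynomials obtained for zonotopes with many segments have a priori a large
degree; their growth reduces it to at most \<open>d + 1\<close>.\<close>

lemma degree_le_of_growth:
  fixes p :: "real poly"
  assumes "\<And>x. x \<ge> 0 \<Longrightarrow> \<bar>poly p x\<bar> \<le> C * (1 + x) ^ n"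
  shows "degree p \<le> n"
proof (rule ccontr)
  assume "\<not> degree p \<le> n"
  define m where "m = degree p"
  have m: "m > n"
    using \<open>\<not> degree p \<le> n\<close> by (simp add: m_def)
  have 1: "((\<lambda>x. poly p x / x ^ m) \<longlongrightarrow> lead_coeff p) at_top"
    unfolding m_def using poly_divide_tendsto_aux[of p]
    by (rule filterlim_mono) (auto simp: at_top_le_at_infinity)
  have inv: "((\<lambda>x::real. inverse x) \<longlongrightarrow> 0) at_top"
    by (rule tendsto_inverse_0_at_top) (rule filterlim_ident)
  have "((\<lambda>x::real. \<bar>C\<bar> * (1 + inverse x) ^ n * inverse x ^ (m - n)) \<longlongrightarrow> \<bar>C\<bar> * (1 + 0) ^ n * 0 ^ (m - n)) at_top"
    by (intro tendsto_intros inv)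
  then have 2: "((\<lambda>x::real. \<bar>C\<bar> * (1 + inverse x) ^ n * inverse x ^ (m - n)) \<longlongrightarrow> 0) at_top"
    using m by (simp add: power_0_left)
  have "((\<lambda>x. poly p x / x ^ m) \<longlongrightarrow> 0) at_top"
  proof (rule Lim_null_comparison[OF _ 2], rule eventually_mono[OF eventually_gt_at_top[of 0]])
    fix x :: real assume x: "x > 0"
    have "norm (poly p x / x ^ m) \<le> \<bar>C\<bar> * (1 + x) ^ n / x ^ m"
      using x assms[of x] by (simp add: divide_right_mono order_trans[OF _ mult_right_mono[of C "\<bar>C\<bar>"]])
    also have "\<dots> = \<bar>C\<bar> * ((1 + x) ^ n / x ^ n) * (1 / x ^ (m - n))"
      using m by (simp add: power_add[symmetric])
    also have "(1 + x) ^ n / x ^ n = ((1 + x) / x) ^ n"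
      by (rule power_divide[symmetric])
    also have "(1 + x) / x = 1 + inverse x"
      using x by (simp add: divide_inverse algebra_simps)
    finally show "norm (poly p x / x ^ m) \<le> \<bar>C\<bar> * (1 + inverse x) ^ n * inverse x ^ (m - n)"
      by (simp add: power_inverse divide_inverse)
  qed
  then have "lead_coeff p = 0"
    using tendsto_unique[OF trivial_limit_at_top_linorder 1] by blast
  then show False
    using m by (simp add: m_def)
qed

section \<open>Lagrange interpolation and pointwise limits of polynomials\<close>

definition lagrange :: "nat \<Rightarrow> nat \<Rightarrow> real poly" where
  "lagrange n j = smult (1 / (\<Prod>i\<in>{..n}-{j}. real j - real i)) (\<Prod>i\<in>{..n}-{j}. [:- real i, 1:])"

lemma poly_lagrange:
  assumes "j \<le> n" "l \<le> n"
  shows "poly (lagrange n j) (real l) = (if l = j then 1 else 0)"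
proof (cases "l = j")
  case True
  have "(\<Prod>i\<in>{..n}-{j}. real j - real i) \<noteq> 0"
    by simp
  then show ?thesis
    using True by (simp add: lagrange_def poly_prod)
next
  case False
  have "(\<Prod>i\<in>{..n}-{j}. real l - real i) = 0"
    using assms False by (subst prod_zero_iff) auto
  then show ?thesis
    using False by (simp add: lagrange_def poly_prod)
qed

lemma degree_lagrange: "j \<le> n \<Longrightarrow> degree (lagrange n j) \<le> n"
  unfolding lagrange_def
  by (rule order_trans[OF degree_smult_le], rule order_trans[OF degree_prod_sum_le]) auto

lemma poly_lagrange_expansion:
  fixes p :: "real poly"
  assumes "degree p \<le> n"
  shows "p = (\<Sum>j\<le>n. smult (poly p (real j)) (lagrange n j))"
proof (rule poly_eqI_degree[of "real ` {..n}"])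
  have card: "card (real ` {..n}) = Suc n"
    by (simp add: card_image)
  show "degree p < card (real ` {..n})"
    using assms card by simp
  have "degree (\<Sum>j\<le>n. smult (poly p (real j)) (lagrange n j)) \<le> n"
    by (intro degree_sum_le order_trans[OF degree_smult_le] degree_lagrange) auto
  then show "degree (\<Sum>j\<le>n. smult (poly p (real j)) (lagrange n j)) < card (real ` {..n})"
    using card by simp
  fix x assume "x \<in> real ` {..n}"
  then obtain l where l: "l \<le> n" "x = real l"
    by auto
  have "poly (\<Sum>j\<le>n. smult (poly p (real j)) (lagrange n j)) x = (\<Sum>j\<le>n. if l = j then poly p (real j) else 0)"
    unfolding poly_sum using l by (intro sum.cong) (auto simp: poly_lagrange)
  then show "poly p x = poly (\<Sum>j\<le>n. smult (poly p (real j)) (lagrange n j)) x"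
    using l by simp
qed

text \<open>With a common degree bound a polynomial is determined by its values at
  \<open>0..n\<close>, and the interpolation formula is continuous in these values; so the limit is
  the interpolating polynomial of its own values.\<close>

lemma poly_pointwise_limit:
  fixes p :: "nat \<Rightarrow> real poly" and f :: "real \<Rightarrow> real"
  assumes deg: "\<And>k. degree (p k) \<le> n" and lim: "\<And>r. r \<ge> 0 \<Longrightarrow> (\<lambda>k. poly (p k) r) \<longlonglongrightarrow> f r"
  shows "\<exists>q. degree q \<le> n \<and> (\<forall>r\<ge>0. f r = poly q r)"
proof (intro exI conjI allI impI)
  let ?q = "\<Sum>j\<le>n. smult (f (real j)) (lagrange n j)"
  show "degree ?q \<le> n"
    by (intro degree_sum_le order_trans[OF degree_smult_le] degree_lagrange) auto
  fix r :: real assume r: "r \<ge> 0"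
  have "(\<lambda>k. \<Sum>j\<le>n. poly (p k) (real j) * poly (lagrange n j) r) \<longlonglongrightarrow> (\<Sum>j\<le>n. f (real j) * poly (lagrange n j) r)"
    by (intro tendsto_intros lim) auto
  moreover have "(\<Sum>j\<le>n. poly (p k) (real j) * poly (lagrange n j) r) = poly (p k) r" for k
    by (subst (2) poly_lagrange_expansion[OF deg]) (simp add: poly_sum)
  ultimately show "f r = poly ?q r"
    using LIMSEQ_unique[OF lim[OF r]] by (simp add: poly_sum)
qed

subsection \<open>The ball is a limit of zonotopes\<close>

lemma reflect_cball_d_iff:
  assumes "u \<in> Rd d" shows "reflect d u x \<in> cball_d d r \<longleftrightarrow> x \<in> cball_d d r"
proof -
  have "reflect d u x \<in> Rd d \<longleftrightarrow> x \<in> Rd d"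
    using reflect_Rd[OF assms] reflect_reflect by metis
  then show ?thesis
    by (simp add: cball_d_def norm_reflect)
qed

lemma reflect_swap_unit:
  assumes u: "u1 \<in> Rd d" "u2 \<in> Rd d" "norm_d d u1 = 1" "norm_d d u2 = 1"
  shows "reflect d (vsub u1 u2) u1 = u2"
proof -
  let ?v = "vsub u1 u2"
  have 1: "inner_d d u1 u1 = 1" "inner_d d u2 u2 = 1"
    using u by (simp_all add: norm_d_power2[symmetric])
  \<comment> \<open>Equality of the two norms makes the coefficient in \<open>reflect\<close> equal
    to 1, so that \<open>u1\<close> goes to \<open>u1 - ?v = u2\<close>.\<close>
  have vv: "inner_d d ?v ?v = 2 * inner_d d ?v u1"
    using 1 by (simp add: inner_d_simps inner_d_commute[of d u2 u1])
  show ?thesis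
  proof (cases "inner_d d ?v ?v = 0")
    case True
    then have "?v = (\<lambda>i. 0)"
      using u by (intro norm_d_eq_0_Rd[of _ d]) (auto simp: norm_d_def)
    then have "u1 = u2"
      by (auto simp: vsub_def fun_eq_iff)
    then show ?thesis
      by (auto simp: reflect_def vec_defs)
  next
    case False
    then show ?thesis
      unfolding reflect_def using vv by (auto simp: vec_defs)
  qed
qed

text \<open>The support function, at a unit vector \<open>u\<close>, of the continuous Minkowski sum
  of the segments \<open>[-x, x]\<close> over the unit ball. It does not depend on \<open>u\<close>,
  so that sum is a ball with this radius.\<close>

definition ball_const :: "nat \<Rightarrow> vec \<Rightarrow> real" where
  "ball_const d u = (LINT x:cball_d d 1|lebv d. \<bar>inner_d d u x\<bar>)"

lemma ball_const_eq:
  assumes u: "u1 \<in> Rd d" "u2 \<in> Rd d" "norm_d d u1 = 1" "norm_d d u2 = 1"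
  shows "ball_const d u1 = ball_const d u2"
proof -
  let ?R = "reflect d (vsub u1 u2)"
  have "ball_const d u1 = (LINT x|lebv d. indicator (cball_d d 1) (?R x) * \<bar>inner_d d u1 (?R x)\<bar>)"
    unfolding ball_const_def set_lebesgue_integral_def
    using u by (subst integral_lebv_reflect) auto
  also have "\<dots> = (LINT x|lebv d. indicator (cball_d d 1) x * \<bar>inner_d d u2 x\<bar>)"
    using u by (simp add: indicator_def reflect_cball_d_iff inner_reflect[symmetric] reflect_swap_unit)
  finally show ?thesis
    by (simp add: ball_const_def set_lebesgue_integral_def)
qed

lemma set_integrable_cball:
  fixes f :: "vec \<Rightarrow> real"
  assumes "f \<in> borel_measurable borel" "\<And>x. x \<in> cball_d d 1 \<Longrightarrow> \<bar>f x\<bar> \<le> B"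
  shows "set_integrable (lebv d) (cball_d d 1) f"
  by (rule set_integrable_bounded[OF _ order_refl assms]) simp

lemma inner_abs_le: "norm_d d u = 1 \<Longrightarrow> \<bar>inner_d d u x\<bar> \<le> norm_d d x"
  using inner_d_Cauchy_Schwarz[of d u x] by simp

lemma set_integrable_abs_inner:
  assumes "norm_d d u = 1"
  shows "set_integrable (lebv d) (cball_d d 1) (\<lambda>x. \<bar>inner_d d u x\<bar>)"
proof (rule set_integrable_cball)
  show "\<bar>\<bar>inner_d d u x\<bar>\<bar> \<le> 1" if "x \<in> cball_d d 1" for x
    using inner_abs_le[OF assms, of x] that by (auto simp: cball_d_def)
qed measurable

lemma set_integrable_component_sgn:
  assumes "j < d"
  shows "set_integrable (lebv d) (cball_d d 1) (\<lambda>x. x j * sgn (inner_d d u x))"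
proof (rule set_integrable_cball)
  show "\<bar>x j * sgn (inner_d d u x)\<bar> \<le> 1" if "x \<in> cball_d d 1" for x
    using abs_component_le_norm_d[OF assms, of x] that by (auto simp: cball_d_def abs_mult sgn_if)
qed measurable

lemma measure_cball_d_pos: "r > 0 \<Longrightarrow> vol d (cball_d d r) > 0"
  using emeasure_cball_d_pos[of r d] emeasure_cball_d_finite[of d r]
  by (simp add: measure_def enn2real_positive_iff)

lemma ball_const_pos:
  assumes u: "u \<in> Rd d" "norm_d d u = 1" shows "ball_const d u > 0"
proof -
  \<comment> \<open>A ball of radius 1/4 around \<open>u / 2\<close> stays in the unit ball, and
    \<open>inner_d d u\<close> is at least \<open>1/2 - 1/4\<close> on it.\<close>
  define C where "C = vadd (vscale (1/2) u) ` cball_d d (1/4)"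
  have bC: "body d C"
    unfolding C_def by (intro body_translate body_cball_d) (use u in simp)
  have C: "C \<in> sets borel"
    by (rule sets_borel_body[OF bC])
  have mC: "vol d C = vol d (cball_d d (1/4))"
    using C u unfolding C_def by (intro measure_translate) auto
  have uu: "inner_d d u u = 1"
    using u by (simp add: norm_d_power2[symmetric])
  have low: "x \<in> cball_d d 1 \<and> 1/4 \<le> \<bar>inner_d d u x\<bar>" if x: "x \<in> C" for x
  proof -
    obtain y where y: "y \<in> cball_d d (1/4)" "x = vadd (vscale (1/2) u) y"
      using x by (auto simp: C_def)
    have "norm_d d x \<le> 1/2 + 1/4"
      using norm_d_triangle[of d "vscale (1/2) u" y] y u by (simp add: norm_d_scale cball_d_def)
    moreover have "\<bar>inner_d d u y\<bar> \<le> 1/4"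
      using inner_abs_le[of d u y] u y by (simp add: cball_d_def)
    ultimately show ?thesis
      using y u uu by (auto simp: cball_d_def inner_d_simps)
  qed
  have "0 < (1/4) * vol d C"
    using mC measure_cball_d_pos[of "1/4" d] by simp
  also have "\<dots> = (LINT x:C|lebv d. 1/4)"
    using C body_emeasure_finite[OF bC] by (subst set_integral_const) auto
  also have "\<dots> \<le> ball_const d u"
    unfolding ball_const_def set_lebesgue_integral_def
  proof (rule integral_mono)
    show "integrable (lebv d) (\<lambda>x. indicator C x *\<^sub>R (1/4::real))"
      using C body_emeasure_finite[OF bC] by simp
    show "integrable (lebv d) (\<lambda>x. indicator (cball_d d 1) x *\<^sub>R \<bar>inner_d d u x\<bar>)"
      unfolding set_integrable_def[symmetric] by (rule set_integrable_abs_inner[OF u(2)])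
  qed (use low in \<open>auto simp: indicator_def\<close>)
  finally show ?thesis .
qed

text \<open>The part \<open>w\<close> of the \<open>j\<close>-th unit vector orthogonal to
  \<open>u\<close> contributes nothing: the reflection along \<open>w\<close> keeps
  \<open>inner_d d u x\<close> and changes the sign of \<open>inner_d d w x\<close>. Only the part
  \<open>u j * inner_d d u x\<close> of \<open>x j\<close> remains, and its product with the sign is
  \<open>u j\<close> times an absolute value.\<close>

lemma ball_sgn_moment:
  assumes u: "u \<in> Rd d" "norm_d d u = 1" and j: "j < d"
  shows "(LINT x:cball_d d 1|lebv d. x j * sgn (inner_d d u x)) = u j * ball_const d u"
proof -
  let ?B = "cball_d d 1"
  define e where "e = (\<lambda>i. if i = j then 1 else 0 :: real)"
  define w where "w = vsub e (vscale (u j) u)"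
  have uu: "inner_d d u u = 1"
    using u by (simp add: norm_d_power2[symmetric])
  have ex: "inner_d d e x = x j" for x
    using j by (simp add: inner_d_def e_def if_distrib[of "\<lambda>a. a * _"] cong: if_cong)
  have wRd: "w \<in> Rd d"
    using u j by (auto simp: w_def e_def Rd_def vec_defs)
  have uw: "inner_d d u w = 0"
    using ex[of u] by (simp add: w_def inner_d_simps uu inner_d_commute[of d u e])
  have wR: "inner_d d w (reflect d w x) = - inner_d d w x" for x
  proof (cases "inner_d d w w = 0")
    case True
    then have "inner_d d w x = 0" for x
      using inner_d_Cauchy_Schwarz[of d w x] by (simp add: norm_d_def)
    then show ?thesis
      by simp
  qed (simp add: reflect_def inner_d_simps)
  have uR: "inner_d d u (reflect d w x) = inner_d d u x" for x
    by (simp add: reflect_def inner_d_simps uw)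
  have wx: "inner_d d w x = x j - u j * inner_d d u x" for x
    by (simp add: w_def inner_d_simps ex)
  let ?f = "\<lambda>x. indicator ?B x * (inner_d d w x * sgn (inner_d d u x))"
  have "(LINT x|lebv d. ?f x) = (LINT x|lebv d. ?f (reflect d w x))"
    using wRd by (subst integral_lebv_reflect) auto
  also have "\<dots> = (LINT x|lebv d. - ?f x)"
    by (intro Bochner_Integration.integral_cong)
       (auto simp: wR uR indicator_def reflect_cball_d_iff[OF wRd])
  finally have zero: "(LINT x:?B|lebv d. inner_d d w x * sgn (inner_d d u x)) = 0"
    by (simp add: set_lebesgue_integral_def)
  note i1 = set_integrable_component_sgn[OF j, of u]
  note i2 = set_integrable_abs_inner[OF u(2)]
  have "inner_d d w x * sgn (inner_d d u x) = x j * sgn (inner_d d u x) - u j * \<bar>inner_d d u x\<bar>" for x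
    by (simp add: wx sgn_if algebra_simps abs_if)
  then have "0 = (LINT x:?B|lebv d. x j * sgn (inner_d d u x)) - (LINT x:?B|lebv d. u j * \<bar>inner_d d u x\<bar>)"
    using zero i1 i2 by (simp add: set_integral_diff)
  then show ?thesis
    by (simp add: ball_const_def)
qed

text \<open>The segments of \<open>zset\<close> start at 0. A generator together with its opposite
  contributes \<open>[0, v] + [0, -v] = [-v, v]\<close>, which makes the zonotope centrally
  symmetric.\<close>

definition pm_list :: "vec list \<Rightarrow> vec list" where
  "pm_list vs = concat (map (\<lambda>v. [v, vscale (-1) v]) vs)"

lemma pm_list_simps [simp]: "pm_list [] = []" "pm_list (v # vs) = v # vscale (-1) v # pm_list vs"
  by (simp_all add: pm_list_def)

lemma set_pm_list: "set vs \<subseteq> Rd d \<Longrightarrow> set (pm_list vs) \<subseteq> Rd d"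
  by (induction vs) auto

lemma zero_in_zset: "(\<lambda>_. 0) \<in> zset as"
proof (induction as)
  case (Cons a as)
  have "vadd (vscale 0 a) (\<lambda>_. 0) \<in> zset (a # as)"
    using Cons unfolding zset.simps by (intro msumI) (auto simp: segment_def)
  then show ?case
    by (simp add: vec_defs)
qed simp

lemma zset_pm_list_mem:
  assumes "\<And>v. v \<in> set vs \<Longrightarrow> \<bar>s v\<bar> \<le> 1"
  shows "(\<lambda>i. \<Sum>v\<leftarrow>vs. s v * a v i) \<in> zset (pm_list (map a vs))"
  using assms
proof (induction vs)
  case (Cons v vs)
  \<comment> \<open>Positive and negative part of the coefficient: one for the segment of
    \<open>a v\<close>, one for that of its opposite.\<close>
  define t where "t = max 0 (s v)"
  define t' where "t' = max 0 (- s v)"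
  have t: "t \<in> {0..1}" "t' \<in> {0..1}" "s v = t - t'"
    using Cons.prems[of v] by (auto simp: t_def t'_def)
  have "vadd (vscale t (a v)) (vadd (vscale t' (vscale (-1) (a v))) (\<lambda>i. \<Sum>v\<leftarrow>vs. s v * a v i))
      \<in> zset (pm_list (map a (v # vs)))"
    unfolding list.map pm_list_simps zset.simps
    using t by (intro msumI Cons.IH Cons.prems) (auto simp: segment_def)
  also have "vadd (vscale t (a v)) (vadd (vscale t' (vscale (-1) (a v))) (\<lambda>i. \<Sum>v\<leftarrow>vs. s v * a v i))
     = (\<lambda>i. \<Sum>v\<leftarrow>v # vs. s v * a v i)"
    by (auto simp: vec_defs t algebra_simps)
  finally show ?case .
qed simp

lemma zset_pm_list_inner_le:
  assumes "z \<in> zset (pm_list vs)"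
  shows "inner_d d u z \<le> (\<Sum>v\<leftarrow>vs. \<bar>inner_d d u v\<bar>)"
  using assms
proof (induction vs arbitrary: z)
  case Nil
  then show ?case
    by (simp add: inner_d_def)
next
  case (Cons v vs)
  then obtain t t' z' where t: "0 \<le> t" "t \<le> 1" "0 \<le> t'" "t' \<le> 1" "z' \<in> zset (pm_list vs)"
     and z: "z = vadd (vscale t v) (vadd (vscale t' (vscale (-1) v)) z')"
    by (auto elim!: msumE simp: segment_def)
  have "inner_d d u z = (t - t') * inner_d d u v + inner_d d u z'"
    by (simp add: z inner_d_simps algebra_simps)
  moreover have "(t - t') * inner_d d u v \<le> \<bar>t - t'\<bar> * \<bar>inner_d d u v\<bar>"
    by (metis abs_ge_self abs_mult)
  moreover have "\<bar>t - t'\<bar> * \<bar>inner_d d u v\<bar> \<le> 1 * \<bar>inner_d d u v\<bar>"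
    using t by (intro mult_right_mono) auto
  ultimately show ?case
    using Cons.IH[OF t(5)] by simp
qed

definition grid :: "nat \<Rightarrow> nat \<Rightarrow> vec \<Rightarrow> vec" where
  "grid d N x = (\<lambda>i. if i < d then of_int \<lfloor>real N * x i\<rfloor> / real N else 0)"

lemma grid_Rd: "grid d N x \<in> Rd d"
  by (auto simp: grid_def Rd_def)

lemma measurable_grid [measurable]: "grid d N \<in> borel_measurable borel"
proof (rule measurable_vecI)
  show "(\<lambda>x. grid d N x i) \<in> borel_measurable borel" for i
    by (cases "i < d") (simp_all add: grid_def)
qed

lemma grid_error:
  assumes "N > 0" "i < d" shows "\<bar>grid d N x i - x i\<bar> \<le> 1 / real N"
proof -
  have "\<bar>of_int \<lfloor>real N * x i\<rfloor> - real N * x i\<bar> \<le> 1"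
    by linarith
  then have "\<bar>of_int \<lfloor>real N * x i\<rfloor> - real N * x i\<bar> / real N \<le> 1 / real N"
    using assms by (intro divide_right_mono) auto
  also have "\<bar>of_int \<lfloor>real N * x i\<rfloor> - real N * x i\<bar> / real N = \<bar>(of_int \<lfloor>real N * x i\<rfloor> - real N * x i) / real N\<bar>"
    using assms by simp
  also have "(of_int \<lfloor>real N * x i\<rfloor> - real N * x i) / real N = grid d N x i - x i"
    using assms by (simp add: grid_def diff_divide_distrib)
  finally show ?thesis .
qed

lemma finite_grid_cball:
  assumes "N > 0" shows "finite (grid d N ` cball_d d 1)"
proof (rule finite_subset)
  let ?F = "(\<lambda>k. of_int k / real N) ` {- int N - 1..int N + 1}"
  show "grid d N ` cball_d d 1 \<subseteq> pad d ` PiE {..<d} (\<lambda>_. ?F)"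
  proof safe
    fix x assume x: "x \<in> cball_d d 1"
    have "grid d N x i \<in> ?F" if i: "i < d" for i
    proof -
      have "\<bar>x i\<bar> \<le> 1"
        using abs_component_le_norm_d[OF i, of x] x by (auto simp: cball_d_def)
      then have "\<bar>real N * x i\<bar> \<le> real N * 1"
        unfolding abs_mult by (intro mult_mono) auto
      then have "\<lfloor>real N * x i\<rfloor> \<in> {- int N - 1..int N + 1}"
        unfolding atLeastAtMost_iff by linarith
      then show ?thesis
        using i by (auto simp: grid_def)
    qed
    then have "restrict (grid d N x) {..<d} \<in> PiE {..<d} (\<lambda>_. ?F)"
      by auto
    moreover have "grid d N x = pad d (restrict (grid d N x) {..<d})"
      by (auto simp: pad_def grid_def)
    ultimately show "grid d N x \<in> pad d ` PiE {..<d} (\<lambda>_. ?F)"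
      by blast
  qed
  show "finite (pad d ` PiE {..<d} (\<lambda>_. ?F))"
    by (intro finite_imageI finite_PiE) auto
qed

text \<open>By \<open>ball_sgn_moment\<close> a unit vector \<open>u\<close> is \<open>1/\<kappa>\<close> times the integral of
\<open>x sgn \<langle>u, x\<rangle>\<close> over the unit ball. Rounding \<open>x\<close> to a grid turns this integral into a combination,
with coefficients in \<open>[-1, 1]\<close>, of finitely many vectors that do not depend on \<open>u\<close>.\<close>

lemma zonotope_near_ball:
  assumes d: "d > 0" and N: "N > 0" and u0: "u0 \<in> Rd d" "norm_d d u0 = 1"
  defines "\<epsilon> \<equiv> real d * vol d (cball_d d 1) / (ball_const d u0 * real N)"
  obtains as where "set as \<subseteq> Rd d" "zset as \<subseteq> cball_d d (1 + \<epsilon>)"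
    "cball_d d 1 \<subseteq> msum (zset as) (cball_d d \<epsilon>)"
proof -
  let ?B = "cball_d d 1"
  define \<kappa> where "\<kappa> = ball_const d u0"
  have \<kappa>: "\<kappa> > 0"
    unfolding \<kappa>_def by (rule ball_const_pos[OF u0])
  have \<kappa>_eq: "ball_const d u = \<kappa>" if "u \<in> Rd d" "norm_d d u = 1" for u
    unfolding \<kappa>_def by (rule ball_const_eq[OF that(1) u0(1) that(2) u0(2)])
  have \<epsilon>0: "\<epsilon> \<ge> 0"
    using \<kappa> by (simp add: \<epsilon>_def \<kappa>_def)
  define G where "G = grid d N ` ?B"
  have finG: "finite G"
    unfolding G_def by (rule finite_grid_cball[OF N])
  then obtain vs0 where vs0: "set vs0 = G" "distinct vs0"
    using finite_distinct_list by metis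
  \<comment> \<open>The points of the ball that are rounded to \<open>v\<close>; on such a cell the
    rounded integrand is constant in the rounded factor.\<close>
  define C where "C v = ?B \<inter> grid d N -` {v}" for v
  have Cm [measurable]: "C v \<in> sets borel" for v
    unfolding C_def by (intro sets.Int measurable_sets_borel[OF measurable_grid]) auto
  have CB: "C v \<subseteq> ?B" for v
    by (auto simp: C_def)
  define m where "m v = vol d (C v)" for v
  \<comment> \<open>All segments \<open>[-x, x]\<close> with \<open>x\<close> in the cell of
    \<open>v\<close> are replaced by \<open>[-v, v]\<close>, weighted by the volume of the cell;
    division by \<open>\<kappa>\<close> normalizes the resulting ball to radius 1.\<close>
  define a where "a v = vscale (m v / \<kappa>) v" for v
  have sumlist: "(\<Sum>v\<leftarrow>vs0. h v) = (\<Sum>v\<in>G. h v)" for h :: "vec \<Rightarrow> real"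
    using vs0 by (simp add: sum_list_distinct_conv_sum_set)
  have cells: "(\<Sum>v\<in>G. LINT x:C v|lebv d. g x) = (LINT x:?B|lebv d. g x)"
    if g: "g \<in> borel_measurable borel" "\<And>x. x \<in> ?B \<Longrightarrow> \<bar>g x\<bar> \<le> M" for g :: "vec \<Rightarrow> real" and M
  proof -
    have "(LINT x:(\<Union>v\<in>G. C v)|lebv d. g x) = (\<Sum>v\<in>G. LINT x:C v|lebv d. g x)"
    proof (rule set_integral_finite_Union[OF finG])
      show "disjoint_family_on C G"
        by (auto simp: disjoint_family_on_def C_def)
      show "set_integrable (lebv d) (C v) g" for v
        using g CB by (intro set_integrable_bounded[of _ d 1 _ M]) auto
    qed auto
    moreover have "(\<Union>v\<in>G. C v) = ?B"
      by (auto simp: C_def G_def)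
    ultimately show ?thesis
      by simp
  qed
  have gridB: "\<bar>grid d N x i\<bar> \<le> 2" if "x \<in> ?B" for x i
  proof (cases "i < d")
    case True
    have "\<bar>x i\<bar> \<le> 1" "1 / real N \<le> 1"
      using abs_component_le_norm_d[OF True, of x] that N by (auto simp: cball_d_def)
    then show ?thesis
      using grid_error[OF N True, of x] by linarith
  qed (simp add: grid_def)
  have inner_grid: "\<bar>inner_d d u (grid d N x)\<bar> \<le> real d * 2" if "norm_d d u = 1" "x \<in> ?B" for u x
  proof -
    have "\<bar>inner_d d u (grid d N x)\<bar> \<le> (\<Sum>i<d. \<bar>grid d N x i\<bar>)"
      using inner_abs_le[OF that(1)] norm_d_le_sum_abs by (rule order_trans)
    also have "\<dots> \<le> (\<Sum>i<d. 2)"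
      by (intro sum_mono gridB[OF that(2)])
    finally show ?thesis
      by simp
  qed
  have gridn: "norm_d d (vsub (grid d N x) x) \<le> real d / real N" for x
  proof -
    have "norm_d d (vsub (grid d N x) x) \<le> (\<Sum>i<d. \<bar>vsub (grid d N x) x i\<bar>)"
      by (rule norm_d_le_sum_abs)
    also have "\<dots> \<le> (\<Sum>i<d. 1 / real N)"
      by (intro sum_mono) (auto simp: vsub_def intro: grid_error[OF N])
    finally show ?thesis
      by simp
  qed
  define as where "as = pm_list (map a vs0)"
  have asRd: "set as \<subseteq> Rd d"
    unfolding as_def by (rule set_pm_list) (auto simp: vs0 G_def a_def grid_Rd)
  have volB: "vol d ?B \<ge> 0"
    by simp
  have Bfin: "emeasure (lebv d) ?B < \<infinity>"
    by (rule emeasure_cball_d_finite)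
  show ?thesis
  proof
    show "set as \<subseteq> Rd d"
      by (rule asRd)
    show "zset as \<subseteq> cball_d d (1 + \<epsilon>)"
    proof
      fix z assume z: "z \<in> zset as"
      then have zRd: "z \<in> Rd d"
        using body_zset[OF asRd] by (auto simp: body_def)
      show "z \<in> cball_d d (1 + \<epsilon>)"
      proof (cases "norm_d d z = 0")
        case True
        then show ?thesis
          using zRd \<epsilon>0 by (simp add: cball_d_def)
      next
        case False
        \<comment> \<open>Testing \<open>z\<close> in its own direction turns the norm into a value
          of the support function, which is an integral over the ball up to the rounding
          error.\<close>
        define u where "u = vscale (inverse (norm_d d z)) z"
        have u: "u \<in> Rd d" "norm_d d u = 1"
          using zRd False by (auto simp: u_def norm_d_scale)
        have "norm_d d z = inner_d d u z"
          using False by (simp add: u_def inner_d_simps norm_d_power2[symmetric] power2_eq_square)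
        also have "\<dots> \<le> (\<Sum>v\<leftarrow>map a vs0. \<bar>inner_d d u v\<bar>)"
          using z unfolding as_def by (rule zset_pm_list_inner_le)
        also have "\<dots> = (\<Sum>v\<in>G. m v / \<kappa> * \<bar>inner_d d u v\<bar>)"
          using \<kappa> by (simp add: o_def sumlist a_def inner_d_simps abs_mult m_def)
        also have "\<dots> = (\<Sum>v\<in>G. (LINT x:C v|lebv d. \<bar>inner_d d u (grid d N x)\<bar>)) / \<kappa>"
          unfolding sum_divide_distrib
        proof (rule sum.cong[OF refl])
          fix v
          have "(LINT x:C v|lebv d. \<bar>inner_d d u (grid d N x)\<bar>) = (LINT x:C v|lebv d. \<bar>inner_d d u v\<bar>)"
            by (rule set_lebesgue_integral_cong) (auto simp: C_def)
          also have "\<dots> = \<bar>inner_d d u v\<bar> * m v"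
            using emeasure_bounded_finite[OF CB[of v]] by (subst set_integral_const) (auto simp: m_def)
          finally show "m v / \<kappa> * \<bar>inner_d d u v\<bar> = (LINT x:C v|lebv d. \<bar>inner_d d u (grid d N x)\<bar>) / \<kappa>"
            by simp
        qed
        also have "(\<Sum>v\<in>G. (LINT x:C v|lebv d. \<bar>inner_d d u (grid d N x)\<bar>))
           = (LINT x:?B|lebv d. \<bar>inner_d d u (grid d N x)\<bar>)"
        proof (rule cells)
          show "\<bar>\<bar>inner_d d u (grid d N x)\<bar>\<bar> \<le> real d * 2" if "x \<in> ?B" for x
            using inner_grid[OF u(2) that] by simp
        qed measurable
        also have "\<dots> \<le> (LINT x:?B|lebv d. \<bar>inner_d d u x\<bar> + real d / real N)"
        proof (rule set_integral_mono)
          show "set_integrable (lebv d) ?B (\<lambda>x. \<bar>inner_d d u (grid d N x)\<bar>)"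
          proof (rule set_integrable_cball)
            show "\<bar>\<bar>inner_d d u (grid d N x)\<bar>\<bar> \<le> real d * 2" if "x \<in> ?B" for x
              using inner_grid[OF u(2) that] by simp
          qed measurable
          show "set_integrable (lebv d) ?B (\<lambda>x. \<bar>inner_d d u x\<bar> + real d / real N)"
          proof (rule set_integrable_cball)
            show "\<bar>\<bar>inner_d d u x\<bar> + real d / real N\<bar> \<le> 1 + real d / real N" if "x \<in> ?B" for x
              using inner_abs_le[OF u(2), of x] that by (auto simp: cball_d_def)
          qed measurable
          fix x
          have "inner_d d u (grid d N x) = inner_d d u x + inner_d d u (vsub (grid d N x) x)"
            by (simp add: inner_d_simps)
          then show "\<bar>inner_d d u (grid d N x)\<bar> \<le> \<bar>inner_d d u x\<bar> + real d / real N"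
            using inner_abs_le[OF u(2), of "vsub (grid d N x) x"] gridn[of x] by linarith
        qed
        also have "\<dots> = (LINT x:?B|lebv d. \<bar>inner_d d u x\<bar>) + (LINT x:?B|lebv d. real d / real N)"
        proof (rule set_integral_add(2))
          show "set_integrable (lebv d) ?B (\<lambda>x. \<bar>inner_d d u x\<bar>)"
            by (rule set_integrable_abs_inner[OF u(2)])
          show "set_integrable (lebv d) ?B (\<lambda>x. real d / real N)"
            by (rule set_integrable_cball[of _ _ "real d / real N"]) auto
        qed
        also have "\<dots> = \<kappa> + real d / real N * vol d ?B"
          using \<kappa>_eq[OF u] Bfin by (simp add: ball_const_def set_integral_const)
        finally have "norm_d d z \<le> (\<kappa> + real d / real N * vol d ?B) / \<kappa>"
          using \<kappa> by (simp add: divide_right_mono)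
        also have "\<dots> = 1 + \<epsilon>"
          using \<kappa> by (simp add: \<epsilon>_def \<kappa>_def[symmetric] field_simps)
        finally show ?thesis
          using zRd by (simp add: cball_d_def)
      qed
    qed
    have unit: "\<exists>z\<in>zset as. norm_d d (vsub u z) \<le> \<epsilon>" if u: "u \<in> Rd d" "norm_d d u = 1" for u
    proof -
      \<comment> \<open>The average sign over the cell; it lies strictly between -1 and 1 when the
        hyperplane splits the cell into two parts of positive measure. For a null cell division by
        zero gives 0, and the generator \<open>a v\<close> vanishes as well.\<close>
      define s where "s v = (LINT x:C v|lebv d. sgn (inner_d d u x)) / m v" for v
      have sb: "\<bar>LINT x:C v|lebv d. sgn (inner_d d u x)\<bar> \<le> 1 * m v" for v
        unfolding m_def by (rule set_integral_bound[OF _ CB]) (auto simp: sgn_if)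
      have s: "\<bar>s v\<bar> \<le> 1" for v
        using sb[of v] by (cases "m v = 0") (auto simp: s_def m_def divide_le_eq zero_less_measure_iff)
      define z where "z = (\<lambda>i. \<Sum>v\<leftarrow>vs0. s v * a v i)"
      have z: "z \<in> zset as"
        unfolding z_def as_def by (rule zset_pm_list_mem) (rule s)
      have zi: "z i = (LINT x:?B|lebv d. grid d N x i * sgn (inner_d d u x)) / \<kappa>" if i: "i < d" for i
      proof -
        have "z i = (\<Sum>v\<in>G. s v * a v i)"
          by (simp add: z_def sumlist)
        also have "\<dots> = (\<Sum>v\<in>G. (LINT x:C v|lebv d. grid d N x i * sgn (inner_d d u x))) / \<kappa>"
          unfolding sum_divide_distrib
        proof (rule sum.cong[OF refl])
          fix v
          have "(LINT x:C v|lebv d. grid d N x i * sgn (inner_d d u x)) = (LINT x:C v|lebv d. v i * sgn (inner_d d u x))"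
            by (rule set_lebesgue_integral_cong) (auto simp: C_def)
          also have "\<dots> = v i * (LINT x:C v|lebv d. sgn (inner_d d u x))"
            by simp
          also have "\<dots> = v i * (s v * m v)"
            using sb[of v] by (cases "m v = 0") (auto simp: s_def)
          finally show "s v * a v i = (LINT x:C v|lebv d. grid d N x i * sgn (inner_d d u x)) / \<kappa>"
            by (simp add: a_def vscale_def)
        qed
        also have "(\<Sum>v\<in>G. (LINT x:C v|lebv d. grid d N x i * sgn (inner_d d u x)))
            = (LINT x:?B|lebv d. grid d N x i * sgn (inner_d d u x))"
        proof (rule cells)
          show "\<bar>grid d N x i * sgn (inner_d d u x)\<bar> \<le> 2" if "x \<in> ?B" for x
            using gridB[OF that, of i] by (simp add: abs_mult sgn_if)
        qed (rule borel_measurable_times, rule measurable_component', auto)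
        finally show ?thesis .
      qed
      have diff: "\<bar>vsub u z i\<bar> \<le> 1 / real N * vol d ?B / \<kappa>" if i: "i < d" for i
      proof -
        note i1 = set_integrable_component_sgn[OF i, of u]
        have i2: "set_integrable (lebv d) ?B (\<lambda>x. grid d N x i * sgn (inner_d d u x))"
        proof (rule set_integrable_cball)
          show "\<bar>grid d N x i * sgn (inner_d d u x)\<bar> \<le> 2" if "x \<in> ?B" for x
            using gridB[OF that, of i] by (simp add: abs_mult sgn_if)
        qed (rule borel_measurable_times, rule measurable_component', auto)
        have "u i = (LINT x:?B|lebv d. x i * sgn (inner_d d u x)) / \<kappa>"
          using ball_sgn_moment[OF u i] \<kappa> \<kappa>_eq[OF u] by simp
        then have "vsub u z i = (LINT x:?B|lebv d. x i * sgn (inner_d d u x) - grid d N x i * sgn (inner_d d u x)) / \<kappa>"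
          using i1 i2 by (simp add: vsub_def zi[OF i] set_integral_diff diff_divide_distrib)
        moreover have "\<bar>LINT x:?B|lebv d. x i * sgn (inner_d d u x) - grid d N x i * sgn (inner_d d u x)\<bar>
          \<le> 1 / real N * vol d ?B"
        proof (rule set_integral_bound[OF _ order_refl])
          show "\<bar>x i * sgn (inner_d d u x) - grid d N x i * sgn (inner_d d u x)\<bar> \<le> 1 / real N" for x
            using grid_error[OF N i, of x] by (simp add: sgn_if abs_minus_commute)
        qed (auto intro!: borel_measurable_diff borel_measurable_times measurable_component'[of "grid d N"])
        moreover have "\<bar>I / \<kappa>\<bar> \<le> M / \<kappa>" if "\<bar>I\<bar> \<le> M" for I M
          using \<kappa> that by (simp add: abs_divide divide_right_mono)
        ultimately show ?thesis
          by (simp only:)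
      qed
      have "norm_d d (vsub u z) \<le> (\<Sum>i<d. \<bar>vsub u z i\<bar>)"
        by (rule norm_d_le_sum_abs)
      also have "\<dots> \<le> (\<Sum>i<d. 1 / real N * vol d ?B / \<kappa>)"
        by (intro sum_mono diff) simp
      also have "\<dots> = \<epsilon>"
        by (simp add: \<epsilon>_def \<kappa>_def[symmetric])
      finally show ?thesis
        using z by blast
    qed
    show "?B \<subseteq> msum (zset as) (cball_d d \<epsilon>)"
    proof
      fix x assume x: "x \<in> ?B"
      show "x \<in> msum (zset as) (cball_d d \<epsilon>)"
      proof (cases "norm_d d x = 0")
        case True
        then have "x = vadd (\<lambda>_. 0) (\<lambda>_. 0)"
          using norm_d_eq_0_Rd[of x d] x by (simp add: cball_d_def vadd_def)
        moreover have "(\<lambda>_. 0) \<in> cball_d d \<epsilon>"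
          using \<epsilon>0 by (simp add: cball_d_def norm_d_def inner_d_def)
        ultimately show ?thesis
          using zero_in_zset msumI by metis
      next
        case False
        \<comment> \<open>Points of norm below 1 follow from their unit vector: the zonotope is
          convex and contains 0, and scaling by \<open>t\<close> only shrinks the error.\<close>
        define t where "t = norm_d d x"
        have t: "0 < t" "t \<le> 1"
          using False x norm_d_nonneg[of d x] by (auto simp: t_def cball_d_def less_le simp del: norm_d_nonneg)
        define u where "u = vscale (inverse t) x"
        have u: "u \<in> Rd d" "norm_d d u = 1"
          using x t by (auto simp: u_def cball_d_def norm_d_scale t_def)
        obtain z where z: "z \<in> zset as" "norm_d d (vsub u z) \<le> \<epsilon>"
          using unit[OF u] by blast
        have "vadd (vscale (1 - t) (\<lambda>_. 0)) (vscale t z) \<in> zset as"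
          using body_zset[OF asRd] z zero_in_zset[of as] t by (auto simp: body_def vconvex_def)
        then have tz: "vscale t z \<in> zset as"
          by (simp add: vec_defs)
        have "z \<in> Rd d"
          using z body_zset[OF asRd] by (auto simp: body_def)
        moreover have "t * norm_d d (vsub u z) \<le> 1 * \<epsilon>"
          using t z by (intro mult_mono) auto
        ultimately have "vscale t (vsub u z) \<in> cball_d d \<epsilon>"
          using u t by (auto simp: cball_d_def norm_d_scale)
        moreover have "x = vadd (vscale t z) (vscale t (vsub u z))"
          using t by (auto simp: u_def vec_defs algebra_simps)
        ultimately show ?thesis
          using tz msumI by metis
      qed
    qed
  qed
qed

lemma zonotope_approximation:
  assumes d: "d > 0" and e: "e > 0"
  obtains as where "set as \<subseteq> Rd d" "zset as \<subseteq> cball_d d (1 + e)"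
    "cball_d d 1 \<subseteq> msum (zset as) (cball_d d e)"
proof -
  define u :: vec where "u = (\<lambda>i. if i = 0 then 1 else 0)"
  have u: "u \<in> Rd d" "norm_d d u = 1"
    using d by (auto simp: u_def Rd_def norm_d_def inner_d_def if_distrib[of "\<lambda>a. a * _"] cong: if_cong)
  define c where "c = real d * vol d (cball_d d 1) / ball_const d u"
  obtain N where N: "N > 0" "c / e < real N"
    using reals_Archimedean2[of "max 1 (c / e)"] by (metis max_less_iff_conj of_nat_0_less_iff order.strict_trans zero_less_one)
  have le: "c / real N \<le> e"
    using N e by (simp add: field_simps)
  have "real d * vol d (cball_d d 1) / (ball_const d u * real N) = c / real N"
    by (simp add: c_def)
  then obtain as where as: "set as \<subseteq> Rd d" "zset as \<subseteq> cball_d d (1 + c / real N)"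
    "cball_d d 1 \<subseteq> msum (zset as) (cball_d d (c / real N))"
    using zonotope_near_ball[OF d N(1) u] by metis
  have sub: "cball_d d (c / real N) \<subseteq> cball_d d e" "cball_d d (1 + c / real N) \<subseteq> cball_d d (1 + e)"
    using le by (auto simp: cball_d_def)
  show ?thesis
    by (rule that[OF as(1) order_trans[OF as(2) sub(2)] order_trans[OF as(3) msum_mono[OF order_refl sub(1)]]])
qed

subsection \<open>Steiner polynomials and centroids of parallel bodies\<close>

lemma zero_in_cball_d [simp]: "r \<ge> 0 \<Longrightarrow> (\<lambda>_. 0) \<in> cball_d d r"
  by (simp add: cball_d_def norm_d_def inner_d_def)

lemma cball_d_mono: "r \<le> s \<Longrightarrow> cball_d d r \<subseteq> cball_d d s"
  by (auto simp: cball_d_def)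

lemma cball_d_scale:
  assumes "r \<ge> 0" "s > 0" shows "cball_d d (r * s) = vscale s ` cball_d d r"
proof (intro equalityI subsetI)
  fix x assume x: "x \<in> cball_d d (r * s)"
  then have "vscale (inverse s) x \<in> cball_d d r"
    using assms by (auto simp: cball_d_def norm_d_scale field_simps)
  moreover have "x = vscale s (vscale (inverse s) x)"
    using assms by (auto simp: vec_defs)
  ultimately show "x \<in> vscale s ` cball_d d r"
    by blast
qed (use assms in \<open>auto simp: cball_d_def norm_d_scale mult.commute\<close>)

lemma cball_d_add:
  assumes "r \<ge> 0" "s \<ge> 0" shows "msum (cball_d d r) (cball_d d s) = cball_d d (r + s)"
proof (rule equalityI[OF msum_cball_d[OF order_refl order_refl]], rule subsetI)
  fix x assume x: "x \<in> cball_d d (r + s)"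
  show "x \<in> msum (cball_d d r) (cball_d d s)"
  proof (cases "r + s = 0")
    case True
    then have "r = 0" "s = 0"
      using assms by linarith+
    moreover have "x = vadd x (\<lambda>_. 0)"
      by (simp add: vadd_def)
    ultimately show ?thesis
      using x msumI[of x _ "\<lambda>_. 0"] zero_in_cball_d[of 0 d] by auto
  next
    case False
    then have p: "r + s > 0"
      using assms by linarith
    have n: "norm_d d x / (r + s) \<le> 1" "x \<in> Rd d"
      using x p by (auto simp: cball_d_def)
    have "vscale (l / (r + s)) x \<in> cball_d d l" if "l \<ge> 0" for l
      using mult_left_mono[OF n(1) that] n p that by (auto simp: cball_d_def norm_d_scale)
    moreover have "vadd (vscale (r / (r + s)) x) (vscale (s / (r + s)) x) = x"
      using False by (auto simp: vec_defs fun_eq_iff simp flip: distrib_right add_divide_distrib)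
    ultimately show ?thesis
      using assms msumI by metis
  qed
qed

lemma subset_msum: "(\<lambda>_. 0) \<in> S \<Longrightarrow> K \<subseteq> msum K S"
  using msumI[of _ K "\<lambda>_. 0" S] by (auto simp: vadd_def)

lemma measure_mono_body:
  "A \<subseteq> B \<Longrightarrow> body d A \<Longrightarrow> body d B \<Longrightarrow> vol d A \<le> vol d B"
  by (intro measure_mono_fmeasurable body_fmeasurable) (auto intro: sets_borel_body)

text \<open>Since \<open>q + \<eta> B\<close> lies in \<open>L\<close>, the ball \<open>e B\<close>
  lies in \<open>(e / \<eta>) (L - q)\<close>. By convexity \<open>L + e B\<close> is then contained
  in a translate of \<open>(1 + e / \<eta>) L\<close>.\<close>

lemma measure_mink_le:
  assumes L: "body d L" and q: "q \<in> Rd d" and ball: "\<And>y. y \<in> cball_d d \<eta> \<Longrightarrow> vadd q y \<in> L"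
    and \<eta>: "\<eta> > 0" and e: "e \<ge> 0"
  shows "vol d (mink d L e) \<le> (1 + e / \<eta>) ^ d * vol d L"
proof -
  define \<tau> where "\<tau> = e / \<eta>"
  have \<tau>: "\<tau> \<ge> 0" "e = \<eta> * \<tau>"
    using \<eta> e by (auto simp: \<tau>_def)
  define S where "S = vscale (1 + \<tau>) ` L"
  have bS: "body d S"
    unfolding S_def by (rule body_scale[OF L])
  have bT: "body d (vadd (vscale (-\<tau>) q) ` S)"
    by (rule body_translate[OF bS]) (use q in simp)
  have "mink d L e \<subseteq> vadd (vscale (-\<tau>) q) ` S"
  proof
    fix x assume "x \<in> mink d L e"
    then obtain y b where yb: "y \<in> L" "b \<in> cball_d d e" "x = vadd y b"
      by (auto simp: mink_def)
    have "\<exists>b'\<in>cball_d d \<eta>. b = vscale \<tau> b'"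
    proof (cases "\<tau> = 0")
      case True
      then have "b = (\<lambda>_. 0)"
        using yb \<tau> norm_d_nonneg[of d b] by (intro norm_d_eq_0_Rd[of _ d]) (auto simp: cball_d_def simp del: norm_d_nonneg)
      then show ?thesis
        using \<eta> by (intro bexI[of _ "\<lambda>_. 0"]) (auto simp: vec_defs)
    next
      case False
      then show ?thesis
        using yb \<tau> \<eta> cball_d_scale[of \<eta> \<tau> d] by auto
    qed
    then obtain b' where b': "b' \<in> cball_d d \<eta>" "b = vscale \<tau> b'"
      by blast
    \<comment> \<open>The convex combination that, after dilation by \<open>1 + \<tau>\<close>,
      gives \<open>y\<close> weight 1 and the point of the inner ball weight
      \<open>\<tau>\<close>.\<close>
    define t where "t = \<tau> / (1 + \<tau>)"
    have t: "t \<in> {0..1}" "(1 + \<tau>) * (1 - t) = 1" "(1 + \<tau>) * t = \<tau>"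
      using \<tau> by (auto simp: t_def field_simps)
    have "vadd (vscale (1 - t) y) (vscale t (vadd q b')) \<in> L"
      using L ball[OF b'(1)] yb t by (auto simp: body_def vconvex_def)
    moreover have "x i = - \<tau> * q i + (1 + \<tau>) * ((1 - t) * y i + t * (q i + b' i))" for i
    proof -
      have "(1 + \<tau>) * ((1 - t) * y i + t * (q i + b' i)) = ((1 + \<tau>) * (1 - t)) * y i + ((1 + \<tau>) * t) * (q i + b' i)"
        by (simp add: algebra_simps)
      then show ?thesis
        unfolding t using yb b' by (simp add: vec_defs algebra_simps)
    qed
    then have "x = vadd (vscale (-\<tau>) q) (vscale (1 + \<tau>) (vadd (vscale (1 - t) y) (vscale t (vadd q b'))))"
      by (auto simp: vec_defs)
    ultimately show "x \<in> vadd (vscale (-\<tau>) q) ` S"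
      unfolding S_def by blast
  qed
  then have "vol d (mink d L e) \<le> vol d (vadd (vscale (-\<tau>) q) ` S)"
    by (intro measure_mono_body bT body_mink L)
  also have "\<dots> = vol d S"
    using q bS bT by (intro measure_translate) (auto intro: sets_borel_body)
  also have "\<dots> = (1 + e / \<eta>) ^ d * vol d L"
    unfolding S_def \<tau>_def[symmetric] using \<tau>(1) L by (intro measure_scale) simp_all
  finally show ?thesis .
qed

lemma aff_int_diff_le:
  assumes A: "body d A" and B: "body d B" and sub: "A \<subseteq> B" "B \<subseteq> cball_d d R"
  shows "\<bar>aff_int d \<alpha> u B - aff_int d \<alpha> u A\<bar>
    \<le> (\<bar>\<alpha>\<bar> + norm_d d u * R) * (vol d B - vol d A)"
proof -
  have m: "A \<in> sets borel" "B \<in> sets borel"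
    using A B by (auto intro: sets_borel_body)
  have "aff_int d \<alpha> u (A \<union> (B - A)) = aff_int d \<alpha> u A + aff_int d \<alpha> u (B - A) - aff_int d \<alpha> u (A \<inter> (B - A))"
    unfolding aff_int_def using m sub
    by (intro set_integral_Un_Int affine_set_integrable[of _ d R]) auto
  moreover have "A \<union> (B - A) = B" "A \<inter> (B - A) = {}"
    using sub by auto
  ultimately have "aff_int d \<alpha> u B - aff_int d \<alpha> u A = aff_int d \<alpha> u (B - A)"
    by (simp add: aff_int_def set_lebesgue_integral_def)
  also have "\<bar>\<dots>\<bar> \<le> (\<bar>\<alpha>\<bar> + norm_d d u * R) * vol d (B - A)"
    using m sub by (intro aff_int_bound) auto
  also have "vol d (B - A) = vol d B - vol d A"
    using m sub body_emeasure_finite[OF B] by (subst measure_Diff) auto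
  finally show ?thesis .
qed

lemma measure_cball_d: "r > 0 \<Longrightarrow> vol d (cball_d d r) = r ^ d * vol d (cball_d d 1)"
  using cball_d_scale[of 1 r d] measure_scale[of r d "cball_d d 1"] body_cball_d by simp

text \<open>\<open>K + r Z\<close> fits into a ball whose radius \<open>s\<close> grows linearly in
  \<open>r\<close>. Its volume contributes \<open>s ^ d\<close> and the affine integrand one more
  factor \<open>s\<close>, which gives \<open>Suc d\<close> whatever the number of segments.\<close>

lemma zonotope_aff_int_degree:
  assumes K: "body d K" and as: "set as \<subseteq> Rd d" "zset as \<subseteq> cball_d d 2"
  obtains p where "degree p \<le> Suc d" "\<And>r. r \<ge> 0 \<Longrightarrow> aff_int d \<alpha> u (msum K (vscale r ` zset as)) = poly p r"
proof -
  obtain p where p: "\<And>r. r \<ge> 0 \<Longrightarrow> aff_int d \<alpha> u (msum K (vscale r ` zset as)) = poly p r"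
    using aff_int_zset_poly[OF K as(1)] by metis
  obtain R0 where R0: "R0 > 0" "K \<subseteq> cball_d d R0"
    using body_bounded[OF K] by metis
  define R where "R = max R0 1"
  have R: "R \<ge> 1" "K \<subseteq> cball_d d R"
    using R0 cball_d_mono[of R0 R d] by (auto simp: R_def)
  let ?vB = "vol d (cball_d d 1)"
  define C where "C = (\<bar>\<alpha>\<bar> + norm_d d u) * (2 * R) ^ Suc d * ?vB"
  have "\<bar>poly p r\<bar> \<le> C * (1 + r) ^ Suc d" if r: "r \<ge> 0" for r
  proof -
    define s where "s = 2 * R * (1 + r)"
    have s: "s \<ge> 1" "R + 2 * r \<le> s"
      using R r mult_mono[of 1 R 1 "1 + r"] mult_mono[of 1 R r r] by (auto simp: s_def algebra_simps)
    have "vscale r ` zset as \<subseteq> cball_d d (2 * r)"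
    proof
      fix x assume "x \<in> vscale r ` zset as"
      then obtain z where z: "z \<in> cball_d d 2" "x = vscale r z"
        using as by auto
      then show "x \<in> cball_d d (2 * r)"
        using r mult_left_mono[of "norm_d d z" 2 r] by (auto simp: cball_d_def norm_d_scale)
    qed
    then have "msum K (vscale r ` zset as) \<subseteq> cball_d d (R + 2 * r)"
      using R by (intro msum_cball_d)
    also have "\<dots> \<subseteq> cball_d d s"
      by (rule cball_d_mono[OF s(2)])
    finally have sub: "msum K (vscale r ` zset as) \<subseteq> cball_d d s" .
    have b: "body d (msum K (vscale r ` zset as))"
      using K as by (intro body_msum body_scale body_zset)
    have "\<bar>poly p r\<bar> \<le> (\<bar>\<alpha>\<bar> + norm_d d u * s) * vol d (msum K (vscale r ` zset as))"
      unfolding p[OF r, symmetric] using sub b by (intro aff_int_bound sets_borel_body)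
    also have "\<dots> \<le> (\<bar>\<alpha>\<bar> * s + norm_d d u * s) * vol d (cball_d d s)"
    proof (rule mult_mono)
      have "\<bar>\<alpha>\<bar> * 1 \<le> \<bar>\<alpha>\<bar> * s"
        using s by (intro mult_left_mono) auto
      then show "\<bar>\<alpha>\<bar> + norm_d d u * s \<le> \<bar>\<alpha>\<bar> * s + norm_d d u * s"
        by simp
      show "vol d (msum K (vscale r ` zset as)) \<le> vol d (cball_d d s)"
        using sub b body_cball_d by (rule measure_mono_body)
      show "0 \<le> \<bar>\<alpha>\<bar> * s + norm_d d u * s"
        using s by simp
    qed simp
    also have "vol d (cball_d d s) = s ^ d * ?vB"
      using s by (intro measure_cball_d) simp
    also have "(\<bar>\<alpha>\<bar> * s + norm_d d u * s) * (s ^ d * ?vB) = (\<bar>\<alpha>\<bar> + norm_d d u) * s ^ Suc d * ?vB"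
      by (simp add: algebra_simps)
    also have "s ^ Suc d = (2 * R) ^ Suc d * (1 + r) ^ Suc d"
      unfolding s_def by (rule power_mult_distrib)
    finally show ?thesis
      by (simp only: C_def mult.assoc mult.commute[of "(1 + r) ^ Suc d"])
  qed
  then have "degree p \<le> Suc d"
    by (rule degree_le_of_growth)
  then show ?thesis
    using p that by blast
qed

text \<open>\<open>K + r B\<close> and its zonotope version \<open>Ln n\<close> both lie in
  \<open>Lp n\<close>, where the ball has radius \<open>r * (1 + e n)\<close>, and
  \<open>Lp n\<close> is covered when either of them is enlarged by \<open>2 * (r * e n)\<close>.
  Both contain \<open>K\<close> and with it a ball of radius \<open>\<eta>\<close>, so
  \<open>measure_mink_le\<close> makes the differences of volume, and hence of the moments, tend to
  0. The degree bound does not depend on \<open>n\<close>, so the limit is again a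
  polynomial.\<close>

lemma aff_int_mink_poly:
  assumes d: "d > 0" and K: "body d K" and q: "q \<in> Rd d"
    and ball: "\<And>y. y \<in> cball_d d \<eta> \<Longrightarrow> vadd q y \<in> K" and \<eta>: "\<eta> > 0"
  obtains p where "degree p \<le> Suc d" "\<And>r. r \<ge> 0 \<Longrightarrow> aff_int d \<alpha> u (mink d K r) = poly p r"
proof -
  define e where "e n = inverse (real (Suc n))" for n
  have e: "e n > 0" "e n \<le> 1" for n
    by (auto simp: e_def inverse_le_1_iff)
  have "\<exists>as. set as \<subseteq> Rd d \<and> zset as \<subseteq> cball_d d (1 + e n) \<and> cball_d d 1 \<subseteq> msum (zset as) (cball_d d (e n))" for n
    using zonotope_approximation[OF d e(1)[of n]] by metis
  then obtain as where as: "\<And>n. set (as n) \<subseteq> Rd d" "\<And>n. zset (as n) \<subseteq> cball_d d (1 + e n)"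
      "\<And>n. cball_d d 1 \<subseteq> msum (zset (as n)) (cball_d d (e n))"
    by metis
  have as2: "zset (as n) \<subseteq> cball_d d 2" for n
    using as(2)[of n] cball_d_mono[of "1 + e n" 2 d] e[of n] by auto
  have "\<exists>p. degree p \<le> Suc d \<and> (\<forall>r\<ge>0. aff_int d \<alpha> u (msum K (vscale r ` zset (as n))) = poly p r)" for n
    using zonotope_aff_int_degree[OF K as(1) as2] by metis
  then obtain p where p: "\<And>n. degree (p n) \<le> Suc d"
     "\<And>n r. r \<ge> 0 \<Longrightarrow> aff_int d \<alpha> u (msum K (vscale r ` zset (as n))) = poly (p n) r"
    by metis
  have lim: "(\<lambda>n. poly (p n) r) \<longlonglongrightarrow> aff_int d \<alpha> u (mink d K r)" if r: "r \<ge> 0" for r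
  proof -
    define L where "L = mink d K r"
    define Ln where "Ln n = msum K (vscale r ` zset (as n))" for n
    define Lp where "Lp n = mink d K (r * (1 + e n))" for n
    have bL: "body d L" and bLn: "body d (Ln n)" and bLp: "body d (Lp n)" and b2: "body d (mink d K (2 * r))" for n
      unfolding L_def Ln_def Lp_def by (intro body_mink body_msum body_scale body_zset K as)+
    obtain R where R: "R > 0" "mink d K (2 * r) \<subseteq> cball_d d R"
      using body_bounded[OF b2] by metis
    have re: "r * (1 + e n) \<le> 2 * r" "r * e n \<ge> 0" for n
      using r e[of n] mult_left_mono[of "1 + e n" 2 r] by (auto simp: less_imp_le)
    have Lp2: "Lp n \<subseteq> mink d K (2 * r)" for n
      unfolding Lp_def mink_msum by (intro msum_mono cball_d_mono re order_refl)
    have L_Lp: "L \<subseteq> Lp n" for n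
      unfolding Lp_def L_def mink_msum using r e[of n] by (intro msum_mono cball_d_mono order_refl) (simp add: algebra_simps)
    have zr: "vscale r ` cball_d d 1 \<subseteq> msum (vscale r ` zset (as n)) (cball_d d (r * e n))" for n
    proof -
      have "vscale r ` cball_d d 1 \<subseteq> msum (vscale r ` zset (as n)) (vscale r ` cball_d d (e n))"
        unfolding vscale_msum[symmetric] using as(3)[of n] by blast
      moreover have "vscale r ` cball_d d (e n) \<subseteq> cball_d d (r * e n)"
        using r by (auto simp: cball_d_def norm_d_scale mult_left_mono)
      ultimately show ?thesis
        using msum_mono[OF order_refl] by (meson order_trans)
    qed
    have cr: "cball_d d r \<subseteq> vscale r ` cball_d d 1"
    proof (cases "r = 0")
      case True
      have "x = vscale 0 (\<lambda>_. 0)" if "x \<in> cball_d d 0" for x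
        using norm_d_eq_0_Rd[of x d] that norm_d_nonneg[of d x] by (auto simp: cball_d_def vec_defs simp del: norm_d_nonneg)
      then show ?thesis
        unfolding True using zero_in_cball_d[of 1 d] by (intro subsetI image_eqI[of _ _ "\<lambda>_. 0"]) simp_all
    qed (use cball_d_scale[of 1 r d] r in auto)
    have Ln_Lp: "Ln n \<subseteq> Lp n" for n
    proof -
      have "vscale r ` zset (as n) \<subseteq> cball_d d (r * (1 + e n))"
        using as(2)[of n] r by (auto simp: cball_d_def norm_d_scale intro!: mult_left_mono)
      then show ?thesis
        unfolding Ln_def Lp_def mink_msum by (intro msum_mono order_refl)
    qed
    have K_sub: "K \<subseteq> L" "K \<subseteq> Ln n" for n
    proof -
      show "K \<subseteq> L"
        unfolding L_def mink_msum using r by (intro subset_msum) simp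
      have "vscale r (\<lambda>_. 0) \<in> vscale r ` zset (as n)"
        using zero_in_zset by blast
      then show "K \<subseteq> Ln n"
        unfolding Ln_def by (intro subset_msum) (simp add: vec_defs)
    qed
    define \<delta> where "\<delta> n = (1 + 2 * (r * e n) / \<eta>) ^ d - 1" for n
    define V2 where "V2 = vol d (mink d K (2 * r))"
    have key: "vol d (Lp n) - vol d M \<le> \<delta> n * V2"
      if M: "body d M" "K \<subseteq> M" "M \<subseteq> Lp n" "Lp n \<subseteq> mink d M (2 * (r * e n))" for M n
    proof -
      have "vol d (Lp n) \<le> vol d (mink d M (2 * (r * e n)))"
        using M bLp by (intro measure_mono_body body_mink)
      also have "\<dots> \<le> (1 + 2 * (r * e n) / \<eta>) ^ d * vol d M"
        using M ball \<eta> q re[of n] by (intro measure_mink_le[of _ _ q]) auto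
      finally have "vol d (Lp n) - vol d M \<le> \<delta> n * vol d M"
        by (simp add: \<delta>_def algebra_simps)
      also have "\<dots> \<le> \<delta> n * V2"
      proof (rule mult_left_mono)
        show "vol d M \<le> V2"
          unfolding V2_def using M b2 Lp2[of n] by (intro measure_mono_body) auto
        show "0 \<le> \<delta> n"
          unfolding \<delta>_def using re[of n] \<eta> by simp
      qed
      finally show ?thesis .
    qed
    have vL: "vol d (Lp n) - vol d L \<le> \<delta> n * V2" for n
    proof (rule key[OF bL K_sub(1) L_Lp])
      have "cball_d d (r * (1 + e n)) \<subseteq> cball_d d (r + 2 * (r * e n))"
        using re[of n] by (intro cball_d_mono) (simp add: algebra_simps)
      also have "\<dots> = msum (cball_d d r) (cball_d d (2 * (r * e n)))"
        using r re[of n] by (subst cball_d_add) auto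
      finally show "Lp n \<subseteq> mink d L (2 * (r * e n))"
        unfolding Lp_def L_def mink_msum msum_assoc by (rule msum_mono[OF order_refl])
    qed
    have vLn: "vol d (Lp n) - vol d (Ln n) \<le> \<delta> n * V2" for n
    proof (rule key[OF bLn K_sub(2) Ln_Lp])
      have "cball_d d (r * (1 + e n)) = msum (cball_d d r) (cball_d d (r * e n))"
        using r re[of n] by (subst cball_d_add) (auto simp: algebra_simps)
      also have "\<dots> \<subseteq> msum (msum (vscale r ` zset (as n)) (cball_d d (r * e n))) (cball_d d (r * e n))"
        using cr zr[of n] by (intro msum_mono order_refl) (rule order_trans)
      also have "\<dots> = msum (vscale r ` zset (as n)) (cball_d d (2 * (r * e n)))"
        using re[of n] by (simp add: msum_assoc cball_d_add)
      finally show "Lp n \<subseteq> mink d (Ln n) (2 * (r * e n))"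
        unfolding Lp_def Ln_def mink_msum msum_assoc by (rule msum_mono[OF order_refl])
    qed
    define C where "C = \<bar>\<alpha>\<bar> + norm_d d u * R"
    have C: "C \<ge> 0"
      using R by (simp add: C_def)
    have bound: "\<bar>poly (p n) r - aff_int d \<alpha> u L\<bar> \<le> 2 * C * (\<delta> n * V2)" for n
    proof -
      have 1: "\<bar>aff_int d \<alpha> u (Lp n) - aff_int d \<alpha> u L\<bar> \<le> C * (vol d (Lp n) - vol d L)"
        unfolding C_def by (intro aff_int_diff_le bL bLp L_Lp order_trans[OF Lp2 R(2)])
      have 2: "\<bar>aff_int d \<alpha> u (Lp n) - aff_int d \<alpha> u (Ln n)\<bar> \<le> C * (vol d (Lp n) - vol d (Ln n))"
        unfolding C_def by (intro aff_int_diff_le bLn bLp Ln_Lp order_trans[OF Lp2 R(2)])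
      have "poly (p n) r = aff_int d \<alpha> u (Ln n)"
        by (simp add: p(2)[OF r] Ln_def)
      then show ?thesis
        using 1 2 mult_left_mono[OF vL[of n] C] mult_left_mono[OF vLn[of n] C] by linarith
    qed
    have "(\<lambda>n. e n) \<longlonglongrightarrow> 0"
      unfolding e_def by (rule LIMSEQ_inverse_real_of_nat)
    then have "(\<lambda>n. 2 * C * (((1 + 2 * (r * e n) / \<eta>) ^ d - 1) * V2)) \<longlonglongrightarrow> 2 * C * (((1 + 2 * (r * 0) / \<eta>) ^ d - 1) * V2)"
      by (intro tendsto_intros) (use \<eta> in auto)
    then have "(\<lambda>n. 2 * C * (\<delta> n * V2)) \<longlonglongrightarrow> 0"
      by (simp add: \<delta>_def)
    then have "(\<lambda>n. poly (p n) r - aff_int d \<alpha> u L) \<longlonglongrightarrow> 0"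
      by (rule Lim_null_comparison[rotated]) (use bound in \<open>auto intro!: always_eventually\<close>)
    then show ?thesis
      by (simp add: L_def LIM_zero_iff)
  qed
  obtain P where "degree P \<le> Suc d" "\<forall>r\<ge>0. aff_int d \<alpha> u (mink d K r) = poly P r"
    using poly_pointwise_limit[OF p(1) lim] by auto
  then show ?thesis
    using that by blast
qed

lemma inner_cg:
  assumes L: "body d L"
  shows "inner_d d u (cg d L) = aff_int d 0 u L / vol d L"
proof -
  have m [measurable]: "L \<in> sets borel"
    by (rule sets_borel_body[OF L])
  have vol: "vol_d d L = vol d L"
    unfolding vol_d_def lebv_def
    by (subst measure_distr) (auto simp: vimage_def Int_def conj_commute)
  have coord: "(LINT x|leb_d d. indicator L (pad d x) * x i) = (LINT x|lebv d. indicator L x * x i)" if "i < d" for i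
  proof -
    have "(LINT x|lebv d. indicator L x * x i) = (LINT x|leb_d d. indicator L (pad d x) * pad d x i)"
      unfolding lebv_def by (rule integral_distr) auto
    then show ?thesis
      using that by (simp add: pad_def)
  qed
  obtain R where R: "L \<subseteq> cball_d d R"
    using body_bounded[OF L] by metis
  have int: "integrable (lebv d) (\<lambda>x. u i * (indicator L x * x i))" if i: "i < d" for i
  proof -
    have "set_integrable (lebv d) L (\<lambda>x. x i)"
      using m R
    proof (rule set_integrable_bounded)
      show "\<bar>x i\<bar> \<le> R" if "x \<in> L" for x
        using abs_component_le_norm_d[OF i, of x] that R by (auto simp: cball_d_def)
    qed measurable
    then show ?thesis
      by (simp add: set_integrable_def)
  qed
  have "inner_d d u (cg d L) = (\<Sum>i<d. u i * (LINT x|lebv d. indicator L x * x i)) / vol d L"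
    by (simp add: inner_d_def cg_def vol coord sum_divide_distrib)
  also have "(\<Sum>i<d. u i * (LINT x|lebv d. indicator L x * x i)) = (LINT x|lebv d. (\<Sum>i<d. u i * (indicator L x * x i)))"
    using int by (subst Bochner_Integration.integral_sum) simp_all
  also have "\<dots> = aff_int d 0 u L"
    unfolding aff_int_def set_lebesgue_integral_def
    by (intro Bochner_Integration.integral_cong) (auto simp: inner_d_def sum_distrib_left algebra_simps)
  finally show ?thesis .
qed

text \<open>Reflecting at the bounding hyperplane maps the part of \<open>K + r B\<close> outside the
half-space into the part inside, because it decreases the distance to every point of \<open>K\<close>.\<close>

lemma aff_int_mink_halfspace:
  assumes K: "body d K" "K \<noteq> {}" and u: "u \<in> Rd d" and half: "\<And>x. x \<in> K \<Longrightarrow> inner_d d u x \<le> c"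
  shows "aff_int d (- c) u (mink d K r) \<le> 0"
proof (cases "inner_d d u u = 0")
  case True
  then have "inner_d d u x = 0" for x
    using inner_d_Cauchy_Schwarz[of d u x] by (simp add: norm_d_def)
  moreover from this have "c \<ge> 0"
    using half K(2) by fastforce
  moreover from this have "0 \<le> (LINT x|lebv d. indicator (mink d K r) x * c)"
    by (intro integral_nonneg_AE AE_I2) (auto simp: indicator_def)
  ultimately show ?thesis
    unfolding aff_int_def set_lebesgue_integral_def by simp
next
  case False
  then have uu: "inner_d d u u > 0"
    using norm_d_power2[of d u] by (metis zero_le_power2 order_le_less)
  define L where "L = mink d K r"
  have bL: "body d L"
    unfolding L_def by (rule body_mink[OF K(1)])
  have m [measurable]: "L \<in> sets borel"
    by (rule sets_borel_body[OF bL])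
  define \<phi> where "\<phi> x = - c + inner_d d u x" for x
  define b where "b = vscale (2 * c / inner_d d u u) u"
  have b: "b \<in> Rd d"
    using u by (simp add: b_def)
  define S where "S x = vadd b (reflect d u x)" for x
  have S: "S x = vsub x (vscale (2 * \<phi> x / inner_d d u u) u)" for x
    by (auto simp: S_def b_def reflect_def \<phi>_def vec_defs diff_divide_distrib add_divide_distrib algebra_simps)
  have \<phi>S: "\<phi> (S x) = - \<phi> x" for x
    using uu by (simp add: S inner_d_simps \<phi>_def)
  have SS: "S (S x) = x" for x
    unfolding S[of "S x"] \<phi>S by (simp add: S vec_defs)
  have into: "S x \<in> L" if x: "x \<in> L" "\<phi> x \<ge> 0" for x
  proof -
    obtain k y where ky: "k \<in> K" "y \<in> cball_d d r" "x = vadd k y"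
      using x by (auto simp: L_def mink_def)
    define l where "l = 2 * \<phi> x / inner_d d u u"
    have l: "l \<ge> 0" "l * inner_d d u u = 2 * \<phi> x"
      using x uu by (auto simp: l_def)
    define z where "z = vsub y (vscale l u)"
    have Sx: "S x = vadd k z"
      by (auto simp: S ky z_def l_def vec_defs)
    \<comment> \<open>As \<open>k\<close> lies in the half-space, the excess \<open>\<phi> x\<close>
      is due to \<open>y\<close> alone; therefore subtracting \<open>l u\<close> from
      \<open>y\<close> does not increase its norm.\<close>
    have "\<phi> x \<le> inner_d d u y"
      using half[OF ky(1)] by (simp add: \<phi>_def ky inner_d_simps)
    then have "2 * l * \<phi> x \<le> 2 * l * inner_d d u y"
      using l by (intro mult_left_mono) auto
    moreover have "inner_d d z z = inner_d d y y - 2 * l * inner_d d u y + l * (l * inner_d d u u)"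
      by (simp add: z_def inner_d_simps inner_d_commute[of d y u] algebra_simps)
    ultimately have "inner_d d z z \<le> inner_d d y y"
      by (simp add: l)
    then have "norm_d d z \<le> norm_d d y"
      by (simp add: norm_d_def)
    moreover have "z \<in> Rd d"
      using ky u by (auto simp: z_def cball_d_def)
    ultimately have "z \<in> cball_d d r"
      using ky by (auto simp: cball_d_def)
    then show ?thesis
      using ky Sx by (auto simp: L_def mink_def)
  qed
  define f where "f x = indicator L x * \<phi> x" for x
  have f [measurable]: "f \<in> borel_measurable borel"
    unfolding f_def \<phi>_def by measurable
  have fi: "integrable (lebv d) f"
    using affine_set_integrable_body[OF bL, of "- c" u] by (simp add: set_integrable_def f_def[abs_def] \<phi>_def)
  have Sm: "S \<in> borel_measurable borel"
    unfolding S_def by measurable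
  have dS: "distr (lebv d) borel S = lebv d"
  proof -
    have "distr (lebv d) borel S = distr (distr (lebv d) borel (reflect d u)) borel (vadd b)"
      by (subst distr_distr) (auto simp: S_def[abs_def] o_def)
    then show ?thesis
      using u b by (simp add: distr_lebv_reflect lebv_translate)
  qed
  have fSi: "integrable (lebv d) (\<lambda>x. f (S x))"
    using integrable_distr[of S "lebv d" borel f] Sm fi by (simp add: dS)
  have "(LINT x|lebv d. f (S x)) = (LINT x|lebv d. f x)"
    using integral_distr[of S "lebv d" borel f] Sm f by (simp add: dS)
  then have "2 * (LINT x|lebv d. f x) = (LINT x|lebv d. f x + f (S x))"
    using fi fSi by simp
  also have "\<dots> \<le> 0"
  proof -
    have "f x + f (S x) \<le> 0" for x
    proof (cases "\<phi> x \<ge> 0")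
      case True
      then show ?thesis
        using into[of x] by (auto simp: f_def \<phi>S indicator_def)
    next
      case False
      then show ?thesis
        using into[of "S x"] by (auto simp: f_def \<phi>S SS indicator_def)
    qed
    then have "0 \<le> (LINT x|lebv d. - (f x + f (S x)))"
      by (intro integral_nonneg_AE AE_I2) (simp only: neg_0_le_iff_le)
    then show ?thesis
      using fi fSi by simp
  qed
  finally show ?thesis
    by (simp add: aff_int_def set_lebesgue_integral_def L_def f_def \<phi>_def)
qed

text \<open>The half-space is only required to contain \<open>K\<close>, not \<open>K + r B\<close>.
  This confines the whole path to \<open>K\<close>, independently of \<open>r\<close>.\<close>

lemma inner_rho_le:
  assumes K: "body d K" "K \<noteq> {}" and u: "u \<in> Rd d" and half: "\<And>x. x \<in> K \<Longrightarrow> inner_d d u x \<le> c"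
    and pos: "vol d (mink d K r) > 0"
  shows "inner_d d u (rho d K r) \<le> c"
proof -
  let ?L = "mink d K r"
  have bL: "body d ?L"
    by (rule body_mink[OF K(1)])
  have m: "?L \<in> sets borel"
    by (rule sets_borel_body[OF bL])
  have "aff_int d (- c) u ?L = (LINT x:?L|lebv d. - c) + aff_int d 0 u ?L"
    unfolding aff_int_def using affine_set_integrable_body[OF bL, of "- c" "\<lambda>_. 0"]
      affine_set_integrable_body[OF bL, of 0 u] by (subst set_integral_add(2)[symmetric]) (auto simp: inner_d_def)
  also have "(LINT x:?L|lebv d. - c) = - c * vol d ?L"
    using m body_emeasure_finite[OF bL] by (subst set_integral_const) auto
  finally have "aff_int d 0 u ?L \<le> c * vol d ?L"
    using aff_int_mink_halfspace[OF K u half, of r] by simp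
  then show ?thesis
    unfolding rho_def inner_cg[OF bL] using pos by (simp add: divide_le_eq)
qed

subsection \<open>The length of the curvature path\<close>

lemma inner_d_pad [simp]: "inner_d d (pad d u) x = inner_d d u x"
  by (simp add: inner_d_def pad_def)

lemma measure_mink_pos:
  assumes K: "body d K" and q: "q \<in> Rd d"
    and ball: "\<And>y. y \<in> cball_d d \<eta> \<Longrightarrow> vadd q y \<in> K" and \<eta>: "\<eta> > 0" and r: "r \<ge> 0"
  shows "vol d (mink d K r) > 0"
proof -
  have b: "body d (vadd q ` cball_d d \<eta>)"
    by (rule body_translate[OF body_cball_d q])
  have "vol d (vadd q ` cball_d d \<eta>) = vol d (cball_d d \<eta>)"
    using b q by (intro measure_translate) (auto intro: sets_borel_body)
  then have "0 < vol d (vadd q ` cball_d d \<eta>)"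
    using measure_cball_d_pos[OF \<eta>] by simp
  also have "\<dots> \<le> vol d (mink d K r)"
  proof (rule measure_mono_body[OF _ b body_mink[OF K]])
    show "vadd q ` cball_d d \<eta> \<subseteq> mink d K r"
      unfolding mink_msum using ball subset_msum[of "cball_d d r" K] r by auto
  qed
  finally show ?thesis .
qed

lemma inner_rho_ratio:
  assumes d: "d > 0" and K: "body d K" and q: "q \<in> Rd d"
    and ball: "\<And>y. y \<in> cball_d d \<eta> \<Longrightarrow> vadd q y \<in> K" and \<eta>: "\<eta> > 0"
  obtains N V where "degree N \<le> Suc d" "degree V \<le> Suc d" "\<And>r. r \<ge> 0 \<Longrightarrow> poly V r > 0"
    "\<And>r. r \<ge> 0 \<Longrightarrow> inner_d d u (rho d K r) = poly N r / poly V r"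
proof -
  obtain N where N: "degree N \<le> Suc d" "\<And>r. r \<ge> 0 \<Longrightarrow> aff_int d 0 u (mink d K r) = poly N r"
    using aff_int_mink_poly[OF d K q ball \<eta>] by metis
  obtain V where V: "degree V \<le> Suc d" "\<And>r. r \<ge> 0 \<Longrightarrow> aff_int d 1 (\<lambda>_. 0) (mink d K r) = poly V r"
    using aff_int_mink_poly[OF d K q ball \<eta>] by metis
  have V': "vol d (mink d K r) = poly V r" if "r \<ge> 0" for r
    using V(2)[OF that] aff_int_1_0[OF body_mink[OF K]] by simp
  show ?thesis
  proof
    show "poly V r > 0" if "r \<ge> 0" for r
      using measure_mink_pos[OF K q ball \<eta> that] V'[OF that] by simp
    show "inner_d d u (rho d K r) = poly N r / poly V r" if "r \<ge> 0" for r
      using N(2)[OF that] V'[OF that] by (simp add: rho_def inner_cg[OF body_mink[OF K]])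
  qed (use N V in auto)
qed

section \<open>Rational functions at infinity\<close>

lemma poly_abs_le_growth:
  fixes p :: "real poly"
  obtains C where "\<And>x. x \<ge> 0 \<Longrightarrow> \<bar>poly p x\<bar> \<le> C * (1 + x) ^ degree p"
proof
  fix x :: real assume x: "x \<ge> 0"
  have "\<bar>poly p x\<bar> \<le> (\<Sum>i\<le>degree p. \<bar>coeff p i * x ^ i\<bar>)"
    unfolding poly_altdef by (rule sum_abs)
  also have "\<dots> \<le> (\<Sum>i\<le>degree p. \<bar>coeff p i\<bar> * (1 + x) ^ degree p)"
  proof (rule sum_mono)
    fix i assume i: "i \<in> {..degree p}"
    have "x ^ i \<le> (1 + x) ^ i"
      using x by (intro power_mono) auto
    also have "\<dots> \<le> (1 + x) ^ degree p"
      using x i by (intro power_increasing) auto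
    finally show "\<bar>coeff p i * x ^ i\<bar> \<le> \<bar>coeff p i\<bar> * (1 + x) ^ degree p"
      using x by (simp add: abs_mult mult_left_mono)
  qed
  finally show "\<bar>poly p x\<bar> \<le> (\<Sum>i\<le>degree p. \<bar>coeff p i\<bar>) * (1 + x) ^ degree p"
    by (simp add: sum_distrib_right)
qed

lemma poly_over_power_limit:
  fixes p :: "real poly"
  assumes "degree p \<le> m"
  shows "\<exists>l. ((\<lambda>x. poly p x / x ^ m) \<longlongrightarrow> l) at_top"
proof -
  have 1: "((\<lambda>x. poly p x / x ^ degree p) \<longlongrightarrow> lead_coeff p) at_top"
    using poly_divide_tendsto_aux[of p] by (rule filterlim_mono) (auto simp: at_top_le_at_infinity)
  have 2: "((\<lambda>x::real. inverse x ^ (m - degree p)) \<longlongrightarrow> 0 ^ (m - degree p)) at_top"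
    by (intro tendsto_power tendsto_inverse_0_at_top filterlim_ident)
  have "((\<lambda>x. poly p x / x ^ m) \<longlongrightarrow> lead_coeff p * 0 ^ (m - degree p)) at_top"
  proof (rule Lim_transform_eventually[OF tendsto_mult[OF 1 2]], rule eventually_mono[OF eventually_gt_at_top[of 0]])
    fix x :: real assume "x > 0"
    have "x ^ m = x ^ degree p * x ^ (m - degree p)"
      using assms by (simp add: power_add[symmetric])
    then show "poly p x / x ^ degree p * inverse x ^ (m - degree p) = poly p x / x ^ m"
      by (simp add: power_inverse divide_inverse)
  qed
  then show ?thesis
    by blast
qed

text \<open>Boundedness forces the degree of \<open>N\<close> to be at most that of
  \<open>V\<close>; then both are divided by the same power. It is needed because
  \<open>rho_inf\<close> is defined by \<open>Lim\<close>, which says nothing unless a limit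
  exists.\<close>

lemma poly_ratio_limit:
  fixes N V :: "real poly"
  assumes V: "\<And>r. r \<ge> 0 \<Longrightarrow> poly V r > 0" and bnd: "\<And>r. r \<ge> 0 \<Longrightarrow> \<bar>poly N r / poly V r\<bar> \<le> B"
  shows "\<exists>l. ((\<lambda>r. poly N r / poly V r) \<longlongrightarrow> l) at_top"
proof -
  let ?m = "degree V"
  obtain C where C: "\<And>x. x \<ge> 0 \<Longrightarrow> \<bar>poly V x\<bar> \<le> C * (1 + x) ^ ?m"
    using poly_abs_le_growth by metis
  have "\<bar>poly N r\<bar> \<le> \<bar>B\<bar> * C * (1 + r) ^ ?m" if r: "r \<ge> 0" for r
  proof -
    have "\<bar>poly N r\<bar> \<le> B * poly V r"
      using bnd[OF r] V[OF r] by (simp add: divide_le_eq)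
    also have "\<dots> \<le> \<bar>B\<bar> * poly V r"
      using V[OF r] by (intro mult_right_mono) auto
    also have "\<dots> \<le> \<bar>B\<bar> * (C * (1 + r) ^ ?m)"
      using C[OF r] by (intro mult_left_mono) auto
    finally show ?thesis
      by (simp add: mult.assoc)
  qed
  then have "degree N \<le> ?m"
    by (rule degree_le_of_growth)
  then obtain l where l: "((\<lambda>x. poly N x / x ^ ?m) \<longlongrightarrow> l) at_top"
    using poly_over_power_limit by blast
  have v: "((\<lambda>x. poly V x / x ^ ?m) \<longlongrightarrow> lead_coeff V) at_top"
    using poly_divide_tendsto_aux[of V] by (rule filterlim_mono) (auto simp: at_top_le_at_infinity)
  have "lead_coeff V \<noteq> 0"
    using V[of 0] by auto
  then have "((\<lambda>r. poly N r / poly V r) \<longlongrightarrow> l / lead_coeff V) at_top"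
    by (intro Lim_transform_eventually[OF tendsto_divide[OF l v]] eventually_mono[OF eventually_gt_at_top[of 0]]) auto
  then show ?thesis
    by blast
qed

lemma partition_mono:
  fixes t :: "nat \<Rightarrow> real"
  assumes "\<And>i. i < n \<Longrightarrow> t i \<le> t (Suc i)" "i \<le> j" "j \<le> n"
  shows "t i \<le> t j"
  using assms(2,3)
proof (induction j rule: dec_induct)
  case (step k)
  then show ?case
    using assms(1)[of k] by simp
qed simp

text \<open>Banach's indicatrix: the variation is the integral over all levels of the number of
crossings.\<close>

lemma variation_le_crossings:
  fixes g :: "real \<Rightarrow> real"
  assumes cont: "continuous_on {0..1} g" and range: "\<And>s. s \<in> {0..1} \<Longrightarrow> a \<le> g s \<and> g s \<le> a + D"
    and D: "D \<ge> 0"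
    and cross: "\<And>c. (\<forall>s\<in>{0..1}. g s = c) \<or> (finite {s\<in>{0<..<1}. g s = c} \<and> card {s\<in>{0<..<1}. g s = c} \<le> m)"
    and t: "\<And>i. i < n \<Longrightarrow> t i \<le> t (Suc i)" "\<And>i. i \<le> n \<Longrightarrow> t i \<in> {0..1}"
  shows "(\<Sum>i<n. \<bar>g (t (Suc i)) - g (t i)\<bar>) \<le> real m * D"
proof -
  \<comment> \<open>Open intervals: a level in \<open>J i\<close> is attained strictly between
    \<open>t i\<close> and \<open>t (Suc i)\<close>. So different steps yield different crossings,
    and the end points 0 and 1 never have to be counted.\<close>
  define J where "J i = {min (g (t i)) (g (t (Suc i)))<..<max (g (t i)) (g (t (Suc i)))}" for i
  note tmono = partition_mono[of n t, OF t(1)]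
  have one: "\<bar>g (t (Suc i)) - g (t i)\<bar> = (LINT c|lborel. indicator (J i) c)" for i
    by (simp add: J_def max_def min_def)
  have "(\<Sum>i<n. \<bar>g (t (Suc i)) - g (t i)\<bar>) = (LINT c|lborel. (\<Sum>i<n. indicator (J i) c))"
    unfolding one by (subst Bochner_Integration.integral_sum) (auto simp: J_def)
  also have "\<dots> \<le> (LINT c|lborel. real m * indicator {a..a + D} c)"
  proof (rule integral_mono)
    show "integrable lborel (\<lambda>c. \<Sum>i<n. indicat_real (J i) c)"
      by (intro Bochner_Integration.integrable_sum) (auto simp: J_def)
    show "integrable lborel (\<lambda>c. real m * indicat_real {a..a + D} c)"
      using D by simp
    fix c :: real
    define I where "I = {i. i < n \<and> c \<in> J i}"
    have fI: "finite I"
      by (simp add: I_def)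
    have sumI: "(\<Sum>i<n. indicat_real (J i) c) = real (card I)"
      by (simp add: I_def indicator_def sum.If_cases Int_def lessThan_def)
    show "(\<Sum>i<n. indicat_real (J i) c) \<le> real m * indicator {a..a + D} c"
    proof (cases "I = {}")
      case True
      then show ?thesis
        by (simp add: sumI)
    next
      case False
      then obtain i where i: "i < n" "c \<in> J i"
        by (auto simp: I_def)
      have ran: "c \<in> {a..a + D}"
        using range[OF t(2)[of i]] range[OF t(2)[of "Suc i"]] i by (auto simp: J_def)
      have nconst: "\<not> (\<forall>s\<in>{0..1}. g s = c)"
      proof
        assume "\<forall>s\<in>{0..1}. g s = c"
        then have "g (t i) = c" "g (t (Suc i)) = c"
          using t(2)[of i] t(2)[of "Suc i"] i by simp_all
        then show False
          using i by (simp add: J_def)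
      qed
      have "\<exists>s. t i < s \<and> s < t (Suc i) \<and> g s = c" if i: "i \<in> I" for i
      proof -
        have i: "i < n" "c \<in> J i"
          using i by (auto simp: I_def)
        have sub: "{t i..t (Suc i)} \<subseteq> {0..1}"
          using t(2)[of i] t(2)[of "Suc i"] i by auto
        have c': "continuous_on {t i..t (Suc i)} g"
          by (rule continuous_on_subset[OF cont sub])
        have le: "t i \<le> t (Suc i)"
          using t(1) i by simp
        have "\<exists>s. t i \<le> s \<and> s \<le> t (Suc i) \<and> g s = c"
        proof (cases "g (t i) \<le> g (t (Suc i))")
          case True
          then show ?thesis
            using IVT'[of g "t i" c "t (Suc i)"] i le c' by (auto simp: J_def)
        next
          case False
          then show ?thesis
            using IVT2'[of g "t (Suc i)" c "t i"] i le c' by (auto simp: J_def)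
        qed
        then obtain s where s: "t i \<le> s" "s \<le> t (Suc i)" "g s = c"
          by blast
        moreover have "s \<noteq> t i" "s \<noteq> t (Suc i)"
          using s i by (auto simp: J_def)
        ultimately show ?thesis
          by (intro exI[of _ s]) auto
      qed
      then obtain \<sigma> where \<sigma>: "\<And>i. i \<in> I \<Longrightarrow> t i < \<sigma> i \<and> \<sigma> i < t (Suc i) \<and> g (\<sigma> i) = c"
        by metis
      have lt: "\<sigma> i < \<sigma> j" if "i \<in> I" "j \<in> I" "i < j" for i j
        using \<sigma>[OF that(1)] \<sigma>[OF that(2)] tmono[of "Suc i" j] that by (auto simp: I_def)
      have "inj_on \<sigma> I"
        using lt by (intro inj_onI) (metis less_irrefl nat_neq_iff)
      moreover have "\<sigma> ` I \<subseteq> {s\<in>{0<..<1}. g s = c}"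
      proof safe
        fix i assume i: "i \<in> I"
        then have "t i \<in> {0..1}" "t (Suc i) \<in> {0..1}"
          by (simp_all only: I_def mem_Collect_eq) (intro t(2); simp)+
        then show "\<sigma> i \<in> {0<..<1}" "g (\<sigma> i) = c"
          using \<sigma>[OF i] by auto
      qed
      ultimately have "card I \<le> m"
        using cross[of c] nconst card_mono[of "{s\<in>{0<..<1}. g s = c}" "\<sigma> ` I"] by (auto simp: card_image)
      then show ?thesis
        using ran by (simp add: sumI)
    qed
  qed
  also have "\<dots> = real m * D"
    using D by simp
  finally show ?thesis .
qed

lemma rho_Rd: "rho d K r \<in> Rd d"
  by (simp add: rho_def cg_def Rd_def)

text \<open>All three facts rest on the quotient \<open>N / V\<close> and on its limit, which gives
  the end point \<open>s = 1\<close> a meaning. A level \<open>c\<close> is attained at roots of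
  \<open>N - smult c V\<close>, and \<open>s / (1 - s)\<close> is injective on the open interval. If
  that polynomial is 0, the coordinate is constant, also at infinity.\<close>

lemma curv_path_coordinate:
  assumes d: "d > 0" and K: "body d K" and q: "q \<in> Rd d"
    and ball: "\<And>y. y \<in> cball_d d \<eta> \<Longrightarrow> vadd q y \<in> K" and \<eta>: "\<eta> > 0"
  shows curv_path_continuous: "continuous_on {0..1} (\<lambda>s. inner_d d u (curv_path d K s))"
    and curv_path_crossings: "(\<forall>s\<in>{0..1}. inner_d d u (curv_path d K s) = c) \<or>
        (finite {s\<in>{0<..<1}. inner_d d u (curv_path d K s) = c} \<and>
         card {s\<in>{0<..<1}. inner_d d u (curv_path d K s) = c} \<le> Suc d)"
    and curv_path_halfspace: "s \<in> {0..1} \<Longrightarrow> (\<And>x. x \<in> K \<Longrightarrow> inner_d d u x \<le> c) \<Longrightarrow>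
        inner_d d u (curv_path d K s) \<le> c"
proof -
  have "vadd q (\<lambda>_. 0) \<in> K"
    using ball \<eta> by simp
  then have Kne: "K \<noteq> {}"
    by blast
  obtain R where R: "R > 0" "K \<subseteq> cball_d d R"
    using body_bounded[OF K] by metis
  have half: "inner_d d u (rho d K r) \<le> c" if "r \<ge> 0" "\<And>x. x \<in> K \<Longrightarrow> inner_d d u x \<le> c" for u r c
    using inner_rho_le[OF K Kne, of "pad d u" c r] measure_mink_pos[OF K q ball \<eta>] that by simp
  have lim: "\<exists>l. ((\<lambda>r. inner_d d u (rho d K r)) \<longlongrightarrow> l) at_top" for u
  proof -
    obtain N V where NV: "\<And>r. r \<ge> 0 \<Longrightarrow> poly V r > 0"
      "\<And>r. r \<ge> 0 \<Longrightarrow> inner_d d u (rho d K r) = poly N r / poly V r"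
      using inner_rho_ratio[OF d K q ball \<eta>] by metis
    have "\<bar>inner_d d u (rho d K r)\<bar> \<le> norm_d d u * R" if r: "r \<ge> 0" for r
    proof -
      have *: "\<bar>inner_d d u x\<bar> \<le> norm_d d u * R" if "x \<in> K" for x
        using abs_affine_le[of x d R 0 u] that R by auto
      have "inner_d d u (rho d K r) \<le> norm_d d u * R"
        using * by (intro half[OF r]) (auto simp: abs_le_iff)
      moreover have "inner_d d (vscale (-1) u) (rho d K r) \<le> norm_d d u * R"
        using * by (intro half[OF r]) (auto simp: abs_le_iff inner_d_simps)
      ultimately show ?thesis
        by (simp add: inner_d_simps abs_le_iff)
    qed
    then have "\<exists>l. ((\<lambda>r. poly N r / poly V r) \<longlongrightarrow> l) at_top"
      using NV by (intro poly_ratio_limit[of V N "norm_d d u * R"]) auto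
    then obtain l where "((\<lambda>r. poly N r / poly V r) \<longlongrightarrow> l) at_top"
      by blast
    then have "((\<lambda>r. inner_d d u (rho d K r)) \<longlongrightarrow> l) at_top"
      by (rule Lim_transform_eventually) (auto simp: NV(2) intro!: eventually_mono[OF eventually_ge_at_top[of 0]])
    then show ?thesis
      by blast
  qed
  have coord: "((\<lambda>r. rho d K r i) \<longlongrightarrow> rho_inf d K i) at_top" if i: "i < d" for i
  proof -
    have "inner_d d (\<lambda>j. if j = i then 1 else 0) x = x i" for x
      using i by (simp add: inner_d_def if_distrib[of "\<lambda>a. a * _"] cong: if_cong)
    then obtain l where "((\<lambda>r. rho d K r i) \<longlongrightarrow> l) at_top"
      using lim[of "\<lambda>j. if j = i then 1 else 0"] by auto
    then show ?thesis
      unfolding rho_inf_def by (simp add: tendsto_Lim)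
  qed
  have lim_inf: "((\<lambda>r. inner_d d u (rho d K r)) \<longlongrightarrow> inner_d d u (rho_inf d K)) at_top" for u
    unfolding inner_d_def by (intro tendsto_sum tendsto_mult tendsto_const coord) simp
  let ?g = "\<lambda>s. inner_d d u (curv_path d K s)"
  obtain N V where NV: "degree N \<le> Suc d" "degree V \<le> Suc d" "\<And>r. r \<ge> 0 \<Longrightarrow> poly V r > 0"
      "\<And>r. r \<ge> 0 \<Longrightarrow> inner_d d u (rho d K r) = poly N r / poly V r"
    using inner_rho_ratio[OF d K q ball \<eta>] by metis
  have g: "?g s = poly N (s / (1 - s)) / poly V (s / (1 - s))" if "s \<in> {0..<1}" for s
    using that by (simp add: curv_path_def NV(4))
  show "continuous_on {0..1} ?g"
    unfolding continuous_on_def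
  proof
    fix s :: real assume s: "s \<in> {0..1}"
    show "(?g \<longlongrightarrow> ?g s) (at s within {0..1})"
    proof (cases "s = 1")
      case True
      have ev: "\<forall>\<^sub>F s in at (1::real) within {0..1}. 0 < 1 - s"
        by (auto simp: eventually_at_filter)
      have "((\<lambda>s::real. 1 - s) \<longlongrightarrow> 1 - 1) (at 1 within {0..1})"
        by (intro tendsto_intros)
      then have "filterlim (\<lambda>s::real. inverse (1 - s)) at_top (at 1 within {0..1})"
        using ev by (intro filterlim_inverse_at_top) auto
      then have "filterlim (\<lambda>s::real. s * inverse (1 - s)) at_top (at 1 within {0..1})"
        by (intro filterlim_tendsto_pos_mult_at_top[OF tendsto_ident_at]) auto
      then have "((\<lambda>s. inner_d d u (rho d K (s * inverse (1 - s)))) \<longlongrightarrow> inner_d d u (rho_inf d K)) (at 1 within {0..1})"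
        by (rule filterlim_compose[OF lim_inf])
      then have "(?g \<longlongrightarrow> inner_d d u (rho_inf d K)) (at 1 within {0..1})"
        by (rule Lim_transform_eventually) (use ev in \<open>auto elim!: eventually_mono simp: curv_path_def divide_inverse\<close>)
      then show ?thesis
        using True by (simp add: curv_path_def)
    next
      case False
      then have s1: "s < 1" "0 \<le> s"
        using s by auto
      have "((\<lambda>s. poly N (s / (1 - s)) / poly V (s / (1 - s))) \<longlongrightarrow> poly N (s / (1 - s)) / poly V (s / (1 - s))) (at s within {0..1})"
        using s1 NV(3)[of "s / (1 - s)"] by (intro tendsto_intros) auto
      moreover have "\<forall>\<^sub>F x in at s within {0..1}. poly N (x / (1 - x)) / poly V (x / (1 - x)) = ?g x"
      proof -
        have "\<forall>\<^sub>F x in at s within {0..1}. x < 1"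
          using s1 by (intro order_tendstoD[OF tendsto_ident_at])
        moreover have "\<forall>\<^sub>F x in at s within {0..1}. x \<in> {0..1}"
          by (auto simp: eventually_at_filter)
        ultimately show ?thesis
          by eventually_elim (use g in auto)
      qed
      ultimately show ?thesis
        using g[of s] s1 by (auto elim: Lim_transform_eventually)
    qed
  qed
  show "s \<in> {0..1} \<Longrightarrow> (\<And>x. x \<in> K \<Longrightarrow> inner_d d u x \<le> c) \<Longrightarrow> ?g s \<le> c"
  proof (cases "s < 1")
    case True
    assume "s \<in> {0..1}" "\<And>x. x \<in> K \<Longrightarrow> inner_d d u x \<le> c"
    then show ?thesis
      using True by (auto simp: curv_path_def intro!: half)
  next
    case False
    assume *: "s \<in> {0..1}" "\<And>x. x \<in> K \<Longrightarrow> inner_d d u x \<le> c"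
    have "inner_d d u (rho_inf d K) \<le> c"
      by (rule tendsto_upperbound[OF lim_inf eventually_mono[OF eventually_ge_at_top[of 0]]])
        (use * half in auto)
    then show ?thesis
      using False by (simp add: curv_path_def)
  qed
  show "(\<forall>s\<in>{0..1}. ?g s = c) \<or> (finite {s\<in>{0<..<1}. ?g s = c} \<and> card {s\<in>{0<..<1}. ?g s = c} \<le> Suc d)"
  proof (cases "N - smult c V = 0")
    case True
    then have "poly N r = c * poly V r" for r
      by (metis poly_smult right_minus_eq)
    then have eq: "inner_d d u (rho d K r) = c" if "r \<ge> 0" for r
      using NV(3,4)[OF that] by simp
    have "inner_d d u (rho_inf d K) = c"
      by (rule tendsto_unique[OF _ lim_inf])
         (auto intro!: tendsto_eventually eventually_mono[OF eventually_ge_at_top[of 0]] simp: eq)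
    then have "\<forall>s\<in>{0..1}. ?g s = c"
      using eq by (auto simp: curv_path_def)
    then show ?thesis ..
  next
    case False
    let ?P = "N - smult c V"
    let ?Z = "{s\<in>{0<..<1}. ?g s = c}"
    define h where "h s = s / (1 - s)" for s :: real
    have inj: "inj_on h ?Z"
    proof (rule inj_onI)
      fix x y assume "x \<in> ?Z" "y \<in> ?Z" "h x = h y"
      then have "x * (1 - y) = y * (1 - x)"
        unfolding h_def by (subst (asm) frac_eq_eq) auto
      then show "x = y"
        by (simp add: algebra_simps)
    qed
    have sub: "h ` ?Z \<subseteq> {r. poly ?P r = 0}"
    proof safe
      fix s assume "s \<in> {0<..<1::real}" "c = ?g s"
      then show "poly (N - smult (?g s) V) (h s) = 0"
        using g[of s] NV(3)[of "h s"] by (simp add: h_def)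
    qed
    have fin: "finite {r. poly ?P r = 0}"
      by (rule poly_roots_finite[OF False])
    have "card ?Z = card (h ` ?Z)"
      using inj by (simp add: card_image)
    also have "\<dots> \<le> card {r. poly ?P r = 0}"
      by (rule card_mono[OF fin sub])
    also have "\<dots> \<le> degree ?P"
      by (rule card_poly_roots_bound[OF False])
    also have "\<dots> \<le> Suc d"
      using NV by (intro degree_diff_le order_trans[OF degree_smult_le])
    finally have "card ?Z \<le> Suc d" .
    moreover have "finite ?Z"
      using finite_imageD[OF finite_subset[OF sub fin] inj] .
    ultimately show ?thesis
      by blast
  qed
qed

section \<open>Normalized coordinates, arc length and discretization\<close>

lemma lin_app_component: "i < d \<Longrightarrow> lin_app d M x i = inner_d d (M i) x"
  by (simp add: lin_app_def inner_d_def)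

lemma lin_app_Rd [simp]: "lin_app d M x \<in> Rd d"
  by (simp add: lin_app_def Rd_def)

lemma lin_app_add: "lin_app d M (vadd x y) = vadd (lin_app d M x) (lin_app d M y)"
  by (auto simp: lin_app_def vadd_def algebra_simps sum.distrib)

lemma lin_app_scale: "lin_app d M (vscale c x) = vscale c (lin_app d M x)"
  by (auto simp: lin_app_def vscale_def algebra_simps sum_distrib_left)

lemma norm_lin_app_le: "norm_d d (lin_app d M x) \<le> (\<Sum>i<d. norm_d d (M i)) * norm_d d x"
proof -
  have "norm_d d (lin_app d M x) \<le> (\<Sum>i<d. \<bar>lin_app d M x i\<bar>)"
    by (rule norm_d_le_sum_abs)
  also have "\<dots> \<le> (\<Sum>i<d. norm_d d (M i) * norm_d d x)"
    by (intro sum_mono) (simp add: lin_app_component inner_d_Cauchy_Schwarz)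
  finally show ?thesis
    by (simp add: sum_distrib_right)
qed

text \<open>The three factors: \<open>d\<close> coordinates, at most \<open>Suc d\<close> crossings
  of each level, and a range of length \<open>2 d\<close> for each coordinate, because the
  normalized path stays in the ball of radius \<open>d\<close>.\<close>

lemma arclen_curv_path_le:
  assumes d: "d > 0" and K: "body d K" and q: "q \<in> Rd d"
    and ball: "\<And>y. y \<in> cball_d d \<eta> \<Longrightarrow> vadd q y \<in> K" and \<eta>: "\<eta> > 0"
    and sub: "lin_app d M ` K \<subseteq> {vadd c y | y. y \<in> cball_d d (real d)}"
  shows "arclen d (lin_app d M \<circ> curv_path d K) 0 1 \<le> ereal (real d * (real (Suc d) * (2 * real d)))"
  unfolding arclen_def
proof (rule SUP_least)
  fix nt :: "nat \<times> (nat \<Rightarrow> real)"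
  assume nt: "nt \<in> {(n, t). t 0 = 0 \<and> t n = 1 \<and> (\<forall>i<n. t i \<le> t (Suc i))}"
  obtain n t where [simp]: "nt = (n, t)"
    by force
  have t: "t 0 = 0" "t n = 1" "\<And>i. i < n \<Longrightarrow> t i \<le> t (Suc i)"
    using nt by auto
  note mono = partition_mono[of n t, OF t(3)]
  have t01: "t i \<in> {0..1}" if "i \<le> n" for i
    using mono[of 0 i] mono[of i n] that t by auto
  define g where "g j s = inner_d d (M j) (curv_path d K s)" for j s
  have range: "c j - real d \<le> g j s \<and> g j s \<le> (c j - real d) + 2 * real d" if j: "j < d" and s: "s \<in> {0..1}" for j s
  proof -
    have b: "\<bar>inner_d d (M j) x - c j\<bar> \<le> real d" if x: "x \<in> K" for x
    proof -
      obtain y where y: "y \<in> cball_d d (real d)" "lin_app d M x = vadd c y"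
        using sub x by blast
      have "inner_d d (M j) x = c j + y j"
        using fun_cong[OF y(2), of j] j by (simp add: lin_app_component vadd_def)
      then show ?thesis
        using abs_component_le_norm_d[OF j, of y] y by (auto simp: cball_d_def)
    qed
    have b': "inner_d d (M j) x \<le> c j + real d" "inner_d d (vscale (-1) (M j)) x \<le> real d - c j" if "x \<in> K" for x
      using b[OF that] unfolding inner_d_simps by linarith+
    have "inner_d d (M j) (curv_path d K s) \<le> c j + real d"
      by (rule curv_path_halfspace[OF d K q ball \<eta> s b'(1)])
    moreover have "inner_d d (vscale (-1) (M j)) (curv_path d K s) \<le> real d - c j"
      by (rule curv_path_halfspace[OF d K q ball \<eta> s b'(2)])
    ultimately show ?thesis
      by (auto simp: g_def inner_d_simps)
  qed
  have var: "(\<Sum>i<n. \<bar>g j (t (Suc i)) - g j (t i)\<bar>) \<le> real (Suc d) * (2 * real d)" if j: "j < d" for j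
  proof (rule variation_le_crossings[where g = "g j" and t = t and a = "c j - real d"])
    show "continuous_on {0..1} (g j)"
      unfolding g_def by (rule curv_path_continuous[OF d K q ball \<eta>])
    show "(\<forall>s\<in>{0..1}. g j s = e) \<or> (finite {s\<in>{0<..<1}. g j s = e} \<and> card {s\<in>{0<..<1}. g j s = e} \<le> Suc d)" for e
      unfolding g_def by (rule curv_path_crossings[OF d K q ball \<eta>])
  qed (use range[OF j] t t01 in auto)
  have "(\<Sum>i<n. norm_d d (vsub ((lin_app d M \<circ> curv_path d K) (t (Suc i))) ((lin_app d M \<circ> curv_path d K) (t i))))
     \<le> (\<Sum>i<n. \<Sum>j<d. \<bar>g j (t (Suc i)) - g j (t i)\<bar>)"
    by (intro sum_mono order_trans[OF norm_d_le_sum_abs]) (simp add: vsub_def lin_app_component g_def)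
  also have "\<dots> = (\<Sum>j<d. \<Sum>i<n. \<bar>g j (t (Suc i)) - g j (t i)\<bar>)"
    by (rule sum.swap)
  also have "\<dots> \<le> (\<Sum>j<d. real (Suc d) * (2 * real d))"
    by (intro sum_mono var) simp
  finally show "ereal (\<Sum>i<fst nt. norm_d d (vsub ((lin_app d M \<circ> curv_path d K) (snd nt (Suc i))) ((lin_app d M \<circ> curv_path d K) (snd nt i))))
      \<le> ereal (real d * (real (Suc d) * (2 * real d)))"
    by simp
qed

lemma norm_le_arclen:
  assumes "a \<le> b" "b \<le> c"
  shows "ereal (norm_d d (vsub (\<gamma> b) (\<gamma> a))) \<le> arclen d \<gamma> a c"
proof -
  define t :: "nat \<Rightarrow> real" where "t i = (if i = 0 then a else if i = 1 then b else c)" for i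
  have "(2, t) \<in> {(n, t). t 0 = a \<and> t n = c \<and> (\<forall>i<n. t i \<le> t (Suc i))}"
    using assms by (auto simp: t_def)
  then have "ereal (\<Sum>i<fst (2::nat, t). norm_d d (vsub (\<gamma> (snd (2::nat, t) (Suc i))) (\<gamma> (snd (2::nat, t) i)))) \<le> arclen d \<gamma> a c"
    unfolding arclen_def by (rule SUP_upper)
  moreover have "(\<Sum>i<fst (2::nat, t). norm_d d (vsub (\<gamma> (snd (2::nat, t) (Suc i))) (\<gamma> (snd (2::nat, t) i))))
      = norm_d d (vsub (\<gamma> b) (\<gamma> a)) + norm_d d (vsub (\<gamma> c) (\<gamma> b))"
    by (simp add: t_def numeral_2_eq_2)
  moreover have "ereal (norm_d d (vsub (\<gamma> b) (\<gamma> a))) \<le> ereal (norm_d d (vsub (\<gamma> b) (\<gamma> a)) + norm_d d (vsub (\<gamma> c) (\<gamma> b)))"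
    by simp
  ultimately show ?thesis
    by (metis order_trans)
qed

text \<open>The unit ball in the normalized picture, pulled back to \<open>K\<close>. It supplies
  the inner ball that the results on \<open>K + r B\<close> assume, so every knowledge set that is
  discretized has interior points.\<close>

lemma discretization_ball:
  assumes disc: "is_discretization d k K p" and K: "K \<subseteq> Rd d"
  obtains q \<eta> where "q \<in> Rd d" "\<eta> > 0" "\<And>y. y \<in> cball_d d \<eta> \<Longrightarrow> vadd q y \<in> K"
proof -
  obtain M c where M: "invertible_d d M" "c \<in> Rd d" "{vadd c y | y. y \<in> cball_d d 1} \<subseteq> lin_app d M ` K"
    using disc unfolding is_discretization_def by (elim exE conjE) (rule that)
  obtain N where N: "\<And>x. x \<in> Rd d \<Longrightarrow> lin_app d N (lin_app d M x) = x"
    using M(1) unfolding invertible_d_def by blast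
  define C where "C = (\<Sum>i<d. norm_d d (M i))"
  have C: "C \<ge> 0"
    by (simp add: C_def sum_nonneg)
  show ?thesis
  proof
    show "lin_app d N c \<in> Rd d"
      by simp
    show "1 / (1 + C) > 0"
      using C by simp
    fix y assume y: "y \<in> cball_d d (1 / (1 + C))"
    have "norm_d d (lin_app d M y) \<le> C * norm_d d y"
      unfolding C_def by (rule norm_lin_app_le)
    also have "\<dots> \<le> C * (1 / (1 + C))"
      using y C by (intro mult_left_mono) (auto simp: cball_d_def)
    also have "\<dots> \<le> 1"
      using C by (simp add: divide_le_eq)
    finally have "lin_app d M y \<in> cball_d d 1"
      by (simp add: cball_d_def)
    then obtain x where x: "x \<in> K" "vadd c (lin_app d M y) = lin_app d M x"
      using M(3) by blast
    have "x = lin_app d N (vadd c (lin_app d M y))"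
      unfolding x(2) using x(1) K N by auto
    also have "\<dots> = vadd (lin_app d N c) y"
      using y N by (simp add: lin_app_add cball_d_def)
    finally show "vadd (lin_app d N c) y \<in> K"
      using x by simp
  qed
qed

lemma curv_path_Rd: "curv_path d K s \<in> Rd d"
proof -
  have "rho_inf d K i = 0" if "i \<ge> d" for i
  proof -
    have "rho d K r i = 0" for r
      using rho_Rd[of d K r] that by (simp add: Rd_def)
    then show ?thesis
      by (simp add: rho_inf_def tendsto_Lim)
  qed
  then show ?thesis
    by (simp add: curv_path_def rho_Rd) (simp add: Rd_def)
qed

text \<open>In normalized coordinates the difference \<open>e\<close> has length at most
  \<open>\<epsilon>\<close>, the length of one piece, and \<open>K\<close> contains a unit ball
  there. So \<open>e / \<epsilon>\<close> can be added to and subtracted from a centre inside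
  \<open>K\<close>, and \<open>e\<close> is \<open>\<epsilon> / 2\<close> times a difference of two
  points of \<open>K\<close>. This one pair bounds the error by the width in all directions at
  once.\<close>

lemma discretization_near_path:
  assumes disc: "is_discretization d k K p" and K: "body d K" and d: "d > 0" and k: "k > 0" and r: "r \<ge> 0"
  defines "\<epsilon> \<equiv> real d * (real (Suc d) * (2 * real d)) / real k"
  obtains i a b where "i \<le> k" "a \<in> K" "b \<in> K"
    "\<And>v. inner_d d v (rho d K r) - inner_d d v (p i) = \<epsilon> / 2 * (inner_d d v b - inner_d d v a)"
proof -
  have KRd: "K \<subseteq> Rd d"
    using K by (simp add: body_def)
  obtain q \<eta> where ball: "q \<in> Rd d" "\<eta> > 0" "\<And>y. y \<in> cball_d d \<eta> \<Longrightarrow> vadd q y \<in> K"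
    using discretization_ball[OF disc KRd] by metis
  obtain M c s where M: "invertible_d d M" "c \<in> Rd d" "{vadd c y | y. y \<in> cball_d d 1} \<subseteq> lin_app d M ` K"
     "lin_app d M ` K \<subseteq> {vadd c y | y. y \<in> cball_d d (real d)}"
    and s: "s 0 = 0" "s k = 1" "\<forall>i<k. s i \<le> s (Suc i)"
     "\<forall>i<k. arclen d (lin_app d M \<circ> curv_path d K) (s i) (s (Suc i))
                 = arclen d (lin_app d M \<circ> curv_path d K) 0 1 / ereal (real k)"
     "\<forall>i\<le>k. p i = curv_path d K (s i)"
    using disc unfolding is_discretization_def by (elim exE conjE) (rule that)
  obtain N where N: "\<And>x. x \<in> Rd d \<Longrightarrow> lin_app d N (lin_app d M x) = x"
    using M(1) unfolding invertible_d_def by blast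
  let ?\<gamma> = "lin_app d M \<circ> curv_path d K"
  have \<epsilon>: "\<epsilon> > 0"
    using d k by (simp add: \<epsilon>_def)
  define s0 where "s0 = r / (1 + r)"
  have s0: "0 \<le> s0" "s0 < 1" "s0 / (1 - s0) = r"
    using r by (auto simp: s0_def field_simps)
  \<comment> \<open>The last division point not after \<open>s0\<close>; it is not the end point, as
    \<open>s k = 1\<close> and \<open>s0 < 1\<close>.\<close>
  define i where "i = (GREATEST i. i \<le> k \<and> s i \<le> s0)"
  have i: "i \<le> k \<and> s i \<le> s0"
    unfolding i_def by (rule GreatestI_nat[of _ 0 k]) (use s s0 in auto)
  have ik: "i < k"
    using i s s0 by (cases "i = k") auto
  have si: "s0 \<le> s (Suc i)"
  proof (rule ccontr)
    assume "\<not> s0 \<le> s (Suc i)"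
    then have "Suc i \<le> i"
      unfolding i_def by (intro Greatest_le_nat[of _ _ k]) (use ik in \<open>auto simp: i_def\<close>)
    then show False
      by simp
  qed
  define e where "e = vsub (rho d K r) (p i)"
  have eRd: "e \<in> Rd d"
    using i s by (simp add: e_def rho_Rd curv_path_Rd)
  have "lin_app d M e = vsub (?\<gamma> s0) (?\<gamma> (s i))"
    using i s s0 by (auto simp: e_def curv_path_def lin_app_def vsub_def algebra_simps sum_subtractf)
  then have "ereal (norm_d d (lin_app d M e)) \<le> arclen d ?\<gamma> (s i) (s (Suc i))"
    using norm_le_arclen[of "s i" s0 "s (Suc i)" d ?\<gamma>] i si by simp
  also have "\<dots> = arclen d ?\<gamma> 0 1 / ereal (real k)"
    using s ik by simp
  also have "\<dots> \<le> ereal (real d * (real (Suc d) * (2 * real d))) / ereal (real k)"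
    using k by (intro ereal_divide_right_mono arclen_curv_path_le[OF d K ball(1,3,2) M(4)]) auto
  also have "\<dots> = ereal \<epsilon>"
    using k by (simp add: \<epsilon>_def)
  finally have Me: "norm_d d (lin_app d M e) \<le> \<epsilon>"
    by simp
  have inK: "vadd (lin_app d N c) (vscale (l / \<epsilon>) e) \<in> K" if l: "\<bar>l\<bar> = 1" for l
  proof -
    have "norm_d d (lin_app d M (vscale (l / \<epsilon>) e)) = norm_d d (lin_app d M e) / \<epsilon>"
      using l \<epsilon> by (simp add: lin_app_scale norm_d_scale)
    also have "\<dots> \<le> 1"
      using Me \<epsilon> by simp
    finally have "lin_app d M (vscale (l / \<epsilon>) e) \<in> cball_d d 1"
      by (simp add: cball_d_def)
    then obtain x where x: "x \<in> K" "vadd c (lin_app d M (vscale (l / \<epsilon>) e)) = lin_app d M x"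
      using M(3) by blast
    have "x = lin_app d N (vadd c (lin_app d M (vscale (l / \<epsilon>) e)))"
      unfolding x(2) using x(1) KRd N by auto
    also have "\<dots> = vadd (lin_app d N c) (vscale (l / \<epsilon>) e)"
      using N[of "vscale (l / \<epsilon>) e"] eRd by (simp add: lin_app_add)
    finally show ?thesis
      using x by simp
  qed
  show ?thesis
  proof
    show "i \<le> k"
      using ik by simp
    show "vadd (lin_app d N c) (vscale (- 1 / \<epsilon>) e) \<in> K" "vadd (lin_app d N c) (vscale (1 / \<epsilon>) e) \<in> K"
      using inK[of "-1"] inK[of 1] by auto
    show "inner_d d v (rho d K r) - inner_d d v (p i) = \<epsilon> / 2 *
      (inner_d d v (vadd (lin_app d N c) (vscale (1 / \<epsilon>) e)) - inner_d d v (vadd (lin_app d N c) (vscale (- 1 / \<epsilon>) e)))" for v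
      using \<epsilon> by (simp add: inner_d_simps) (simp add: e_def inner_d_simps)
  qed
qed

subsection \<open>Cuts near the centroid\<close>

lemma cg_inner_le:
  assumes L: "body d L" and pos: "vol d L > 0" and le: "\<And>x. x \<in> L \<Longrightarrow> inner_d d v x \<le> c"
  shows "inner_d d v (cg d L) \<le> c"
proof -
  have "aff_int d 0 v L \<le> (LINT x:L|lebv d. c)"
    unfolding aff_int_def
    using affine_set_integrable_body[OF L, of 0 v] affine_set_integrable_body[OF L, of c "\<lambda>_. 0"] le
    by (intro set_integral_mono) (auto simp: inner_d_def)
  also have "\<dots> = c * vol d L"
    using sets_borel_body[OF L] body_emeasure_finite[OF L] by (subst set_integral_const) auto
  finally show ?thesis
    using pos by (simp add: inner_cg[OF L] divide_le_eq)
qed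

text \<open>The contractions with ratio \<open>1 - 1/(2d)\<close> towards \<open>a\<close> and towards \<open>b\<close> map \<open>L\<close> into itself
and keep half of the volume, and the two images of a point differ by \<open>(b - a)/(2d)\<close>. This weak form
of Gruenbaum's inequality does not need the Brunn-Minkowski theorem.\<close>

lemma mean_deviation_ge:
  assumes d: "d > 0" and L: "body d L" and ab: "a \<in> L" "b \<in> L"
  shows "(LINT x:L|lebv d. \<bar>\<alpha> + inner_d d v x\<bar>) \<ge> vol d L * (inner_d d v b - inner_d d v a) / (8 * real d)"
proof -
  define c where "c = 1 - 1 / (2 * real d)"
  have c: "c > 0" "c \<le> 1"
    using d by (auto simp: c_def field_simps)
  \<comment> \<open>Bernoulli's inequality: this is why the ratio is
    \<open>1 - 1/(2 d)\<close>.\<close>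
  have cd: "c ^ d \<ge> 1/2"
    using Bernoulli_inequality[of "- (1 / (2 * real d))" d] d by (simp add: c_def field_simps)
  have m [measurable]: "L \<in> sets borel"
    by (rule sets_borel_body[OF L])
  have LRd: "L \<subseteq> Rd d"
    using L by (simp add: body_def)
  define h where "h x = indicator L x * \<bar>\<alpha> + inner_d d v x\<bar>" for x
  have hm [measurable]: "h \<in> borel_measurable borel"
    unfolding h_def by measurable
  define T where "T e x = vadd (vscale (1 - c) e) (vscale c x)" for e x
  obtain R where R: "L \<subseteq> cball_d d R"
    using body_bounded[OF L] by metis
  have Lint: "set_integrable (lebv d) L (\<lambda>x. \<bar>\<alpha>' + inner_d d u x\<bar>)" for \<alpha>' u
    by (intro set_integrable_abs affine_set_integrable_body[OF L])
  have hint: "integrable (lebv d) h"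
    using Lint by (simp add: h_def[abs_def] set_integrable_def)
  have innT: "\<alpha> + inner_d d v (T e x) = (\<alpha> + (1 - c) * inner_d d v e) + inner_d d (vscale c v) x" for e x
    by (simp add: T_def inner_d_simps)
  \<comment> \<open>Change of variables: the image of \<open>L\<close> under the contraction is part
    of \<open>L\<close>, so its integral is at most the one over \<open>L\<close>, and the Jacobian
    gives the factor.\<close>
  have step: "(LINT x:L|lebv d. \<bar>\<alpha> + inner_d d v (T e x)\<bar>) \<le> inverse c ^ d * (LINT x|lebv d. h x)" if e: "e \<in> L" for e
  proof -
    have "(LINT x|lebv d. h (T e x)) = inverse c ^ d * (LINT x|lebv d. h (vadd (vscale (1 - c) e) x))"
      unfolding T_def using integral_lebv_scale[OF c(1), of "\<lambda>x. h (vadd (vscale (1 - c) e) x)"] by simp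
    also have "(LINT x|lebv d. h (vadd (vscale (1 - c) e) x)) = (LINT x|lebv d. h x)"
      using e LRd by (intro integral_lebv_translate) auto
    finally have eq: "(LINT x|lebv d. h (T e x)) = inverse c ^ d * (LINT x|lebv d. h x)" .
    have TL: "T e x \<in> L" if "x \<in> L" for x
    proof -
      have "vadd (vscale (1 - c) e) (vscale c x) \<in> L"
        using L e that c by (auto simp: body_def vconvex_def)
      then show ?thesis
        by (simp add: T_def)
    qed
    have hTi: "integrable (lebv d) (\<lambda>x. h (T e x))"
      unfolding T_def using e LRd
      by (intro integrable_lebv_scale[OF c(1), of d "\<lambda>x. h (vadd (vscale (1 - c) e) x)"]
          integrable_lebv_translate[OF _ hint]) auto
    have "(LINT x:L|lebv d. \<bar>\<alpha> + inner_d d v (T e x)\<bar>) \<le> (LINT x|lebv d. h (T e x))"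
      unfolding set_lebesgue_integral_def
    proof (rule integral_mono)
      show "integrable (lebv d) (\<lambda>x. indicat_real L x *\<^sub>R \<bar>\<alpha> + inner_d d v (T e x)\<bar>)"
        using Lint unfolding innT set_integrable_def .
    qed (use hTi TL in \<open>auto simp: h_def indicator_def\<close>)
    then show ?thesis
      by (simp add: eq)
  qed
  \<comment> \<open>The two images of \<open>x\<close> differ in height by the same amount for every
    \<open>x\<close>, so the affine function cannot be small at both.\<close>
  have "(LINT x:L|lebv d. (1 - c) * (inner_d d v b - inner_d d v a))
     \<le> (LINT x:L|lebv d. \<bar>\<alpha> + inner_d d v (T a x)\<bar> + \<bar>\<alpha> + inner_d d v (T b x)\<bar>)"
  proof (rule set_integral_mono)
    show "set_integrable (lebv d) L (\<lambda>x. (1 - c) * (inner_d d v b - inner_d d v a))"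
      using affine_set_integrable_body[OF L, of "(1 - c) * (inner_d d v b - inner_d d v a)" "\<lambda>_. 0"] by (simp add: inner_d_def)
    show "set_integrable (lebv d) L (\<lambda>x. \<bar>\<alpha> + inner_d d v (T a x)\<bar> + \<bar>\<alpha> + inner_d d v (T b x)\<bar>)"
      unfolding innT by (intro set_integral_add(1) Lint)
    fix x
    have "(1 - c) * (inner_d d v b - inner_d d v a) = (\<alpha> + inner_d d v (T b x)) - (\<alpha> + inner_d d v (T a x))"
      by (simp add: T_def inner_d_simps algebra_simps)
    then show "(1 - c) * (inner_d d v b - inner_d d v a) \<le> \<bar>\<alpha> + inner_d d v (T a x)\<bar> + \<bar>\<alpha> + inner_d d v (T b x)\<bar>"
      by linarith
  qed
  also have "\<dots> = (LINT x:L|lebv d. \<bar>\<alpha> + inner_d d v (T a x)\<bar>) + (LINT x:L|lebv d. \<bar>\<alpha> + inner_d d v (T b x)\<bar>)"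
    unfolding innT by (intro set_integral_add(2) Lint)
  also have "\<dots> \<le> 2 * (inverse c ^ d * (LINT x|lebv d. h x))"
    using step[OF ab(1)] step[OF ab(2)] by linarith
  finally have "(1 - c) * (inner_d d v b - inner_d d v a) * vol d L \<le> 2 * (inverse c ^ d * (LINT x|lebv d. h x))"
    using m body_emeasure_finite[OF L] by (subst (asm) set_integral_const) (auto simp: mult.commute)
  also have "\<dots> \<le> 2 * (2 * (LINT x|lebv d. h x))"
  proof (intro mult_left_mono mult_right_mono)
    show "inverse c ^ d \<le> 2"
      using le_imp_inverse_le[OF cd] by (simp add: power_inverse)
    show "0 \<le> (LINT x|lebv d. h x)"
      by (intro integral_nonneg_AE AE_I2) (simp add: h_def)
  qed simp
  finally have "(1 - c) * (inner_d d v b - inner_d d v a) * vol d L / 4 \<le> (LINT x|lebv d. h x)"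
    by simp
  moreover have "(1 - c) * (inner_d d v b - inner_d d v a) * vol d L / 4
     = vol d L * (inner_d d v b - inner_d d v a) / (8 * real d)"
    by (simp add: c_def)
  ultimately show ?thesis
    by (simp add: h_def set_lebesgue_integral_def)
qed

text \<open>The height \<open>\<phi>\<close> of the centroid over \<open>x\<close> has mean 0 on
  \<open>L\<close>, so the integral of \<open>\<bar>\<phi>\<bar> + \<phi>\<close> is that of
  \<open>\<bar>\<phi>\<bar>\<close>, at least \<open>\<omega> / (8 d)\<close> times the volume. On
  \<open>A\<close> the integrand is at most \<open>\<omega> / (16 d)\<close>, and elsewhere it
  exceeds this by at most \<open>2 \<omega>\<close>; hence \<open>L - A\<close> must have at least
  the fraction \<open>1 / (32 d)\<close> of the volume. The hypotheses on \<open>\<omega>\<close>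
  say that it is the width of \<open>L\<close> in direction \<open>v\<close>.\<close>

lemma cut_measure_le:
  assumes d: "d > 0" and L: "body d L" and pos: "vol d L > 0"
    and \<omega>: "\<omega> > 0" "\<And>a b. a \<in> L \<Longrightarrow> b \<in> L \<Longrightarrow> inner_d d v b - inner_d d v a \<le> \<omega>"
    and \<omega>': "\<And>m. (\<And>a b. a \<in> L \<Longrightarrow> b \<in> L \<Longrightarrow> inner_d d v b - inner_d d v a \<le> m) \<Longrightarrow> \<omega> \<le> m"
    and A: "body d A" "A \<subseteq> L" "\<And>x. x \<in> A \<Longrightarrow> inner_d d v (cg d L) - inner_d d v x \<le> \<omega> / (32 * real d)"
  shows "vol d A \<le> (1 - 1 / (32 * real d)) * vol d L"
proof -
  define g where "g = inner_d d v (cg d L)"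
  define \<phi> where "\<phi> x = g + inner_d d (vscale (-1) v) x" for x
  have \<phi>: "\<phi> x = g - inner_d d v x" for x
    by (simp add: \<phi>_def inner_d_simps)
  let ?V = "vol d L"
  have m: "L \<in> sets borel" "A \<in> sets borel"
    using L A by (auto intro: sets_borel_body)
  have i\<phi>: "set_integrable (lebv d) L \<phi>"
    unfolding \<phi>_def by (rule affine_set_integrable_body[OF L])
  have "(LINT x:L|lebv d. \<phi> x) = (LINT x:L|lebv d. g) - aff_int d 0 v L"
    unfolding \<phi> aff_int_def using affine_set_integrable_body[OF L, of g "\<lambda>_. 0"] affine_set_integrable_body[OF L, of 0 v]
    by (subst set_integral_diff(2)[symmetric]) (auto simp: inner_d_def)
  also have "(LINT x:L|lebv d. g) = g * ?V"
    using m body_emeasure_finite[OF L] by (subst set_integral_const) auto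
  also have "aff_int d 0 v L = g * ?V"
    using pos by (simp add: g_def inner_cg[OF L])
  finally have zero: "(LINT x:L|lebv d. \<phi> x) = 0"
    by simp
  have dev: "?V * \<omega> / (8 * real d) \<le> (LINT x:L|lebv d. \<bar>\<phi> x\<bar>)"
  proof -
    have "\<omega> \<le> (LINT x:L|lebv d. \<bar>\<phi> x\<bar>) * (8 * real d) / ?V"
    proof (rule \<omega>')
      fix a b assume "a \<in> L" "b \<in> L"
      then have "?V * (inner_d d (vscale (-1) v) a - inner_d d (vscale (-1) v) b) / (8 * real d) \<le> (LINT x:L|lebv d. \<bar>\<phi> x\<bar>)"
        unfolding \<phi>_def by (intro mean_deviation_ge[OF d L])
      then show "inner_d d v b - inner_d d v a \<le> (LINT x:L|lebv d. \<bar>\<phi> x\<bar>) * (8 * real d) / ?V"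
        using pos d by (simp add: inner_d_simps field_simps)
    qed
    then show ?thesis
      using pos d by (simp add: field_simps)
  qed
  have gle: "g \<le> inner_d d v x + \<omega>" if "x \<in> L" for x
    unfolding g_def using \<omega>(2)[OF that] by (intro cg_inner_le[OF L pos]) (simp add: algebra_simps)
  have iB: "integrable (lebv d) (indicat_real (L - A))"
    using m body_emeasure_finite[OF L] emeasure_mono[of "L - A" L "lebv d"]
    by (intro integrable_real_indicator) (auto simp: less_top intro: le_less_trans)
  have iL: "integrable (lebv d) (indicat_real L)"
    using m body_emeasure_finite[OF L] by (intro integrable_real_indicator) auto
  have "(LINT x:L|lebv d. \<bar>\<phi> x\<bar> + \<phi> x) \<le> (LINT x|lebv d. \<omega> / (16 * real d) * indicator L x + 2 * \<omega> * indicator (L - A) x)"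
    unfolding set_lebesgue_integral_def
  proof (rule integral_mono)
    show "integrable (lebv d) (\<lambda>x. indicat_real L x *\<^sub>R (\<bar>\<phi> x\<bar> + \<phi> x))"
      using set_integral_add(1)[OF set_integrable_abs[OF i\<phi>] i\<phi>] by (simp add: set_integrable_def)
    show "integrable (lebv d) (\<lambda>x. \<omega> / (16 * real d) * indicat_real L x + 2 * \<omega> * indicat_real (L - A) x)"
      by (intro Bochner_Integration.integrable_add integrable_mult_right iL iB)
    fix x
    have w0: "\<omega> / (16 * real d) > 0" "\<omega> / (32 * real d) * 2 = \<omega> / (16 * real d)"
      using \<omega>(1) d by auto
    show "indicat_real L x *\<^sub>R (\<bar>\<phi> x\<bar> + \<phi> x) \<le> \<omega> / (16 * real d) * indicat_real L x + 2 * \<omega> * indicat_real (L - A) x"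
    proof (cases "x \<in> A")
      case True
      then have "\<phi> x \<le> \<omega> / (32 * real d)"
        using A(3) by (simp add: \<phi> g_def)
      then have "\<bar>\<phi> x\<bar> + \<phi> x \<le> \<omega> / (16 * real d)"
        using w0 by linarith
      then show ?thesis
        using True A(2) by (auto simp: indicator_def)
    next
      case False
      show ?thesis
      proof (cases "x \<in> L")
        case True
        then have "\<bar>\<phi> x\<bar> + \<phi> x \<le> \<omega> / (16 * real d) + 2 * \<omega>"
          using gle[OF True] w0 \<omega>(1) by (simp add: \<phi>)
        then show ?thesis
          using True False by (simp add: indicator_def)
      qed (simp add: indicator_def)
    qed
  qed
  also have "\<dots> = \<omega> / (16 * real d) * ?V + 2 * \<omega> * vol d (L - A)"
    using iL iB m by simp
  also have "vol d (L - A) = ?V - vol d A"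
    using m A body_emeasure_finite[OF L] by (subst measure_Diff) auto
  finally have "(LINT x:L|lebv d. \<bar>\<phi> x\<bar>) \<le> \<omega> / (16 * real d) * ?V + 2 * \<omega> * (?V - vol d A)"
    using i\<phi> zero by (simp add: set_integral_add set_integrable_abs)
  with dev have "\<omega> * (?V / (8 * real d)) \<le> \<omega> * (?V / (16 * real d) + 2 * (?V - vol d A))"
    by (simp add: algebra_simps)
  then have "?V / (8 * real d) \<le> ?V / (16 * real d) + 2 * (?V - vol d A)"
    using \<omega>(1) by (simp only: mult_le_cancel_left_pos)
  moreover have "?V / (8 * real d) = 4 * (?V / (32 * real d))" "?V / (16 * real d) = 2 * (?V / (32 * real d))"
    by simp_all
  ultimately show ?thesis
    by (simp add: algebra_simps)
qed

subsection \<open>The volume potential\<close>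

text \<open>To be used with \<open>v i\<close> the optimal action minus the list entry
  \<open>xi i\<close>: at \<open>w\<close> the optimum is better by at least \<open>h\<close>, at
  \<open>p i\<close> it is not better at all. This is demanded for every \<open>i\<close>, because
  which \<open>p i\<close> is near the centroid depends on \<open>r\<close>.\<close>

lemma round_measure_decrease:
  assumes d: "d \<ge> 2" and K: "body d K" and disc: "is_discretization d (200 * d ^ 4) K p" and w: "w \<in> K"
    and K': "body d K'" "K' \<subseteq> K" and h: "h > 0"
    and v: "\<And>i. i \<le> 200 * d ^ 4 \<Longrightarrow> inner_d d (v i) (p i) \<le> 0 \<and> h \<le> inner_d d (v i) w \<and>
        norm_d d (v i) \<le> 2 \<and> (\<forall>x\<in>K'. 0 \<le> inner_d d (v i) x)"
  defines "r \<equiv> h / (100 * real d)"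
  shows "vol d (mink d K' r) \<le> (1 - 1 / (32 * real d)) * vol d (mink d K r)"
proof -
  have d0: "d > 0" "real d \<ge> 2"
    using d by auto
  have r: "r > 0"
    using h d0 by (simp add: r_def)
  define k where "k = 200 * d ^ 4"
  have k: "k > 0"
    using d0 by (simp add: k_def)
  define \<epsilon> where "\<epsilon> = real d * (real (Suc d) * (2 * real d)) / real k"
  have \<epsilon>: "\<epsilon> \<ge> 0" "\<epsilon> \<le> 3 / (200 * real d)"
  proof -
    show "\<epsilon> \<ge> 0"
      by (simp add: \<epsilon>_def)
    \<comment> \<open>\<open>Suc d\<close> is at most \<open>3/2 * d\<close> because
      \<open>d\<close> is at least 2. Three powers of \<open>d\<close> against
      \<open>k = 200 * d ^ 4\<close> leave the factor \<open>1 / d\<close> that the cut can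
      tolerate.\<close>
    have "\<epsilon> \<le> real d * (3 / 2 * real d * (2 * real d)) / real k"
      unfolding \<epsilon>_def using d0 by (intro divide_right_mono mult_left_mono mult_right_mono) auto
    also have "\<dots> = 3 / (200 * real d)"
      using d0 by (simp add: k_def power4_eq_xxxx)
    finally show "\<epsilon> \<le> 3 / (200 * real d)" .
  qed
  obtain i a b where i: "i \<le> k" "a \<in> K" "b \<in> K"
    "\<And>v. inner_d d v (rho d K r) - inner_d d v (p i) = \<epsilon> / 2 * (inner_d d v b - inner_d d v a)"
    using discretization_near_path[OF disc K d0(1), folded k_def \<epsilon>_def, OF k less_imp_le[OF r]] by metis
  define u where "u = v i"
  have u: "inner_d d u (p i) \<le> 0" "h \<le> inner_d d u w" "norm_d d u \<le> 2" "\<And>x. x \<in> K' \<Longrightarrow> 0 \<le> inner_d d u x"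
    using v[of i] i by (auto simp: u_def k_def)
  let ?L = "mink d K r"
  have L: "body d ?L"
    by (rule body_mink[OF K])
  have KL: "K \<subseteq> ?L"
    unfolding mink_msum using r by (intro subset_msum) simp
  obtain q \<eta> where ball: "q \<in> Rd d" "\<eta> > 0" "\<And>y. y \<in> cball_d d \<eta> \<Longrightarrow> vadd q y \<in> K"
    using discretization_ball[OF disc] K by (auto simp: body_def)
  have pos: "vol d ?L > 0"
    using measure_mink_pos[OF K ball(1,3,2)] r by simp
  obtain R where R: "?L \<subseteq> cball_d d R"
    using body_bounded[OF L] by metis
  define D where "D = {inner_d d u y - inner_d d u x | x y. x \<in> ?L \<and> y \<in> ?L}"
  define \<omega> where "\<omega> = Sup D"
  have bdd: "bdd_above D"
  proof (rule bdd_aboveI)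
    fix z assume "z \<in> D"
    then obtain x y where "x \<in> ?L" "y \<in> ?L" "z = inner_d d u y - inner_d d u x"
      by (auto simp: D_def)
    moreover from this have "\<bar>inner_d d u x\<bar> \<le> norm_d d u * R" "\<bar>inner_d d u y\<bar> \<le> norm_d d u * R"
      using abs_affine_le[of x d R 0 u] abs_affine_le[of y d R 0 u] R by auto
    ultimately show "z \<le> norm_d d u * R + norm_d d u * R"
      by linarith
  qed
  have \<omega>_ub: "inner_d d u y - inner_d d u x \<le> \<omega>" if "x \<in> ?L" "y \<in> ?L" for x y
    unfolding \<omega>_def by (rule cSup_upper[OF _ bdd]) (use that in \<open>auto simp: D_def\<close>)
  have wL: "w \<in> ?L"
    using w KL by auto
  have \<omega>_least: "\<omega> \<le> m" if "\<And>x y. x \<in> ?L \<Longrightarrow> y \<in> ?L \<Longrightarrow> inner_d d u y - inner_d d u x \<le> m" for m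
    unfolding \<omega>_def
  proof (rule cSup_least)
    show "D \<noteq> {}"
      using wL unfolding D_def by blast
  qed (use that in \<open>auto simp: D_def\<close>)
  have \<omega>0: "\<omega> \<ge> 0"
    using \<omega>_ub[OF wL wL] by simp
  define g where "g = inner_d d u (cg d ?L)"
  have g_near: "g \<le> \<epsilon> / 2 * \<omega>"
  proof -
    have "g = inner_d d u (p i) + \<epsilon> / 2 * (inner_d d u b - inner_d d u a)"
      using i(4)[of u] by (simp add: g_def rho_def)
    also have "\<dots> \<le> 0 + \<epsilon> / 2 * \<omega>"
      using u(1) \<omega>_ub[of a b] i KL \<epsilon> by (intro add_mono mult_left_mono) auto
    finally show ?thesis
      by simp
  qed
  \<comment> \<open>The point \<open>w\<close> has height at least \<open>h\<close> along
    \<open>u\<close>, while the centroid is at most slightly above 0. So the width is not much below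
    \<open>h\<close>.\<close>
  have "inner_d d (vscale (-1) u) (cg d ?L) \<le> \<omega> - inner_d d u w"
    using \<omega>_ub[OF _ wL] by (intro cg_inner_le[OF L pos]) (simp add: inner_d_simps algebra_simps)
  then have g_low: "h \<le> g + \<omega>"
    using u(2) by (simp add: g_def inner_d_simps)
  have \<epsilon>\<omega>: "\<epsilon> / 2 * \<omega> \<le> 3 / 400 * (\<omega> / real d)"
    using mult_right_mono[OF \<epsilon>(2), of "\<omega> / 2"] \<omega>0 by (simp add: field_simps)
  have "\<omega> / real d \<le> \<omega> / 2"
    using d0 \<omega>0 by (intro divide_left_mono) auto
  then have h_le: "h \<le> 101 / 100 * \<omega>"
    using g_low g_near \<epsilon>\<omega> \<omega>0 by linarith
  then have \<omega>: "\<omega> > 0"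
    using h by simp
  have "r \<le> 101 / 10000 * (\<omega> / real d)"
    using divide_right_mono[OF h_le, of "100 * real d"] d0 by (simp add: r_def)
  \<comment> \<open>In units of \<open>\<omega> / d\<close>: 3/400 for the discretization and
    \<open>2 * 101/10000\<close> for the radius add up to 277/10000, below 1/32. This is the room
    that the constants 200 in \<open>k\<close> and 100 in \<open>r\<close> provide.\<close>
  then have r_le: "g + 2 * r \<le> \<omega> / (32 * real d)"
  proof -
    have "\<omega> / (32 * real d) = (\<omega> / real d) / 32" "\<omega> / real d > 0"
      using \<omega> d0 by auto
    then show ?thesis
      using g_near \<epsilon>\<omega> \<open>r \<le> 101 / 10000 * (\<omega> / real d)\<close> by linarith
  qed
  show ?thesis
  proof (rule cut_measure_le[OF d0(1) L pos \<omega> \<omega>_ub \<omega>_least body_mink[OF K'(1)]])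
    show "mink d K' r \<subseteq> ?L"
      unfolding mink_msum using K' by (intro msum_mono) auto
    fix x assume "x \<in> mink d K' r"
    then obtain x' y where x: "x' \<in> K'" "y \<in> cball_d d r" "x = vadd x' y"
      by (auto simp: mink_def)
    have "\<bar>inner_d d u y\<bar> \<le> norm_d d u * norm_d d y"
      by (rule inner_d_Cauchy_Schwarz)
    also have "\<dots> \<le> 2 * r"
      using u(3) x(2) r by (intro mult_mono) (auto simp: cball_d_def)
    finally have "- (2 * r) \<le> inner_d d u x"
      using u(4)[OF x(1)] by (simp add: x inner_d_simps)
    then show "inner_d d u (cg d ?L) - inner_d d u x \<le> \<omega> / (32 * real d)"
      using r_le by (simp add: g_def)
  qed auto
qed

lemma body_halfspace:
  assumes K: "body d K" shows "body d (K \<inter> {v \<in> Rd d. inner_d d u v \<ge> 0})"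
proof -
  have "closed {v. inner_d d u v \<ge> 0}"
    by (intro closed_Collect_le continuous_inner_d continuous_on_const)
  then have "compact (K \<inter> (Rd d \<inter> {v. inner_d d u v \<ge> 0}))"
    using K closed_Rd by (intro compact_Int_closed closed_Int) (auto simp: body_def)
  moreover have "Rd d \<inter> {v. inner_d d u v \<ge> 0} = {v \<in> Rd d. inner_d d u v \<ge> 0}"
    by auto
  moreover have "vconvex (K \<inter> {v \<in> Rd d. inner_d d u v \<ge> 0})"
    using K by (auto simp: vconvex_def body_def inner_d_simps)
  ultimately show ?thesis
    using K by (auto simp: body_def)
qed

lemma body_halfspaces:
  assumes "finite I" "body d K"
  shows "body d (K \<inter> (\<Inter>x\<in>I. {v \<in> Rd d. inner_d d (f x) v \<ge> 0}))"
  using assms(1)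
proof (induction I)
  case (insert x I)
  have "K \<inter> (\<Inter>x\<in>insert x I. {v \<in> Rd d. inner_d d (f x) v \<ge> 0}) =
     (K \<inter> (\<Inter>x\<in>I. {v \<in> Rd d. inner_d d (f x) v \<ge> 0})) \<inter> {v \<in> Rd d. inner_d d (f x) v \<ge> 0}"
    by auto
  then show ?case
    using body_halfspace[OF insert.IH] by simp
qed (use assms in simp)

text \<open>When \<open>J\<close> grows by 1, the remainder \<open>1 / 2 ^ J\<close> is halved.
  Either the new layer is active and pays for the loss, or \<open>l\<close> is already below the new
  remainder.\<close>

lemma dyadic_layers:
  fixes l :: real
  assumes "l \<le> 2"
  shows "l \<le> 1 / 2 ^ J + (\<Sum>j\<le>J. 1 / 2 ^ j * of_bool (1 / 2 ^ j < l))"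
proof (induction J)
  case (Suc J)
  show ?case
  proof (cases "1 / 2 ^ Suc J < l")
    case True
    then show ?thesis
      using Suc by simp
  next
    case False
    have "0 \<le> (\<Sum>j\<le>Suc J. 1 / 2 ^ j * of_bool (1 / 2 ^ j < l) :: real)"
      by (intro sum_nonneg) auto
    then show ?thesis
      using False by linarith
  qed
qed (use assms in auto)

text \<open>The 9 stems from \<open>ln_dyadic_le\<close>; only the resulting bound 20, independent
  of \<open>J\<close>, is used.\<close>

lemma weighted_geometric_sum: "(\<Sum>j\<le>J. (9 + real j) / 2 ^ j) = 20 - (real J + 11) / 2 ^ J"
proof (induction J)
  case (Suc J)
  then show ?case
    by (simp add: field_simps)
qed simp

lemma alg_run_bounds:
  assumes d: "d \<ge> 2" and w: "w \<in> cball_d d 1" and run: "alg_run d T w X xs K p xi L"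
  defines "loss \<equiv> \<lambda>t. inner_d d w (xs t) - Max ((\<lambda>x. inner_d d w x) ` L t)"
  shows alg_run_loss_le_2: "t \<in> {1..T} \<Longrightarrow> loss t \<le> 2"
    and alg_run_large_losses:
      "h > 0 \<Longrightarrow> real (card {t\<in>{1..T}. h < loss t}) \<le> 32 * (real d)\<^sup>2 * ln (1 + 100 * real d / h)"
proof -
  define k where "k = 200 * d ^ 4"
  have K1: "K 1 = cball_d d 1"
    using run by (simp add: alg_run_def Let_def)
  have R: "X t \<subseteq> cball_d d 1" "is_discretization d k (K t) (p t)"
    "\<And>i. i \<le> k \<Longrightarrow> xi t i \<in> X t" "\<And>i x. i \<le> k \<Longrightarrow> x \<in> X t \<Longrightarrow> inner_d d (p t i) x \<le> inner_d d (p t i) (xi t i)"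
    "L t = xi t ` {0..k}" "xs t \<in> X t" "\<And>x. x \<in> X t \<Longrightarrow> inner_d d x w \<le> inner_d d (xs t) w"
    "K (Suc t) = K t \<inter> (\<Inter>x\<in>L t. {v \<in> Rd d. inner_d d (vsub (xs t) x) v \<ge> 0})"
    if "t \<in> {1..T}" for t
    using bspec[OF conjunct2[OF run[unfolded alg_run_def Let_def, folded k_def]] that] by (elim conjE; simp)+
  have fin: "finite (L t)" if "t \<in> {1..T}" for t
    using R(5)[OF that] by simp
  \<comment> \<open>The list is judged by its best entry, so every entry is at least this bad, in
    particular the one whose \<open>p t i\<close> happens to be near the centroid.\<close>
  have loss_le: "loss t \<le> inner_d d (vsub (xs t) (xi t i)) w" if t: "t \<in> {1..T}" and i: "i \<le> k" for t i
  proof -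
    have "inner_d d w (xi t i) \<le> Max ((\<lambda>x. inner_d d w x) ` L t)"
      using fin[OF t] R(5)[OF t] i by (intro Max_ge) auto
    then show ?thesis
      by (simp add: loss_def inner_d_simps inner_d_commute[of d w])
  qed
  have norm2: "norm_d d (vsub (xs t) (xi t i)) \<le> 2" if t: "t \<in> {1..T}" and i: "i \<le> k" for t i
  proof -
    have "norm_d d (xs t) \<le> 1" "norm_d d (xi t i) \<le> 1"
      using R(1,6)[OF t] R(3)[OF t i] by (auto simp: cball_d_def)
    then show ?thesis
      using norm_d_triangle_sub[of d "xs t" "xi t i"] by linarith
  qed
  show "loss t \<le> 2" if t: "t \<in> {1..T}"
  proof -
    have "loss t \<le> norm_d d (vsub (xs t) (xi t 0)) * norm_d d w"
      using loss_le[OF t, of 0] inner_d_Cauchy_Schwarz[of d "vsub (xs t) (xi t 0)" w] by simp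
    also have "\<dots> \<le> 2 * 1"
      using norm2[OF t, of 0] w by (intro mult_mono) (auto simp: cball_d_def)
    finally show ?thesis
      by simp
  qed
  \<comment> \<open>Knowledge sets are numbered from 1: \<open>K (Suc t)\<close> is the one after
    \<open>t\<close> rounds.\<close>
  have inv: "body d (K (Suc t)) \<and> w \<in> K (Suc t)" if "t \<le> T" for t
    using that
  proof (induction t)
    case 0
    then show ?case
      using K1 w body_cball_d by simp
  next
    case (Suc t)
    then have t: "Suc t \<in> {1..T}" and IH: "body d (K (Suc t))" "w \<in> K (Suc t)"
      by auto
    have "body d (K (Suc (Suc t)))"
      unfolding R(8)[OF t] by (rule body_halfspaces[OF fin[OF t] IH(1)])
    moreover have "inner_d d (vsub (xs (Suc t)) x) w \<ge> 0" if x: "x \<in> L (Suc t)" for x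
    proof -
      have "x \<in> X (Suc t)"
        using x R(3)[OF t] unfolding R(5)[OF t] by auto
      then show ?thesis
        using R(7)[OF t] by (simp add: inner_d_simps)
    qed
    ultimately show ?case
      using IH w unfolding R(8)[OF t] by (auto simp: cball_d_def)
  qed
  show "real (card {t\<in>{1..T}. h < loss t}) \<le> 32 * (real d)\<^sup>2 * ln (1 + 100 * real d / h)" if h: "h > 0"
  proof -
    define r where "r = h / (100 * real d)"
    have r: "r > 0"
      using h d by (simp add: r_def)
    define \<gamma> where "\<gamma> = 1 - 1 / (32 * real d)"
    have \<gamma>: "\<gamma> > 0"
      using d by (simp add: \<gamma>_def field_simps)
    let ?V = "\<lambda>t. vol d (mink d (K t) r)"
    \<comment> \<open>Rounds of small loss need no estimate: the knowledge sets decrease, so the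
      potential never grows.\<close>
    have bound: "?V (Suc t) \<le> \<gamma> ^ card {s\<in>{1..t}. h < loss s} * ?V 1" if "t \<le> T" for t
      using that
    proof (induction t)
      case (Suc t)
      then have t: "Suc t \<in> {1..T}" and IH: "?V (Suc t) \<le> \<gamma> ^ card {s\<in>{1..t}. h < loss s} * ?V 1"
        by auto
      have b: "body d (K (Suc t))" "w \<in> K (Suc t)" "body d (K (Suc (Suc t)))"
        using inv[of t] inv[of "Suc t"] Suc.prems by auto
      have sub: "K (Suc (Suc t)) \<subseteq> K (Suc t)"
        using R(8)[OF t] by auto
      show ?case
      proof (cases "h < loss (Suc t)")
        case True
        have "?V (Suc (Suc t)) \<le> \<gamma> * ?V (Suc t)"
          unfolding \<gamma>_def r_def
        proof (rule round_measure_decrease[OF d b(1) _ b(2,3) sub h, where v = "\<lambda>i. vsub (xs (Suc t)) (xi (Suc t) i)"])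
          show "is_discretization d (200 * d ^ 4) (K (Suc t)) (p (Suc t))"
            using R(2)[OF t] by (simp add: k_def)
          fix i assume "i \<le> 200 * d ^ 4"
          then have i: "i \<le> k"
            by (simp add: k_def)
          have "inner_d d (vsub (xs (Suc t)) (xi (Suc t) i)) (p (Suc t) i) \<le> 0"
            using R(4)[OF t i R(6)[OF t]] by (simp add: inner_d_simps inner_d_commute[of d "p (Suc t) i"])
          moreover have "h \<le> inner_d d (vsub (xs (Suc t)) (xi (Suc t) i)) w"
            using True loss_le[OF t i] by simp
          moreover have "\<forall>x\<in>K (Suc (Suc t)). 0 \<le> inner_d d (vsub (xs (Suc t)) (xi (Suc t) i)) x"
            using i unfolding R(8)[OF t] R(5)[OF t] by auto
          ultimately show "inner_d d (vsub (xs (Suc t)) (xi (Suc t) i)) (p (Suc t) i) \<le> 0 \<and>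
            h \<le> inner_d d (vsub (xs (Suc t)) (xi (Suc t) i)) w \<and>
            norm_d d (vsub (xs (Suc t)) (xi (Suc t) i)) \<le> 2 \<and>
            (\<forall>x\<in>K (Suc (Suc t)). 0 \<le> inner_d d (vsub (xs (Suc t)) (xi (Suc t) i)) x)"
            using norm2[OF t i] by blast
        qed
        also have "\<dots> \<le> \<gamma> * (\<gamma> ^ card {s\<in>{1..t}. h < loss s} * ?V 1)"
          using IH \<gamma> by (intro mult_left_mono) auto
        also have "\<dots> = \<gamma> ^ card {s\<in>{1..Suc t}. h < loss s} * ?V 1"
        proof -
          have "{s\<in>{1..Suc t}. h < loss s} = insert (Suc t) {s\<in>{1..t}. h < loss s}"
            using True by (auto simp: le_Suc_eq)
          then show ?thesis
            by simp
        qed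
        finally show ?thesis .
      next
        case False
        have "?V (Suc (Suc t)) \<le> ?V (Suc t)"
          using b sub unfolding mink_msum by (intro measure_mono_body msum_mono body_msum body_cball_d) auto
        also have "\<dots> \<le> \<gamma> ^ card {s\<in>{1..t}. h < loss s} * ?V 1"
          by (rule IH)
        also have "{s\<in>{1..t}. h < loss s} = {s\<in>{1..Suc t}. h < loss s}"
          using False by (auto simp: le_Suc_eq)
        finally show ?thesis .
      qed
    qed simp
    define n where "n = card {t\<in>{1..T}. h < loss t}"
    let ?vB = "vol d (cball_d d 1)"
    have vB: "?vB > 0"
      by (rule measure_cball_d_pos) simp
    have wRd: "w \<in> Rd d"
      using w by (simp add: cball_d_def)
    have bw: "body d (vadd w ` cball_d d r)"
      by (rule body_translate[OF body_cball_d wRd])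
    \<comment> \<open>The hidden point survives all cuts, so the final potential is at least the
      volume of a ball of radius \<open>r\<close> around it.\<close>
    have "r ^ d * ?vB = vol d (cball_d d r)"
      using measure_cball_d[OF r, of d] by simp
    also have "\<dots> = vol d (vadd w ` cball_d d r)"
      using wRd bw by (intro measure_translate[symmetric]) (auto intro: sets_borel_body)
    also have "\<dots> \<le> ?V (Suc T)"
    proof (rule measure_mono_body[OF _ bw body_mink])
      show "vadd w ` cball_d d r \<subseteq> mink d (K (Suc T)) r"
        using inv[of T] by (auto simp: mink_def)
    qed (use inv[of T] in simp)
    also have "\<dots> \<le> \<gamma> ^ n * ?V 1"
      unfolding n_def by (rule bound) simp
    also have "?V 1 = (1 + r) ^ d * ?vB"
      unfolding K1 mink_msum using r measure_cball_d[of "1 + r" d] by (simp add: cball_d_add)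
    finally have "r ^ d \<le> \<gamma> ^ n * (1 + r) ^ d"
      using vB by (simp add: mult.assoc[symmetric])
    moreover have "\<gamma> \<le> exp (- (1 / (32 * real d)))"
      using exp_ge_add_one_self[of "- (1 / (32 * real d))"] by (simp add: \<gamma>_def)
    then have "\<gamma> ^ n \<le> exp (- (1 / (32 * real d))) ^ n"
      using \<gamma> by (intro power_mono) auto
    ultimately have "r ^ d \<le> exp (- (real n / (32 * real d))) * (1 + r) ^ d"
      using r by (auto simp: exp_of_nat_mult[symmetric] intro: order_trans mult_right_mono)
    then have "ln (r ^ d) \<le> ln (exp (- (real n / (32 * real d))) * (1 + r) ^ d)"
      using r by (intro ln_mono) auto
    then have "real d * ln r \<le> - (real n / (32 * real d)) + real d * ln (1 + r)"
      using r by (simp add: ln_mult ln_realpow)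
    then have "real n / (32 * real d) \<le> real d * (ln (1 + r) - ln r)"
      by (simp add: algebra_simps)
    also have "ln (1 + r) - ln r = ln (1 + 100 * real d / h)"
    proof -
      have "(1 + r) / r = 1 + 100 * real d / h"
        using h d by (simp add: r_def field_simps)
      moreover have "ln ((1 + r) / r) = ln (1 + r) - ln r"
        using r by (simp add: ln_div)
      ultimately show ?thesis
        by simp
    qed
    finally have "real n \<le> real d * ln (1 + 100 * real d / h) * (32 * real d)"
      using d by (simp add: divide_le_eq)
    then show ?thesis
      by (simp add: n_def power2_eq_square algebra_simps)
  qed
qed

text \<open>\<open>1 + 100 d 2^j\<close> is at most \<open>2^8 d 2^j\<close>, and \<open>d\<close>
  at least 2 allows replacing each 2 by \<open>d\<close>. The argument is then at most
  \<open>d^(9 + j)\<close>, so that constants and scales both become multiples of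
  \<open>ln d\<close>.\<close>

lemma ln_dyadic_le:
  assumes d: "d \<ge> 2"
  shows "ln (1 + 100 * real d / (1 / 2 ^ j)) \<le> (9 + real j) * ln (real d)"
proof -
  have d1: "real d \<ge> 2"
    using d by simp
  have "1 + 100 * real d / (1 / 2 ^ j) \<le> 2 ^ 8 * real d * 2 ^ j"
  proof -
    have "1 * 1 \<le> real d * 2 ^ j"
      using d1 by (intro mult_mono) auto
    then show ?thesis
      by simp
  qed
  also have "\<dots> \<le> real d ^ 8 * real d * real d ^ j"
    using d1 by (intro mult_mono power_mono) auto
  also have "\<dots> = real d ^ (9 + j)"
    by (simp add: power_add eval_nat_numeral)
  finally have "ln (1 + 100 * real d / (1 / 2 ^ j)) \<le> ln (real d ^ (9 + j))"
    using d1 by (intro ln_mono) (auto intro: add_pos_nonneg)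
  then show ?thesis
    using d1 by (simp add: ln_realpow)
qed

theorem theorem5p4:
  shows "\<exists>C. \<forall>d\<ge>2. \<forall>T w X xs K p xi L.
           w \<in> cball_d d 1 \<and> alg_run d T w X xs K p xi L \<longrightarrow>
           regret d T w xs L \<le> C * real d ^ 2 * ln (real d)"
proof (intro exI[of _ "641 :: real"] allI impI, elim conjE)
  fix d T w X xs K p xi L
  assume d: "2 \<le> d" and w: "w \<in> cball_d d 1" and run: "alg_run d T w X xs K p xi L"
  define loss where "loss = (\<lambda>t. inner_d d w (xs t) - Max ((\<lambda>x. inner_d d w x) ` L t))"
  have le2: "loss t \<le> 2" if "t \<in> {1..T}" for t
    using alg_run_loss_le_2[OF d w run that] by (simp add: loss_def)
  \<comment> \<open>Below level \<open>J\<close> each round contributes at most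
    \<open>1 / 2 ^ J\<close>, hence all \<open>T\<close> rounds together less than 1. This makes the
    bound independent of \<open>T\<close>.\<close>
  obtain J where J: "real T < 2 ^ J"
    using real_arch_pow[of 2 "real T"] by auto
  have N: "(\<Sum>t=1..T. of_bool (1 / 2 ^ j < loss t)) \<le> 32 * (real d)\<^sup>2 * ((9 + real j) * ln (real d))" for j
  proof -
    have "(\<Sum>t=1..T. of_bool (1 / 2 ^ j < loss t)) = real (card {t\<in>{1..T}. 1 / 2 ^ j < loss t})"
      by (simp add: of_bool_def sum.If_cases Int_def)
    also have "\<dots> \<le> 32 * (real d)\<^sup>2 * ln (1 + 100 * real d / (1 / 2 ^ j))"
      unfolding loss_def by (rule alg_run_large_losses[OF d w run]) simp
    also have "\<dots> \<le> 32 * (real d)\<^sup>2 * ((9 + real j) * ln (real d))"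
      by (intro mult_left_mono ln_dyadic_le d) simp
    finally show ?thesis .
  qed
  have ln_d: "1 \<le> (real d)\<^sup>2 * ln (real d)"
  proof -
    have "2\<^sup>2 * (2 / 3) \<le> (real d)\<^sup>2 * ln (real d)"
    proof (rule mult_mono)
      have "2 / 3 \<le> ln (2 :: real)"
        using ln2_ge_two_thirds by simp
      also have "\<dots> \<le> ln (real d)"
        using d by simp
      finally show "2 / 3 \<le> ln (real d)" .
      show "2\<^sup>2 \<le> (real d)\<^sup>2"
        using d by (intro power_mono) auto
    qed auto
    then show ?thesis
      by simp
  qed
  have "regret d T w xs L = (\<Sum>t=1..T. loss t)"
    by (simp add: regret_def loss_def)
  also have "\<dots> \<le> (\<Sum>t=1..T. 1 / 2 ^ J + (\<Sum>j\<le>J. 1 / 2 ^ j * of_bool (1 / 2 ^ j < loss t)))"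
    by (intro sum_mono dyadic_layers le2)
  also have "\<dots> = real T / 2 ^ J + (\<Sum>j\<le>J. 1 / 2 ^ j * (\<Sum>t=1..T. of_bool (1 / 2 ^ j < loss t)))"
    unfolding sum.distrib sum_distrib_left by (subst sum.swap) simp
  also have "\<dots> \<le> 1 + (\<Sum>j\<le>J. 1 / 2 ^ j * (32 * (real d)\<^sup>2 * ((9 + real j) * ln (real d))))"
    using J by (intro add_mono sum_mono mult_left_mono N) auto
  also have "(\<Sum>j\<le>J. 1 / 2 ^ j * (32 * (real d)\<^sup>2 * ((9 + real j) * ln (real d))))
     = 32 * ((real d)\<^sup>2 * ln (real d)) * (\<Sum>j\<le>J. (9 + real j) / 2 ^ j)"
    unfolding sum_distrib_left by (intro sum.cong refl) simp
  also have "\<dots> \<le> 32 * ((real d)\<^sup>2 * ln (real d)) * 20"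
    unfolding weighted_geometric_sum using ln_d by (intro mult_left_mono) auto
  \<comment> \<open>\<open>641 = 32 * 20 + 1\<close>, where the 1 for the smallest losses is
    absorbed by \<open>ln_d\<close>.\<close>
  finally show "regret d T w xs L \<le> 641 * (real d)\<^sup>2 * ln (real d)"
    using ln_d by simp
qed

end
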